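(* Let $\mathrm{Re}\,\alpha>0$. Let $(A(u))$, $u\in\mathbb{R}^n$, be a measurable family of real $n\times n$ matrices which, where defined, are self-adjoint and commute with each other, and let, in addition, the matrix $A(u)$ be positive definite for almost every $u$. Fix an orthogonal matrix $C$ with $C^{-1}A(u)C=\mathrm{diag}(a_1(u),\dots,a_n(u))$ for all $u$ for which $A(u)$ is defined. Assume that the system of equations $a_k(u)=e^{t_k}$, $k=1,\dots,n$, has a unique solution $u=b(t)=(b_1(t),\dots,b_n(t))$ for almost every $t=(t_1,\dots,t_n)\in\mathbb{R}^n$, so that one has a measurable map $b:\mathbb{R}^n\to\mathbb{R}^n$ which is almost bijective. Let $K$ be a locally Lebesgue integrable function on $\mathbb{R}^n$ such that $A(u)$ is defined and $\det A(u)\neq0$ for almost every $u$ in the support of $K$ and $|\det A(u)|^{-1/2}K(u)\in L^1(\mathbb{R}^n)$. Let the scalar symbol satisfy $\varphi_{K,A}\ge 0$ and let the fractional power $\varphi_{K,A}^\alpha$ be the Fourier transform of a function $Q_\alpha\in L^1(\mathbb{R}^n)$. Then the fractional power $\mathcal{H}_{K,A}^\alpha$ is also a Hausdorff operator of the form $\mathcal{H}_{K_\alpha,A}$ (with some kernel $K_\alpha$ and the same family $A$) bounded in $L^2(\mathbb{R}^n)$.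
   Context: For a locally Lebesgue integrable function $K$ on $\mathbb{R}^n$ such that $A(u)$ is defined and $\det A(u)\neq0$ for almost every $u$ in the support of $K$, the Hausdorff operator with kernel $K$ is $\mathcal{H}_{K,A}f(x)=\int_{\mathbb{R}^n}K(u)f(A(u)x)\,du$, where $x\in\mathbb{R}^n$ is a column vector. The condition $|\det A(u)|^{-1/2}K(u)\in L^1(\mathbb{R}^n)$ guarantees that it is bounded on $L^2(\mathbb{R}^n)$. The numbers $a_1(u),\dots,a_n(u)$ are the eigenvalues of $A(u)$ with multiplicities. The scalar symbol of $\mathcal{H}_{K,A}$ is $$\varphi_{K,A}(s)=\int_{\mathbb{R}^n}K(u)\,a(u)^{-\frac12-is}\,du,\quad s=(s_1,\dots,s_n)\in\mathbb{R}^n,$$ where $a(u)^{-\frac12-is}=\prod_{k=1}^n\exp\big((-\tfrac12-is_k)\log a_k(u)\big)$. The Fourier transform is $\widehat g(s)=\int_{\mathbb{R}^n}g(t)e^{-is\cdot t}\,dt$. For a non-negative bounded operator $B$ in a Hilbert space $\mathfrak{H}$, the fractional power $B^\alpha$, $\mathrm{Re}\,\alpha>0$, is given for every positive integer $m>\mathrm{Re}\,\alpha$ by $$B^\alpha f=\frac{\Gamma(m)}{\Gamma(\alpha)\Gamma(m-\alpha)}\int_0^\infty t^{\alpha-1}\big(B(t+B)^{-1}\big)^m f\,dt,\quad f\in\mathfrak{H}.$$ Under the stated hypotheses $\mathcal{H}_{K,A}$ is a non-negative operator in $L^2(\mathbb{R}^n)$.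
   Formalization: The map b is assumed measurable for Lebesgue sets on both sides (Borel-target measurability makes the claim false), and K_α is shown integrable only on compact sets where det A is bounded, since full local integrability of K_α can fail. *)

theory Defs
  imports "HOL-Analysis.Analysis"
begin

section \<open>The complex Hilbert space of square integrable functions\<close>

definition square_integrable :: "('a::euclidean_space \<Rightarrow> complex) \<Rightarrow> bool" where
  "square_integrable f \<longleftrightarrow>
     f \<in> borel_measurable lebesgue \<and> integrable lebesgue (\<lambda>x. (cmod (f x))\<^sup>2)"

definition L2_eq :: "('a::euclidean_space \<Rightarrow> complex) \<Rightarrow> ('a \<Rightarrow> complex) \<Rightarrow> bool" where
  "L2_eq f g \<longleftrightarrow>
     square_integrable f \<and> square_integrable g \<and> (AE x in lebesgue. f x = g x)"

lemma square_integrable_zero: "square_integrable (\<lambda>x. 0)"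
  by (simp add: square_integrable_def)

lemma square_integrable_scale:
  assumes "square_integrable f" shows "square_integrable (\<lambda>x. c * f x)"
  using assms by (auto simp: square_integrable_def norm_mult power_mult_distrib)

lemma square_integrable_add:
  assumes f: "square_integrable f" and g: "square_integrable g"
  shows "square_integrable (\<lambda>x. f x + g x)"
proof -
  have [measurable]: "f \<in> borel_measurable lebesgue" "g \<in> borel_measurable lebesgue"
    using f g by (auto simp: square_integrable_def)
  have "integrable lebesgue (\<lambda>x. 2 * (cmod (f x))\<^sup>2 + 2 * (cmod (g x))\<^sup>2)"
    using f g by (auto simp: square_integrable_def)
  moreover have "(cmod (f x + g x))\<^sup>2 \<le> 2 * (cmod (f x))\<^sup>2 + 2 * (cmod (g x))\<^sup>2" for x
  proof -
    have "(cmod (f x + g x))\<^sup>2 \<le> (cmod (f x) + cmod (g x))\<^sup>2"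
      by (intro power_mono norm_triangle_ineq) auto
    also have "\<dots> \<le> 2 * (cmod (f x))\<^sup>2 + 2 * (cmod (g x))\<^sup>2"
      using sum_squares_bound[of "cmod (f x)" "cmod (g x)"] by (simp add: power2_sum)
    finally show ?thesis .
  qed
  ultimately have "integrable lebesgue (\<lambda>x. (cmod (f x + g x))\<^sup>2)"
    by (rule_tac Bochner_Integration.integrable_bound) auto
  then show ?thesis by (simp add: square_integrable_def)
qed

lemma square_integrable_diff:
  assumes "square_integrable f" "square_integrable g"
  shows "square_integrable (\<lambda>x. f x - g x)"
  using square_integrable_add[OF assms(1) square_integrable_scale[OF assms(2), of "-1"]] by simp

lemma integrable_square_integrable_mult:
  assumes f: "square_integrable f" and g: "square_integrable g"
  shows "integrable lebesgue (\<lambda>x. f x * cnj (g x))"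
proof -
  have [measurable]: "f \<in> borel_measurable lebesgue" "g \<in> borel_measurable lebesgue"
    using f g by (auto simp: square_integrable_def)
  have "integrable lebesgue (\<lambda>x. (cmod (f x))\<^sup>2 + (cmod (g x))\<^sup>2)"
    using f g by (auto simp: square_integrable_def)
  moreover have "cmod (f x * cnj (g x)) \<le> (cmod (f x))\<^sup>2 + (cmod (g x))\<^sup>2" for x
  proof -
    have "cmod (f x) * cmod (g x) \<le> 2 * cmod (f x) * cmod (g x)"
      by simp
    also have "\<dots> \<le> (cmod (f x))\<^sup>2 + (cmod (g x))\<^sup>2"
      by (rule sum_squares_bound)
    finally show ?thesis by (simp add: norm_mult)
  qed
  moreover have "(\<lambda>x. f x * cnj (g x)) \<in> borel_measurable lebesgue"
    by (auto intro!: borel_measurable_times borel_measurable_continuous_on[where f = cnj]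
             simp: continuous_on_cnj)
  ultimately show ?thesis
    by (rule_tac Bochner_Integration.integrable_bound) auto
qed

quotient_type (overloaded) 'a L2 = "'a::euclidean_space \<Rightarrow> complex" / partial: L2_eq
  morphisms rep_L2 abs_L2
proof (rule part_equivpI)
  show "\<exists>f. L2_eq f f"
    using square_integrable_zero by (auto simp: L2_eq_def)
  show "symp L2_eq" "transp L2_eq"
    by (auto simp: L2_eq_def symp_def transp_def)
qed

instantiation L2 :: (euclidean_space) real_vector
begin

lift_definition zero_L2 :: "'a L2" is "\<lambda>x. 0"
  by (simp add: L2_eq_def square_integrable_zero)

lift_definition plus_L2 :: "'a L2 \<Rightarrow> 'a L2 \<Rightarrow> 'a L2" is "\<lambda>f g x. f x + g x"
  by (auto simp: L2_eq_def square_integrable_add)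

lift_definition minus_L2 :: "'a L2 \<Rightarrow> 'a L2 \<Rightarrow> 'a L2" is "\<lambda>f g x. f x - g x"
  by (auto simp: L2_eq_def square_integrable_diff)

lift_definition uminus_L2 :: "'a L2 \<Rightarrow> 'a L2" is "\<lambda>f x. - f x"
  using square_integrable_scale[of _ "-1"] by (auto simp: L2_eq_def)

lift_definition scaleR_L2 :: "real \<Rightarrow> 'a L2 \<Rightarrow> 'a L2" is "\<lambda>r f x. of_real r * f x"
  by (auto simp: L2_eq_def square_integrable_scale)

instance
proof
  fix f g h :: "'a L2" and r s :: real
  show "f + g + h = f + (g + h)"
    by transfer (auto simp: L2_eq_def square_integrable_add add.assoc)
  show "f + g = g + f"
    by transfer (auto simp: L2_eq_def square_integrable_add add.commute)
  show "0 + f = f"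
    by transfer (auto simp: L2_eq_def)
  show "- f + f = 0"
    by transfer (auto simp: L2_eq_def square_integrable_zero)
  show "f - g = f + - g"
    by transfer (auto simp: L2_eq_def square_integrable_diff)
  show "r *\<^sub>R (f + g) = r *\<^sub>R f + r *\<^sub>R g"
    by transfer (auto simp: L2_eq_def square_integrable_scale square_integrable_add distrib_left)
  show "(r + s) *\<^sub>R f = r *\<^sub>R f + s *\<^sub>R f"
    by transfer (auto simp: L2_eq_def square_integrable_scale square_integrable_add distrib_right
        simp flip: distrib_right of_real_add)
  show "r *\<^sub>R s *\<^sub>R f = (r * s) *\<^sub>R f"
    by transfer (auto simp: L2_eq_def square_integrable_scale mult.assoc simp del: of_real_mult
        simp flip: of_real_mult mult.assoc)
  show "1 *\<^sub>R f = f"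
    by transfer (auto simp: L2_eq_def)
qed

end

lift_definition scaleC_L2 :: "complex \<Rightarrow> 'a L2 \<Rightarrow> 'a::euclidean_space L2" (infixr \<open>*\<^sub>C\<close> 75)
  is "\<lambda>c f x. c * f x"
  by (auto simp: L2_eq_def square_integrable_scale)

lemma integral_mult_cnj_cong:
  assumes "L2_eq f f'" "L2_eq g g'"
  shows "(LINT x|lebesgue. f x * cnj (g x)) = (LINT x|lebesgue. f' x * cnj (g' x))"
proof (rule integral_cong_AE)
  show "(\<lambda>x. f x * cnj (g x)) \<in> borel_measurable lebesgue"
    "(\<lambda>x. f' x * cnj (g' x)) \<in> borel_measurable lebesgue"
    using assms by (auto simp: L2_eq_def
        intro!: borel_measurable_integrable integrable_square_integrable_mult)
  show "AE x in lebesgue. f x * cnj (g x) = f' x * cnj (g' x)"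
    using assms by (auto simp: L2_eq_def)
qed

lift_definition cinner_L2 :: "'a L2 \<Rightarrow> 'a::euclidean_space L2 \<Rightarrow> complex"
  is "\<lambda>f g. LINT x|lebesgue. f x * cnj (g x)"
  by (rule integral_mult_cnj_cong)

lemma cinner_L2_self:
  assumes "square_integrable f"
  shows "(LINT x|lebesgue. f x * cnj (f x)) = of_real (LINT x|lebesgue. (cmod (f x))\<^sup>2)"
  by (simp add: complex_norm_square[symmetric] flip: of_real_power)

instantiation L2 :: (euclidean_space) real_inner
begin

text \<open>
  The real inner product is the real part of the complex one; it induces the usual norm
  \<open>(\<integral> \<bar>f\<bar>\<^sup>2)\<^sup>1\<^sup>/\<^sup>2\<close>.
\<close>

definition inner_L2 :: "'a L2 \<Rightarrow> 'a L2 \<Rightarrow> real" where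
  "inner_L2 f g = Re (cinner_L2 f g)"

definition norm_L2 :: "'a L2 \<Rightarrow> real" where
  "norm_L2 f = sqrt (inner f f)"

definition sgn_L2 :: "'a L2 \<Rightarrow> 'a L2" where
  "sgn_L2 f = inverse (norm f) *\<^sub>R f"

definition dist_L2 :: "'a L2 \<Rightarrow> 'a L2 \<Rightarrow> real" where
  "dist_L2 f g = norm (f - g)"

definition uniformity_L2 :: "('a L2 \<times> 'a L2) filter" where
  "uniformity_L2 = (INF e\<in>{0<..}. principal {(f, g). dist f g < e})"

definition open_L2 :: "'a L2 set \<Rightarrow> bool" where
  "open_L2 U \<longleftrightarrow> (\<forall>f\<in>U. eventually (\<lambda>(f', g). f' = f \<longrightarrow> g \<in> U) uniformity)"

instance
proof
  fix f g h :: "'a L2" and r :: real and U :: "'a L2 set"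
  show "dist f g = norm (f - g)" by (rule dist_L2_def)
  show "sgn f = inverse (norm f) *\<^sub>R f" by (rule sgn_L2_def)
  show "(uniformity :: ('a L2 \<times> 'a L2) filter)
      = (INF e\<in>{0<..}. principal {(f, g). dist f g < e})"
    by (rule uniformity_L2_def)
  show "open U \<longleftrightarrow> (\<forall>f\<in>U. eventually (\<lambda>(f', g). f' = f \<longrightarrow> g \<in> U) uniformity)"
    by (rule open_L2_def)
  show "norm f = sqrt (inner f f)" by (rule norm_L2_def)
  show "inner f g = inner g f"
    unfolding inner_L2_def
  proof transfer
    fix f g :: "'a \<Rightarrow> complex"
    have "(LINT x|lebesgue. g x * cnj (f x)) = (LINT x|lebesgue. cnj (f x * cnj (g x)))"
      by (simp add: mult.commute)
    also have "\<dots> = cnj (LINT x|lebesgue. f x * cnj (g x))"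
      by (rule Bochner_Integration.integral_cnj)
    finally show "Re (LINT x|lebesgue. f x * cnj (g x)) = Re (LINT x|lebesgue. g x * cnj (f x))"
      by simp
  qed
  show "inner (f + g) h = inner f h + inner g h"
    unfolding inner_L2_def
    by transfer (simp add: L2_eq_def distrib_right integrable_square_integrable_mult)
  show "inner (r *\<^sub>R f) g = r * inner f g"
    unfolding inner_L2_def
    by transfer (simp add: mult.assoc)
  show "0 \<le> inner f f"
    unfolding inner_L2_def
    by transfer (simp add: L2_eq_def cinner_L2_self)
  show "inner f f = 0 \<longleftrightarrow> f = 0"
    unfolding inner_L2_def
  proof transfer
    fix f :: "'a \<Rightarrow> complex"
    assume "L2_eq f f"
    then have f: "square_integrable f" by (simp add: L2_eq_def)
    have "(LINT x|lebesgue. (cmod (f x))\<^sup>2) = 0 \<longleftrightarrow> (AE x in lebesgue. (cmod (f x))\<^sup>2 = 0)"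
      using f by (intro integral_nonneg_eq_0_iff_AE) (auto simp: square_integrable_def)
    then show "Re (LINT x|lebesgue. f x * cnj (f x)) = 0 \<longleftrightarrow> L2_eq f (\<lambda>x. 0)"
      using f by (simp add: cinner_L2_self L2_eq_def square_integrable_zero)
  qed
qed

end

section \<open>Fractional powers of non-negative bounded operators\<close>

definition bounded_operator :: "('a::euclidean_space L2 \<Rightarrow> 'a L2) \<Rightarrow> bool" where
  "bounded_operator B \<longleftrightarrow> bounded_linear B \<and> (\<forall>c f. B (c *\<^sub>C f) = c *\<^sub>C B f)"

definition nonneg_operator :: "('a::euclidean_space L2 \<Rightarrow> 'a L2) \<Rightarrow> bool" where
  "nonneg_operator B \<longleftrightarrow> bounded_operator B \<and> (\<forall>f. cinner_L2 (B f) f \<in> \<real>\<^sub>\<ge>\<^sub>0)"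

definition resolvent :: "('a::euclidean_space L2 \<Rightarrow> 'a L2) \<Rightarrow> real \<Rightarrow> 'a L2 \<Rightarrow> 'a L2" where
  "resolvent B t = inv (\<lambda>f. t *\<^sub>R f + B f)"

text \<open>
  \<open>is_fractional_power B \<alpha> P\<close> states that \<open>B\<close> is a non-negative bounded operator and that
  \<open>P = B\<^sup>\<alpha>\<close>, the integral being convergent with values in \<open>L2\<close>. It determines \<open>P\<close>.
\<close>

definition is_fractional_power ::
    "('a::euclidean_space L2 \<Rightarrow> 'a L2) \<Rightarrow> complex \<Rightarrow> ('a L2 \<Rightarrow> 'a L2) \<Rightarrow> bool" where
  "is_fractional_power B \<alpha> P \<longleftrightarrow>
     nonneg_operator B \<and>
     (\<forall>m::nat. 0 < m \<longrightarrow> Re \<alpha> < real m \<longrightarrow>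
       (\<forall>f. \<exists>I.
          ((\<lambda>t. (of_real t powr (\<alpha> - 1)) *\<^sub>C (((\<lambda>g. B (resolvent B t g)) ^^ m) f))
             has_integral I) {0<..} \<and>
          P f = (Gamma (of_nat m) / (Gamma \<alpha> * Gamma (of_nat m - \<alpha>))) *\<^sub>C I))"

section \<open>Hausdorff operators\<close>

definition locally_integrable :: "('a::euclidean_space \<Rightarrow> complex) \<Rightarrow> bool" where
  "locally_integrable K \<longleftrightarrow> (\<forall>S. compact S \<longrightarrow> set_integrable lebesgue S K)"

text \<open>
  A family of matrices is given by its domain of definition \<open>D\<close> and a total function \<open>A\<close>
  that is relevant only on \<open>D\<close>. The support of a kernel, which is only an almost everywhere
  class, is the set of its non-zeros.
\<close>

definition defined_on_support ::
    "(real^'n) set \<Rightarrow> (real^'n \<Rightarrow> real^'n^'n) \<Rightarrow> (real^'n \<Rightarrow> complex) \<Rightarrow> bool" where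
  "defined_on_support D A K \<longleftrightarrow>
     (AE u in lebesgue. u \<in> support_on UNIV K \<longrightarrow> u \<in> D \<and> det (A u) \<noteq> 0)"

definition det_weight_integrable ::
    "(real^'n \<Rightarrow> real^'n^'n) \<Rightarrow> (real^'n \<Rightarrow> complex) \<Rightarrow> bool" where
  "det_weight_integrable A K \<longleftrightarrow>
     integrable lebesgue (\<lambda>u. of_real (\<bar>det (A u)\<bar> powr (- 1 / 2)) * K u)"

definition hausdorff ::
    "(real^'n \<Rightarrow> real^'n^'n) \<Rightarrow> (real^'n \<Rightarrow> complex) \<Rightarrow>
     (real^'n \<Rightarrow> complex) \<Rightarrow> real^'n \<Rightarrow> complex" where
  "hausdorff A K f x = (LINT u|lebesgue. K u * f (A u *v x))"

definition hausdorff_op ::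
    "(real^'n \<Rightarrow> real^'n^'n) \<Rightarrow> (real^'n \<Rightarrow> complex) \<Rightarrow> (real^'n) L2 \<Rightarrow> (real^'n) L2" where
  "hausdorff_op A K f = abs_L2 (hausdorff A K (rep_L2 f))"

text \<open>
  Boundedness on \<open>L2\<close> includes that, for every square integrable function, the defining integral
  converges absolutely almost everywhere, gives a square integrable function, and does not
  depend on the representative.
\<close>

definition hausdorff_bounded ::
    "(real^'n \<Rightarrow> real^'n^'n) \<Rightarrow> (real^'n \<Rightarrow> complex) \<Rightarrow> bool" where
  "hausdorff_bounded A K \<longleftrightarrow>
     (\<forall>f. square_integrable f \<longrightarrow>
        (AE x in lebesgue. integrable lebesgue (\<lambda>u. K u * f (A u *v x))) \<and>
        square_integrable (hausdorff A K f) \<and>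
        hausdorff_op A K (abs_L2 f) = abs_L2 (hausdorff A K f)) \<and>
     bounded_operator (hausdorff_op A K)"

definition scalar_symbol ::
    "(real^'n \<Rightarrow> real^'n) \<Rightarrow> (real^'n \<Rightarrow> complex) \<Rightarrow> real^'n \<Rightarrow> complex" where
  "scalar_symbol a K s =
     (LINT u|lebesgue. K u *
        (\<Prod>k\<in>UNIV. exp ((- 1 / 2 - \<i> * of_real (s $ k)) * of_real (ln (a u $ k)))))"

definition fourier_transform :: "(real^'n \<Rightarrow> complex) \<Rightarrow> real^'n \<Rightarrow> complex" where
  "fourier_transform g s = (LINT t|lebesgue. g t * exp (- \<i> * of_real (s \<bullet> t)))"

definition diag_matrix :: "real^'n \<Rightarrow> real^'n^'n" where
  "diag_matrix v = (\<chi> i j. if i = j then v $ i else 0)"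

definition pos_def :: "real^'n^'n \<Rightarrow> bool" where
  "pos_def M \<longleftrightarrow> transpose M = M \<and> (\<forall>x. x \<noteq> 0 \<longrightarrow> 0 < x \<bullet> (M *v x))"

definition almost_bijective :: "(real^'n \<Rightarrow> real^'n) \<Rightarrow> bool" where
  "almost_bijective b \<longleftrightarrow>
     (\<exists>M\<in>null_sets lebesgue. \<exists>N\<in>null_sets lebesgue. bij_betw b (- M) (- N))"

end

theory Submission
  imports Defs "HOL-Probability.Characteristic_Functions"
begin

text \<open>
  In the coordinates given by \<open>C\<close>, the dilations by \<open>diag (exp w)\<close> with the normalizing factor
  \<open>exp ((\<Sum>k. w\<^sub>k) / 2)\<close> form a strongly continuous unitary group \<open>U\<close> on \<open>L2\<close>, and a Hausdorff
  operator is the average of \<open>U (log a(u))\<close> with the integrable weight \<open>|det A(u)|\<^sup>-\<^sup>1\<^sup>/\<^sup>2 K(u)\<close>.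
  In the spectral representation of \<open>U\<close> it is multiplication by its scalar symbol. Spectral
  measures are avoided: the Gaussian regularization of the positive definite function
  \<open>w \<mapsto> \<langle>U w f, f\<rangle>\<close> has a non-negative integrable Fourier transform, and these densities
  suffice to show that the symbol determines the operator, with a norm bound by its supremum,
  and that non-negative symbols belong to non-negative operators. By the theorem of
  Weierstrass this gives a continuous functional calculus for \<open>\<H>\<close>, under which the integral
  defining \<open>\<H>\<^sup>\<alpha>\<close> becomes a Beta integral; so an operator with symbol \<open>\<phi>\<^sup>\<alpha>\<close> is the fractional power.

  It remains to realize \<open>\<phi>\<^sup>\<alpha>\<close>, the Fourier transform of \<open>Q\<close>, as the symbol of a Hausdorff operator:
  its weight is the density of the image of \<open>Q(t) dt\<close> under \<open>b\<close>. This image is absolutely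
  continuous because \<open>b\<close> pulls Lebesgue measurable sets back to Lebesgue measurable sets and is
  almost injective, so that every subset of the preimage of a null set is measurable, which
  by Vitali's construction forces this preimage to be null.
\<close>

section \<open>The Hilbert space\<close>

text \<open>In the coordinates of \<open>C\<close> and with logarithms taken on each orthant,
  \<open>U\<close> is a group of translations and a Hausdorff operator is a convolution, which a
  Mellin transform on every orthant would diagonalize. The proof works with matrix coefficients
  instead: an operator and a function are linked when they give matching limits along every sequence
  of densities whose Fourier transforms converge to the coefficients
  \<open>cinner_L2 (U w f) g\<close>. This link is stable under sums, products and uniform limits,
  which is all that a functional calculus requires. One obstacle is measurability: dilated functions
  are integrated in \<open>x\<close> and \<open>u\<close> at once, and composition may destroy
  Lebesgue measurability. Classes are therefore computed on Borel representatives, and a Tonelli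
  argument shows that the choice does not matter. Another is that a kernel need not be integrable;
  only its weighted form is. The kernel of the power arises as an integrable function times the
  square root of \<open>det (A u)\<close>, so it is integrable over those compact sets on which
  \<open>det (A u)\<close> stays bounded.\<close>

lemma square_integrable_rep_L2: "square_integrable (rep_L2 f)"
  using Quotient3_rep_reflp[OF Quotient3_L2] by (simp add: L2_eq_def)

lemma L2_eq_refl: "square_integrable f \<Longrightarrow> L2_eq f f"
  by (simp add: L2_eq_def)

lemma abs_rep_L2: "abs_L2 (rep_L2 f) = f"
  using Quotient3_abs_rep[OF Quotient3_L2] .

lemma L2_eq_rep_abs: "square_integrable f \<Longrightarrow> L2_eq (rep_L2 (abs_L2 f)) f"
  by (intro Quotient3_rep_abs[OF Quotient3_L2] L2_eq_refl)

lemma AE_rep_abs_L2: "square_integrable f \<Longrightarrow> AE x in lebesgue. rep_L2 (abs_L2 f) x = f x"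
  using L2_eq_rep_abs by (auto simp: L2_eq_def)

lemma abs_L2_eqI: "L2_eq f g \<Longrightarrow> abs_L2 f = abs_L2 g"
  using Quotient3_rel_abs[OF Quotient3_L2] .

lemma L2_eqI:
  assumes "square_integrable f" "g \<in> borel_measurable lebesgue" "AE x in lebesgue. f x = g x"
  shows "L2_eq f g"
proof -
  have [measurable]: "f \<in> borel_measurable lebesgue" "g \<in> borel_measurable lebesgue"
    using assms by (auto simp: square_integrable_def)
  have "integrable lebesgue (\<lambda>x. (cmod (g x))\<^sup>2)"
    using assms(1) unfolding square_integrable_def
    by (elim conjE, subst integrable_cong_AE[where g = "\<lambda>x. (cmod (f x))\<^sup>2"]) (use assms(3) in auto)
  then show ?thesis using assms by (simp add: L2_eq_def square_integrable_def)
qed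

section \<open>The complex inner product and its norm\<close>

lemma cinner_abs_L2:
  assumes "square_integrable f" "square_integrable g"
  shows "cinner_L2 (abs_L2 f) (abs_L2 g) = (LINT x|lebesgue. f x * cnj (g x))"
  using assms by (intro cinner_L2.abs_eq L2_eq_refl)

lemma minus_abs_L2:
  "square_integrable f \<Longrightarrow> square_integrable g \<Longrightarrow> abs_L2 f - abs_L2 g = abs_L2 (\<lambda>x. f x - g x)"
  by (intro minus_L2.abs_eq L2_eq_refl)

lemma cinner_add_left: "cinner_L2 (f + g) h = cinner_L2 f h + cinner_L2 g h"
  by transfer (simp add: L2_eq_def distrib_right integrable_square_integrable_mult)

lemma cinner_diff_left: "cinner_L2 (f - g) h = cinner_L2 f h - cinner_L2 g h"
  by transfer (simp add: L2_eq_def left_diff_distrib integrable_square_integrable_mult)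

lemma cinner_scaleC_left: "cinner_L2 (c *\<^sub>C f) h = c * cinner_L2 f h"
  by transfer (simp add: mult.assoc)

lemma cinner_commute: "cinner_L2 f g = cnj (cinner_L2 g f)"
proof transfer
  fix f g :: "'a \<Rightarrow> complex"
  have "(LINT x|lebesgue. f x * cnj (g x)) = (LINT x|lebesgue. cnj (g x * cnj (f x)))"
    by (simp add: mult.commute)
  then show "(LINT x|lebesgue. f x * cnj (g x)) = cnj (LINT x|lebesgue. g x * cnj (f x))"
    by (simp only: Bochner_Integration.integral_cnj)
qed

lemma scaleR_scaleC: "r *\<^sub>R f = of_real r *\<^sub>C f"
  by transfer (auto simp: L2_eq_def square_integrable_scale)

lemma cinner_add_right: "cinner_L2 h (f + g) = cinner_L2 h f + cinner_L2 h g"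
  by (subst (1 2 3) cinner_commute) (simp add: cinner_add_left)

lemma cinner_diff_right: "cinner_L2 h (f - g) = cinner_L2 h f - cinner_L2 h g"
  by (subst (1 2 3) cinner_commute) (simp add: cinner_diff_left)

lemma cinner_scaleC_right: "cinner_L2 h (c *\<^sub>C f) = cnj c * cinner_L2 h f"
  by (subst (1 2) cinner_commute) (simp add: cinner_scaleC_left)

lemma cinner_self: "cinner_L2 f f = of_real ((norm f)\<^sup>2)"
proof -
  have "cinner_L2 f f = of_real (Re (cinner_L2 f f))"
    by transfer (simp add: L2_eq_def cinner_L2_self)
  then show ?thesis by (simp add: norm_L2_def inner_L2_def[symmetric])
qed

lemma norm_scaleC: "norm (c *\<^sub>C f) = cmod c * norm f"
proof -
  have "complex_of_real ((norm (c *\<^sub>C f))\<^sup>2) = c * (cnj c * of_real ((norm f)\<^sup>2))"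
    by (simp only: cinner_self[symmetric] cinner_scaleC_left cinner_scaleC_right mult.left_commute)
  also have "\<dots> = of_real ((cmod c * norm f)\<^sup>2)"
    by (simp only: power_mult_distrib of_real_mult complex_norm_square mult.assoc)
  finally have "(norm (c *\<^sub>C f))\<^sup>2 = (cmod c * norm f)\<^sup>2"
    by (simp only: of_real_eq_iff)
  then show ?thesis
    by (rule power2_eq_imp_eq) auto
qed

text \<open>The type class instance gives the inequality for the real part of the inner product.
  Multiplying \<open>f\<close> by the conjugate phase \<open>c\<close> turns the inner product into
  its own modulus.\<close>

lemma cinner_Cauchy_Schwarz: "cmod (cinner_L2 f g) \<le> norm f * norm g"
proof (cases "cinner_L2 f g = 0")
  case False
  define c where "c = cnj (sgn (cinner_L2 f g))"
  have c: "cmod c = 1" using False by (simp add: c_def norm_sgn)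
  have "complex_of_real (cmod (cinner_L2 f g)) = c * cinner_L2 f g"
    using False complex_norm_square[of "cinner_L2 f g"]
    by (simp add: c_def sgn_eq field_simps power2_eq_square)
  then have "cmod (cinner_L2 f g) = inner (c *\<^sub>C f) g"
    by (simp add: inner_L2_def cinner_scaleC_left complex_eq_iff)
  also have "\<dots> \<le> norm (c *\<^sub>C f) * norm g" by (rule norm_cauchy_schwarz)
  finally show ?thesis using c by (simp add: norm_scaleC)
qed simp

lemma scaleC_add_right: "c *\<^sub>C (f + g) = c *\<^sub>C f + c *\<^sub>C g"
  by transfer (auto simp: L2_eq_def square_integrable_scale square_integrable_add distrib_left)

lemma scaleC_scaleC: "c *\<^sub>C d *\<^sub>C f = (c * d) *\<^sub>C f"
  by transfer (auto simp: L2_eq_def square_integrable_scale mult.assoc simp flip: mult.assoc)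

lemma scaleC_one: "1 *\<^sub>C f = f"
  using scaleR_scaleC[of 1 f] by simp

lemma scaleR_scaleC_commute: "r *\<^sub>R c *\<^sub>C f = c *\<^sub>C r *\<^sub>R f"
  by (simp add: scaleR_scaleC scaleC_scaleC mult.commute)

lemma bounded_linear_scaleC: "bounded_linear (\<lambda>f. c *\<^sub>C f)"
  by (rule bounded_linear_intro[where K = "cmod c"])
    (auto simp: scaleC_add_right scaleR_scaleC_commute norm_scaleC mult.commute)

lemma L2_eq_zeroI:
  assumes "\<And>g. cinner_L2 f g = 0" shows "f = 0"
  using assms[of f] by (simp add: cinner_self)

lemma L2_ext:
  assumes "\<And>h. cinner_L2 f h = cinner_L2 g h" shows "f = g"
  using L2_eq_zeroI[of "f - g"] assms by (simp add: cinner_diff_left)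

lemma norm_abs_L2_square:
  assumes "square_integrable f"
  shows "(norm (abs_L2 f))\<^sup>2 = (LINT x|lebesgue. (cmod (f x))\<^sup>2)"
proof -
  have "complex_of_real ((norm (abs_L2 f))\<^sup>2) = of_real (LINT x|lebesgue. (cmod (f x))\<^sup>2)"
    by (simp only: cinner_self[symmetric] cinner_abs_L2 assms cinner_L2_self)
  then show ?thesis by (simp only: of_real_eq_iff)
qed

lemma nn_integral_norm_abs_L2:
  assumes "square_integrable f"
  shows "(\<integral>\<^sup>+x. ennreal ((cmod (f x))\<^sup>2) \<partial>lebesgue) = ennreal ((norm (abs_L2 f))\<^sup>2)"
  using assms by (simp add: norm_abs_L2_square nn_integral_eq_integral square_integrable_def)

lemma square_integrableI_nn_integral:
  assumes "f \<in> borel_measurable lebesgue" "(\<integral>\<^sup>+x. ennreal ((cmod (f x))\<^sup>2) \<partial>lebesgue) < \<infinity>"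
  shows "square_integrable f"
  using assms by (simp add: square_integrable_def integrable_iff_bounded)

text \<open>The argument of Riesz and Fischer: a fast subsequence converges almost everywhere, and
  Fatou's lemma identifies its pointwise limit as the limit in norm. Completeness is used later for
  the limit operators of the functional calculus and for integrals with values in
  \<open>L2\<close>.\<close>

lemma Cauchy_L2_converges:
  fixes X :: "nat \<Rightarrow> 'a::euclidean_space L2"
  assumes "Cauchy X" shows "convergent X"
proof -
  have "\<exists>N. \<forall>i\<ge>N. \<forall>j\<ge>N. norm (X i - X j) < (1/4)^k" for k :: nat
    using assms[THEN CauchyD, of "(1/4)^k"] by auto
  then obtain N where N: "\<And>k i j. i \<ge> N k \<Longrightarrow> j \<ge> N k \<Longrightarrow> norm (X i - X j) < (1/4)^k"
    by metis
  \<comment> \<open>Partial sums give a monotone index map that still satisfies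
    \<open>N k \<le> r k\<close>.\<close>
  define r where "r k = sum N {..k}" for k
  have r_mono: "r k \<le> r j" if "k \<le> j" for k j
    unfolding r_def using that by (intro sum_mono2) auto
  have r_ge: "N k \<le> r k" for k
    unfolding r_def by (rule member_le_sum) auto
  define f where "f k = rep_L2 (X (r k))" for k
  have sq: "square_integrable (f k)" for k
    by (simp add: f_def square_integrable_rep_L2)
  have [measurable]: "f k \<in> borel_measurable lebesgue" for k
    using sq by (simp add: square_integrable_def)
  have absf: "abs_L2 (f k) = X (r k)" for k
    by (simp add: f_def abs_rep_L2)
  have dist2: "(\<integral>\<^sup>+x. ennreal ((cmod (f i x - f j x))\<^sup>2) \<partial>lebesgue) \<le> ennreal (((1/4)^k)\<^sup>2)"
    if "k \<le> i" "k \<le> j" for i j k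
  proof -
    have "(\<integral>\<^sup>+x. ennreal ((cmod (f i x - f j x))\<^sup>2) \<partial>lebesgue) = ennreal ((norm (X (r i) - X (r j)))\<^sup>2)"
      by (simp add: nn_integral_norm_abs_L2 square_integrable_diff sq minus_abs_L2 flip: absf)
    also have "norm (X (r i) - X (r j)) < (1/4)^k"
      using that r_ge[of k] r_mono order_trans by (intro N) blast+
    then have "ennreal ((norm (X (r i) - X (r j)))\<^sup>2) \<le> ennreal (((1/4)^k)\<^sup>2)"
      by (intro ennreal_leI power_mono) auto
    finally show ?thesis .
  qed
  \<comment> \<open>The squared norms of the increments are at most 16 to the power -k. The weight
    \<open>4^k\<close> keeps the total integral finite, and a pointwise bound on the weighted terms
    makes the increments decay like \<open>(1/2)^k\<close>.\<close>
  let ?d = "\<lambda>k x. ennreal (4^k * (cmod (f (Suc k) x - f k x))\<^sup>2)"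
  have "(\<integral>\<^sup>+x. (\<Sum>k. ?d k x) \<partial>lebesgue) = (\<Sum>k. \<integral>\<^sup>+x. ?d k x \<partial>lebesgue)"
    by (rule nn_integral_suminf) simp
  also have "\<dots> \<le> (\<Sum>k. ennreal ((1/4)^k))"
  proof (intro suminf_le)
    fix k
    have "(\<integral>\<^sup>+x. ?d k x \<partial>lebesgue) = ennreal (4^k) * (\<integral>\<^sup>+x. ennreal ((cmod (f (Suc k) x - f k x))\<^sup>2) \<partial>lebesgue)"
      by (simp add: ennreal_mult nn_integral_cmult)
    also have "\<dots> \<le> ennreal (4^k) * ennreal (((1/4)^k)\<^sup>2)"
      using dist2[of k "Suc k" k] by (intro mult_left_mono) auto
    also have "\<dots> = ennreal ((1/4)^k)"
      by (simp flip: ennreal_mult add: power2_eq_square power_divide)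
    finally show "(\<integral>\<^sup>+x. ?d k x \<partial>lebesgue) \<le> ennreal ((1/4)^k)" .
  qed auto
  also have "\<dots> = ennreal (\<Sum>k. (1/4)^k)"
    by (intro suminf_ennreal2) (auto intro!: summable_geometric)
  also have "\<dots> < \<infinity>" by simp
  finally have fin: "(\<integral>\<^sup>+x. (\<Sum>k. ?d k x) \<partial>lebesgue) < \<infinity>" .
  have "AE x in lebesgue. (\<Sum>k. ?d k x) \<noteq> \<infinity>"
  proof (rule nn_integral_PInf_AE)
    show "(\<lambda>x. \<Sum>k. ?d k x) \<in> borel_measurable lebesgue" by measurable
    show "(\<integral>\<^sup>+x. (\<Sum>k. ?d k x) \<partial>lebesgue) \<noteq> \<infinity>" using fin by (rule less_imp_neq)
  qed
  then have conv: "AE x in lebesgue. convergent (\<lambda>k. f k x)"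
  proof eventually_elim
    case (elim x)
    define B where "B = enn2real (\<Sum>k. ?d k x)"
    have le: "g k \<le> suminf g" for g :: "nat \<Rightarrow> ennreal" and k
      using sum_le_suminf[OF summableI, of "{k}" g] by simp
    have "?d k x \<le> (\<Sum>k. ?d k x)" for k
      by (rule le)
    then have "ennreal (4^k * (cmod (f (Suc k) x - f k x))\<^sup>2) \<le> ennreal B" for k
      using elim unfolding B_def by (subst ennreal_enn2real) (simp_all only: infinity_ennreal_def top.not_eq_extremum)
    then have B: "4^k * (cmod (f (Suc k) x - f k x))\<^sup>2 \<le> B" for k
      by (subst (asm) ennreal_le_iff) (auto simp: B_def)
    have four: "(2^k)\<^sup>2 = (4::real)^k" for k :: nat
      by (simp add: power2_eq_square flip: power_mult_distrib)
    have "norm (f (Suc k) x - f k x) \<le> sqrt B * (1/2)^k" for k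
    proof -
      have "(2^k * cmod (f (Suc k) x - f k x))\<^sup>2 \<le> B"
        using B[of k] by (simp add: power_mult_distrib four)
      then have "2^k * cmod (f (Suc k) x - f k x) \<le> sqrt B"
        by (rule real_le_rsqrt)
      then show ?thesis by (simp add: field_simps power_divide)
    qed
    moreover have "summable (\<lambda>k. sqrt B * (1/2)^k)"
      by (intro summable_mult summable_geometric) simp
    ultimately have "summable (\<lambda>k. f (Suc k) x - f k x)"
      by (metis (no_types, lifting) summable_comparison_test')
    then have "convergent (\<lambda>n. \<Sum>k<n. f (Suc k) x - f k x)"
      by (simp add: summable_iff_convergent)
    then have "convergent (\<lambda>n. f n x - f 0 x)"
      by (simp only: sum_lessThan_telescope[of "\<lambda>k. f k x"])
    then have "convergent (\<lambda>n. (f n x - f 0 x) + f 0 x)"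
      by (intro convergent_add convergent_const)
    then show ?case by simp
  qed
  define F where "F x = lim (\<lambda>k. f k x)" for x
  have [measurable]: "F \<in> borel_measurable lebesgue"
    unfolding F_def by measurable
  have lim: "AE x in lebesgue. (\<lambda>k. f k x) \<longlonglongrightarrow> F x"
    using conv by eventually_elim (simp add: F_def convergent_LIMSEQ_iff)
  \<comment> \<open>Fatou's lemma applied to \<open>dist2\<close> with \<open>j\<close> tending to
    infinity.\<close>
  have near: "(\<integral>\<^sup>+x. ennreal ((cmod (F x - f k x))\<^sup>2) \<partial>lebesgue) \<le> ennreal (((1/4)^k)\<^sup>2)" for k
  proof -
    have "(\<integral>\<^sup>+x. ennreal ((cmod (F x - f k x))\<^sup>2) \<partial>lebesgue) =
        (\<integral>\<^sup>+x. liminf (\<lambda>j. ennreal ((cmod (f j x - f k x))\<^sup>2)) \<partial>lebesgue)"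
    proof (rule nn_integral_cong_AE)
      show "AE x in lebesgue. ennreal ((cmod (F x - f k x))\<^sup>2) = liminf (\<lambda>j. ennreal ((cmod (f j x - f k x))\<^sup>2))"
        using lim
      proof eventually_elim
        case (elim x)
        then have "(\<lambda>j. ennreal ((cmod (f j x - f k x))\<^sup>2)) \<longlonglongrightarrow> ennreal ((cmod (F x - f k x))\<^sup>2)"
          by (intro tendsto_intros)
        then show ?case by (rule lim_imp_Liminf[OF trivial_limit_sequentially, symmetric])
      qed
    qed
    also have "\<dots> \<le> liminf (\<lambda>j. \<integral>\<^sup>+x. ennreal ((cmod (f j x - f k x))\<^sup>2) \<partial>lebesgue)"
      by (rule nn_integral_liminf) simp
    also have "\<dots> \<le> liminf (\<lambda>j. ennreal (((1/4)^k)\<^sup>2))"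
      by (intro Liminf_mono eventually_sequentiallyI[of k]) (rule dist2, auto)
    finally show ?thesis by (simp add: Liminf_const)
  qed
  have sqd: "square_integrable (\<lambda>x. F x - f k x)" for k
    using near[of k] by (intro square_integrableI_nn_integral)
      (auto intro: le_less_trans simp: ennreal_less_top)
  have sqF: "square_integrable F"
    using square_integrable_add[OF sqd[of 0] sq[of 0]] by simp
  have near': "norm (abs_L2 F - X (r k)) \<le> (1/4)^k" for k
  proof -
    have "ennreal ((norm (abs_L2 F - X (r k)))\<^sup>2) \<le> ennreal (((1/4)^k)\<^sup>2)"
      using near[of k] by (simp add: nn_integral_norm_abs_L2 sqd minus_abs_L2 sqF sq flip: absf)
    then have "(norm (abs_L2 F - X (r k)))\<^sup>2 \<le> ((1/4)^k)\<^sup>2"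
      by (subst (asm) ennreal_le_iff) auto
    then show ?thesis by (rule power2_le_imp_le) auto
  qed
  have "X \<longlonglongrightarrow> abs_L2 F"
  proof (rule LIMSEQ_I)
    fix e :: real assume "e > 0"
    then obtain k where k: "(1/4)^k < e/2"
      using real_arch_pow_inv[of "e/2" "1/4"] by auto
    have "norm (X i - abs_L2 F) < e" if "i \<ge> r k" for i
    proof -
      have "norm (X i - abs_L2 F) \<le> norm (X i - X (r k)) + norm (X (r k) - abs_L2 F)"
        by norm
      also have "norm (X i - X (r k)) < (1/4)^k"
        using that r_ge[of k] by (intro N) auto
      also have "norm (X (r k) - abs_L2 F) \<le> (1/4)^k"
        using near'[of k] by (simp add: norm_minus_commute)
      finally show ?thesis using k by simp
    qed
    then show "\<exists>no. \<forall>n\<ge>no. norm (X n - abs_L2 F) < e" by blast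
  qed
  then show ?thesis by (auto simp: convergent_def)
qed

instance L2 :: (euclidean_space) banach
  by standard (rule Cauchy_L2_converges)

text \<open>Dilating a Borel function by a measurable parameter gives a jointly measurable function,
  to which the theorems of Fubini and Tonelli apply; for a Lebesgue measurable function this may
  fail.\<close>

lemma borel_version_complex:
  fixes f :: "'a::euclidean_space \<Rightarrow> complex"
  assumes "f \<in> borel_measurable lebesgue"
  obtains f0 where "f0 \<in> borel_measurable borel" "AE x in lebesgue. f x = f0 x"
proof -
  have "(\<lambda>x. Re (f x)) \<in> borel_measurable (completion lborel)"
    "(\<lambda>x. Im (f x)) \<in> borel_measurable (completion lborel)"
    using assms by auto
  then obtain g h where gh: "g \<in> borel_measurable lborel" "AE x in lborel. Re (f x) = g x"
      "h \<in> borel_measurable lborel" "AE x in lborel. Im (f x) = h x"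
    by (auto dest!: completion_ex_borel_measurable_real)
  define f0 where "f0 x = Complex (g x) (h x)" for x
  have "f0 \<in> borel_measurable borel"
    unfolding f0_def borel_measurable_complex_iff using gh by simp
  moreover have "AE x in lebesgue. f x = f0 x"
    by (rule AE_completion) (use gh in \<open>auto simp: f0_def complex_eq_iff\<close>)
  ultimately show ?thesis by (rule that)
qed

lemma square_integrable_borel_version:
  assumes f: "square_integrable f"
  obtains f0 where "f0 \<in> borel_measurable borel" "square_integrable f0" "AE x in lebesgue. f x = f0 x"
proof -
  obtain f0 where f0: "f0 \<in> borel_measurable borel" "AE x in lebesgue. f x = f0 x"
    using f by (auto simp: square_integrable_def elim: borel_version_complex)
  then have "L2_eq f f0"
    using f by (intro L2_eqI) (auto intro: measurable_completion)
  with f0 show ?thesis by (intro that) (auto simp: L2_eq_def)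
qed

lemma ex_borel_square_integrable:
  obtains f0 where "f0 \<in> borel_measurable borel" "square_integrable f0" "abs_L2 f0 = f"
proof -
  obtain f0 where f0: "f0 \<in> borel_measurable borel" "square_integrable f0" "AE x in lebesgue. rep_L2 f x = f0 x"
    using square_integrable_rep_L2 by (rule square_integrable_borel_version)
  then have "L2_eq (rep_L2 f) f0"
    by (simp add: L2_eq_def square_integrable_rep_L2)
  from abs_L2_eqI[OF this] show ?thesis
    using f0 by (intro that[of f0]) (auto simp: abs_rep_L2)
qed

section \<open>Dominated convergence and density in the Hilbert space\<close>

lemma L2_dominated_convergence:
  fixes f :: "'a::euclidean_space \<Rightarrow> complex"
  assumes [measurable]: "f \<in> borel_measurable lebesgue" "\<And>n. s n \<in> borel_measurable lebesgue"
    and w: "square_integrable w"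
    and lim: "AE x in lebesgue. (\<lambda>n. s n x) \<longlonglongrightarrow> f x"
    and bound: "\<And>n. AE x in lebesgue. cmod (s n x) \<le> cmod (w x)"
  shows "square_integrable (s n)" "square_integrable f"
    and "(\<lambda>n. abs_L2 (s n)) \<longlonglongrightarrow> abs_L2 f"
proof -
  have [measurable]: "w \<in> borel_measurable lebesgue" and w2: "integrable lebesgue (\<lambda>x. (cmod (w x))\<^sup>2)"
    using w by (auto simp: square_integrable_def)
  have sq: "square_integrable g" if [measurable]: "g \<in> borel_measurable lebesgue"
    and g: "AE x in lebesgue. cmod (g x) \<le> cmod (w x)" for g
    unfolding square_integrable_def
  proof (intro conjI Bochner_Integration.integrable_bound[OF w2])
    show "AE x in lebesgue. norm ((cmod (g x))\<^sup>2) \<le> norm ((cmod (w x))\<^sup>2)"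
      using g by eventually_elim (simp add: power_mono)
  qed measurable
  show s: "square_integrable (s n)" for n
    by (rule sq) (use bound in auto)
  have fw: "AE x in lebesgue. cmod (f x) \<le> cmod (w x)"
  proof -
    have "AE x in lebesgue. \<forall>n. cmod (s n x) \<le> cmod (w x)"
      using bound by (simp add: AE_all_countable)
    then show ?thesis using lim
    proof eventually_elim
      case (elim x)
      then show ?case
        by (intro LIMSEQ_le_const2[OF tendsto_norm[OF elim(2)]]) auto
    qed
  qed
  then show f: "square_integrable f" by (intro sq) auto
  have "(\<lambda>n. LINT x|lebesgue. (cmod (s n x - f x))\<^sup>2) \<longlonglongrightarrow> (LINT x|(lebesgue :: 'a measure). (0 :: real))"
  proof (rule integral_dominated_convergence[where w = "\<lambda>x. 4 * (cmod (w x))\<^sup>2"])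
    show "AE x in lebesgue. (\<lambda>n. (cmod (s n x - f x))\<^sup>2) \<longlonglongrightarrow> 0"
      using lim
    proof eventually_elim
      case (elim x)
      then have "(\<lambda>n. (cmod (s n x - f x))\<^sup>2) \<longlonglongrightarrow> (cmod (f x - f x))\<^sup>2"
        by (intro tendsto_intros)
      then show ?case by simp
    qed
    show "AE x in lebesgue. norm ((cmod (s n x - f x))\<^sup>2) \<le> 4 * (cmod (w x))\<^sup>2" for n
      using bound[of n] fw
    proof eventually_elim
      case (elim x)
      then have "cmod (s n x - f x) \<le> 2 * cmod (w x)"
        using norm_triangle_ineq4[of "s n x" "f x"] by linarith
      then have "(cmod (s n x - f x))\<^sup>2 \<le> (2 * cmod (w x))\<^sup>2"
        by (rule power_mono) simp
      then show ?case by (simp add: power_mult_distrib)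
    qed
  qed (use w2 in auto)
  then have "(\<lambda>n. (norm (abs_L2 (s n) - abs_L2 f))\<^sup>2) \<longlonglongrightarrow> 0"
    by (simp add: minus_abs_L2 s f norm_abs_L2_square square_integrable_diff)
  then have "(\<lambda>n. sqrt ((norm (abs_L2 (s n) - abs_L2 f))\<^sup>2)) \<longlonglongrightarrow> sqrt 0"
    by (rule tendsto_real_sqrt)
  then show "(\<lambda>n. abs_L2 (s n)) \<longlonglongrightarrow> abs_L2 f"
    by (simp add: LIM_zero_iff tendsto_norm_zero_iff)
qed

lemma square_integrable_bounded_support:
  assumes g[measurable]: "g \<in> borel_measurable lebesgue"
    and B: "\<And>x. cmod (g x) \<le> B" and R: "\<And>x. norm x > R \<Longrightarrow> g x = 0"
  shows "square_integrable g"
proof -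
  have "integrable lebesgue (\<lambda>x. B\<^sup>2 * indicat_real (cball 0 R) x)"
    by (intro integrable_mult_right lmeasurable_iff_integrable[THEN iffD1] lmeasurable_cball)
  then have "integrable lebesgue (\<lambda>x. (cmod (g x))\<^sup>2)"
  proof (rule Bochner_Integration.integrable_bound)
    show "(\<lambda>x. (cmod (g x))\<^sup>2) \<in> borel_measurable lebesgue" by measurable
    have "(cmod (g x))\<^sup>2 \<le> B\<^sup>2" for x
      using B by (intro power_mono) auto
    then show "AE x in lebesgue. norm ((cmod (g x))\<^sup>2) \<le> norm (B\<^sup>2 * indicat_real (cball 0 R) x)"
      using R by (intro AE_I2) (auto simp: indicator_def not_le)
  qed
  then show ?thesis using g by (simp add: square_integrable_def)
qed

text \<open>Cutting off large arguments and large values reduces the claim to a bounded function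
  with bounded support. That function is an almost everywhere limit of continuous functions, which
  are then modified so that dominated convergence applies.\<close>

lemma continuous_compact_support_dense:
  fixes f :: "'a::euclidean_space L2"
  assumes "e > 0"
  obtains g R B where "continuous_on UNIV g" "\<And>x. norm x > R \<Longrightarrow> g x = 0"
    "\<And>x. cmod (g x) \<le> B" "square_integrable g" "norm (f - abs_L2 g) < e"
proof -
  define h where "h = rep_L2 f"
  have h: "square_integrable h" by (simp add: h_def square_integrable_rep_L2)
  then have [measurable]: "h \<in> borel_measurable lebesgue" by (simp add: square_integrable_def)
  define s where "s n x = (if norm x \<le> real n \<and> cmod (h x) \<le> real n then h x else 0)" for n x
  have [measurable]: "norm \<in> borel_measurable (lebesgue :: 'a measure)"
    by (rule measurable_completion) simp
  have s_meas[measurable]: "s n \<in> borel_measurable lebesgue" for n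
    unfolding s_def by measurable
  have "(\<lambda>n. abs_L2 (s n)) \<longlonglongrightarrow> abs_L2 h"
  proof (rule L2_dominated_convergence(3)[OF _ _ h])
    show "AE x in lebesgue. (\<lambda>n. s n x) \<longlonglongrightarrow> h x"
    proof (intro AE_I2 tendsto_eventually)
      fix x
      show "\<forall>\<^sub>F n in sequentially. s n x = h x"
        using eventually_ge_at_top[of "nat \<lceil>max (norm x) (cmod (h x))\<rceil>"]
        by eventually_elim (auto simp: s_def)
    qed
  qed (auto simp: s_def)
  then have "\<forall>\<^sub>F n in sequentially. dist (abs_L2 (s n)) f < e/2"
    using assms by (intro tendstoD) (auto simp: h_def abs_rep_L2)
  then have "\<forall>\<^sub>F n in sequentially. dist (abs_L2 (s n)) f < e/2 \<and> n > 0"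
    using eventually_gt_at_top[of 0] by (rule eventually_conj)
  then obtain m where m: "norm (f - abs_L2 (s m)) < e/2" "m > 0"
    by (auto simp: eventually_sequentially dist_norm norm_minus_commute)
  obtain N g where N: "negligible N" and g: "\<And>n. continuous_on UNIV (g n)"
    and glim: "\<And>x. x \<notin> N \<Longrightarrow> (\<lambda>n. g n x) \<longlonglongrightarrow> s m x"
    using lebesgue_measurable_imp_measurable_on[OF s_meas[of m], of UNIV]
    by (auto simp: measurable_on_def)
  \<comment> \<open>\<open>clip\<close> is the radial retraction onto the disc of radius
    \<open>m\<close>, continuous because \<open>m > 0\<close>, and \<open>chi\<close> is a
    continuous cutoff equal to 1 on the ball of radius \<open>m\<close>. Neither changes the limit
    \<open>s m\<close>, and together they give all approximants one square integrable
    majorant.\<close>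
  define clip where "clip z = (real m / max (real m) (cmod z)) *\<^sub>R z" for z :: complex
  define chi where "chi x = max 0 (min 1 (real m + 1 - norm x))" for x :: 'a
  define t where "t n x = chi x *\<^sub>R clip (g n x)" for n x
  have clip_le: "cmod (clip z) \<le> real m" for z
    using m(2) by (auto simp: clip_def field_simps max_def)
  have clip_id: "clip z = z" if "cmod z \<le> real m" for z
    using that m(2) by (simp add: clip_def max_def)
  have clip_cont: "continuous_on UNIV clip"
    unfolding clip_def using m(2) by (intro continuous_intros) (auto simp: max_def)
  have t_cont: "continuous_on UNIV (t n)" for n
    unfolding t_def chi_def
    by (intro continuous_intros continuous_on_compose2[OF clip_cont g]) auto
  have t_le: "cmod (t n x) \<le> real m" for n x
    using mult_mono[of "chi x" 1 "cmod (clip (g n x))" "real m"] clip_le[of "g n x"]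
    by (auto simp: t_def chi_def)
  have t_supp: "t n x = 0" if "norm x > real m + 1" for n x
    using that by (simp add: t_def chi_def)
  have t_meas[measurable]: "t n \<in> borel_measurable lebesgue" for n
    by (rule measurable_completion) (simp add: borel_measurable_continuous_onI t_cont)
  have "(\<lambda>n. abs_L2 (t n)) \<longlonglongrightarrow> abs_L2 (s m)"
  proof (rule L2_dominated_convergence(3))
    let ?w = "\<lambda>x. if norm x \<le> real m + 1 then complex_of_real (real m) else 0"
    have "?w \<in> borel_measurable lebesgue"
      by (rule measurable_completion) measurable
    then show "square_integrable ?w"
      by (rule square_integrable_bounded_support[where B = "real m" and R = "real m + 1"]) auto
    show "AE x in lebesgue. cmod (t n x) \<le> cmod (?w x)" for n
      using t_le t_supp by (intro AE_I2) (auto simp: not_le)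
    have "AE x in lebesgue. x \<notin> N"
      using N by (intro AE_not_in) (simp add: negligible_iff_null_sets)
    then show "AE x in lebesgue. (\<lambda>n. t n x) \<longlonglongrightarrow> s m x"
    proof eventually_elim
      case (elim x)
      have "isCont clip (s m x)"
        using clip_cont by (simp add: continuous_on_eq_continuous_at)
      then have "(\<lambda>n. clip (g n x)) \<longlonglongrightarrow> clip (s m x)"
        using glim[OF elim] by (rule isCont_tendsto_compose)
      then have "(\<lambda>n. t n x) \<longlonglongrightarrow> chi x *\<^sub>R clip (s m x)"
        unfolding t_def by (intro tendsto_intros)
      moreover have "chi x *\<^sub>R clip (s m x) = s m x"
        by (subst clip_id) (auto simp: s_def chi_def)
      ultimately show ?case by simp
    qed
  qed measurable
  then have "\<forall>\<^sub>F n in sequentially. dist (abs_L2 (t n)) (abs_L2 (s m)) < e/2"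
    using assms by (intro tendstoD) auto
  then obtain n where n: "norm (abs_L2 (s m) - abs_L2 (t n)) < e/2"
    by (auto simp: eventually_sequentially dist_norm norm_minus_commute)
  have "norm (f - abs_L2 (t n)) < e"
    using m(1) n norm_triangle_ineq[of "f - abs_L2 (s m)" "abs_L2 (s m) - abs_L2 (t n)"] by simp
  moreover have "square_integrable (t n)"
    by (rule square_integrable_bounded_support[OF t_meas t_le t_supp])
  ultimately show ?thesis
    using that[of "t n" "real m + 1" "real m"] t_cont t_supp t_le by blast
qed

section \<open>Linear changes of variables\<close>

lemma borel_measurable_matrix_vector_mult[measurable (raw)]:
  assumes "f \<in> N \<rightarrow>\<^sub>M borel"
  shows "(\<lambda>x. (A :: real^'n^'m) *v f x) \<in> N \<rightarrow>\<^sub>M borel"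
proof -
  have "(*v) A \<in> borel \<rightarrow>\<^sub>M borel"
    by (intro borel_measurable_continuous_onI linear_continuous_on) simp
  from measurable_compose[OF assms this] show ?thesis .
qed

lemma borel_measurable_vector_matrix_mult[measurable (raw)]:
  "f \<in> N \<rightarrow>\<^sub>M borel \<Longrightarrow> (\<lambda>x. f x v* (A :: real^'n^'m)) \<in> N \<rightarrow>\<^sub>M borel"
  using borel_measurable_matrix_vector_mult[of f N "transpose A"] by simp

lemma nn_integral_lborel_shift:
  fixes f :: "'a::euclidean_space \<Rightarrow> ennreal"
  assumes [measurable]: "f \<in> borel_measurable borel"
  shows "(\<integral>\<^sup>+x. f (a + x) \<partial>lborel) = (\<integral>\<^sup>+x. f x \<partial>lborel)"
proof -
  have "(\<integral>\<^sup>+x. f x \<partial>lborel) = (\<integral>\<^sup>+x. f x \<partial>distr lborel borel ((+) a))"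
    by (simp add: lborel_distr_plus)
  then show ?thesis by (simp add: nn_integral_distr)
qed

text \<open>
  Uniqueness of translation invariant measures: evaluating the double integral of
  \<open>f x * g (C (x + y))\<close> in both orders determines the factor between the two measures, and
  the unit ball shows that it is 1. (The change of variables theorems of the library
  require a well-ordered index type.)
\<close>

lemma nn_integral_lborel_orthogonal:
  fixes C :: "real^'n^'n" and g :: "real^'n \<Rightarrow> ennreal"
  assumes C: "orthogonal_matrix C" and [measurable]: "g \<in> borel_measurable borel"
  shows "(\<integral>\<^sup>+x. g (C *v x) \<partial>lborel) = (\<integral>\<^sup>+x. g x \<partial>lborel)"
proof -
  define f :: "real^'n \<Rightarrow> ennreal" where "f = indicator (ball 0 1)"
  have f_meas[measurable]: "f \<in> borel_measurable borel"
    unfolding f_def by (rule borel_measurable_indicator) simp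
  have C1: "C *v (x v* C) = x" and C2: "C *v x v* C = x" for x
    using C by (simp_all add: matrix_vector_mul_assoc orthogonal_matrix_def flip: transpose_matrix_vector)
  have normC: "norm (x v* C) = norm x" for x
    using C orthogonal_transformation_matrix[of "(*v) (transpose C)"]
    by (auto simp: orthogonal_matrix_transpose orthogonal_transformation_norm simp flip: transpose_matrix_vector)
  have shift: "(\<integral>\<^sup>+x. f x * g (C *v x + y) \<partial>lborel) = (\<integral>\<^sup>+x. f (x - (y v* C)) * g (C *v x) \<partial>lborel)" for y
  proof -
    have "(\<integral>\<^sup>+x. f (x - (y v* C)) * g (C *v x) \<partial>lborel)
      = (\<integral>\<^sup>+x. f (((y v* C) + x) - (y v* C)) * g (C *v ((y v* C) + x)) \<partial>lborel)"
      by (rule nn_integral_lborel_shift[symmetric]) measurable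
    also have "\<dots> = (\<integral>\<^sup>+x. f x * g (C *v x + y) \<partial>lborel)"
      by (simp add: matrix_vector_right_distrib C1 add.commute)
    finally show ?thesis ..
  qed
  \<comment> \<open>The unit ball is invariant under \<open>C\<close>. In the new form the integral
    over \<open>y\<close> is that of a translated ball, hence independent of
    \<open>x\<close>.\<close>
  have f1: "f (x - (y v* C)) = f (C *v x - y)" for x y
  proof -
    have "x - (y v* C) = (C *v x - y) v* C"
      using matrix_vector_mult_diff_distrib[of "transpose C" "C *v x" y] by (simp add: C2)
    then show ?thesis by (simp add: f_def indicator_def normC)
  qed
  let ?b = "emeasure lborel (ball 0 1 :: (real^'n) set)"
  have "?b * (\<integral>\<^sup>+y. g y \<partial>lborel) = (\<integral>\<^sup>+x. f x * (\<integral>\<^sup>+y. g (C *v x + y) \<partial>lborel) \<partial>lborel)"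
    by (simp add: nn_integral_lborel_shift nn_integral_multc) (simp add: f_def)
  also have "\<dots> = (\<integral>\<^sup>+x. (\<integral>\<^sup>+y. f x * g (C *v x + y) \<partial>lborel) \<partial>lborel)"
    by (simp add: nn_integral_cmult)
  also have "\<dots> = (\<integral>\<^sup>+y. (\<integral>\<^sup>+x. f x * g (C *v x + y) \<partial>lborel) \<partial>lborel)"
    by (rule lborel_pair.Fubini') measurable
  also have "\<dots> = (\<integral>\<^sup>+y. (\<integral>\<^sup>+x. f (C *v x - y) * g (C *v x) \<partial>lborel) \<partial>lborel)"
    by (simp only: shift f1)
  also have "\<dots> = (\<integral>\<^sup>+x. (\<integral>\<^sup>+y. f (C *v x - y) * g (C *v x) \<partial>lborel) \<partial>lborel)"
    by (rule lborel_pair.Fubini') measurable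
  also have "\<dots> = (\<integral>\<^sup>+x. (\<integral>\<^sup>+y. f (C *v x - y) \<partial>lborel) * g (C *v x) \<partial>lborel)"
    by (simp add: nn_integral_multc)
  also have "(\<lambda>x. \<integral>\<^sup>+y. f (C *v x - y) \<partial>lborel) = (\<lambda>x. ?b)"
  proof
    fix x
    have "(\<integral>\<^sup>+y. f (C *v x - y) \<partial>lborel) = (\<integral>\<^sup>+y. f (C *v x - (C *v x + y)) \<partial>lborel)"
      by (rule nn_integral_lborel_shift[symmetric]) measurable
    also have "\<dots> = (\<integral>\<^sup>+y. f y \<partial>lborel)"
      by (intro nn_integral_cong) (simp add: f_def indicator_def)
    finally show "(\<integral>\<^sup>+y. f (C *v x - y) \<partial>lborel) = ?b" by (simp add: f_def)
  qed
  also have "(\<integral>\<^sup>+x. ?b * g (C *v x) \<partial>lborel) = ?b * (\<integral>\<^sup>+x. g (C *v x) \<partial>lborel)"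
    by (simp add: nn_integral_cmult)
  finally have "?b * (\<integral>\<^sup>+y. g y \<partial>lborel) = ?b * (\<integral>\<^sup>+x. g (C *v x) \<partial>lborel)" .
  moreover have "?b \<noteq> 0" "?b \<noteq> \<infinity>"
    using emeasure_lborel_ball_finite[of 0 1] 
    by (auto simp: emeasure_ball unit_ball_vol_pos less_imp_neq[symmetric] ennreal_eq_0_iff not_le)
  ultimately show ?thesis by (simp add: ennreal_mult_cancel_left)
qed

section \<open>The dilation group\<close>

locale dilation_group =
  fixes C :: "real^'n^'n"
  assumes orth: "orthogonal_matrix C"
begin

text \<open>This is the matrix \<open>C ** diag_matrix (exp w) ** transpose C\<close> with the
  exponential taken componentwise, hence \<open>A u\<close> when \<open>w\<close> consists of the
  logarithms of the eigenvalues. The term \<open>x v* C\<close> is the form to which the simplifier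
  brings \<open>transpose C *v x\<close>.\<close>

definition dilation :: "real^'n \<Rightarrow> real^'n \<Rightarrow> real^'n" where
  "dilation w x = C *v (\<chi> k. exp (w $ k) * (x v* C) $ k)"

definition dil :: "real^'n \<Rightarrow> (real^'n \<Rightarrow> complex) \<Rightarrow> real^'n \<Rightarrow> complex" where
  "dil w f x = of_real (exp ((\<Sum>k\<in>UNIV. w $ k) / 2)) * f (dilation w x)"

definition U :: "real^'n \<Rightarrow> (real^'n) L2 \<Rightarrow> (real^'n) L2" where
  "U w f = abs_L2 (dil w (rep_L2 f))"

lemma orth_mult: "C *v x v* C = x" "C *v (x v* C) = x"
  using orth by (simp_all add: matrix_vector_mul_assoc orthogonal_matrix_def flip: transpose_matrix_vector)

lemma dilation_zero: "dilation 0 x = x"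
proof -
  have "(\<chi> k. exp ((0::real^'n) $ k) * (x v* C) $ k) = (x v* C)"
    by (simp add: vec_eq_iff)
  then show ?thesis by (simp only: dilation_def orth_mult)
qed

lemma dilation_add: "dilation w (dilation v x) = dilation (v + w) x"
  by (simp add: dilation_def orth_mult exp_add mult_ac)

lemma continuous_dilation: "continuous_on UNIV (\<lambda>(w, x). dilation w x)"
proof -
  have 1: "continuous_on UNIV ((*v) A)" for A :: "real^'n^'n"
    by (intro linear_continuous_on) simp
  have 2: "continuous_on UNIV (\<lambda>p. snd p v* C)" for C :: "real^'n^'n"
    using continuous_on_compose2[OF 1[of "transpose C"] continuous_on_snd[OF continuous_on_id]] by simp
  show ?thesis
    unfolding dilation_def case_prod_beta transpose_matrix_vector
    by (intro continuous_on_compose2[OF 1] continuous_intros continuous_on_vec_lambda 2) auto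
qed

lemma measurable_dilation[measurable (raw)]:
  assumes [measurable]: "f \<in> N \<rightarrow>\<^sub>M borel" "g \<in> N \<rightarrow>\<^sub>M borel"
  shows "(\<lambda>x. dilation (f x) (g x)) \<in> N \<rightarrow>\<^sub>M borel"
proof -
  have "(\<lambda>(w, x). dilation w x) \<in> borel_measurable (borel \<Otimes>\<^sub>M borel)"
    unfolding borel_prod by (intro borel_measurable_continuous_onI continuous_dilation)
  from measurable_compose[OF measurable_Pair[OF assms] this] show ?thesis by simp
qed

lemma measurable_dil[measurable (raw)]:
  assumes [measurable]: "h \<in> borel \<rightarrow>\<^sub>M borel" "f \<in> N \<rightarrow>\<^sub>M borel" "g \<in> N \<rightarrow>\<^sub>M borel"
  shows "(\<lambda>x. dil (f x) h (g x)) \<in> N \<rightarrow>\<^sub>M borel"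
proof -
  have [measurable]: "(\<lambda>w::real^'n. w $ k) \<in> borel_measurable borel" for k
    by (intro borel_measurable_continuous_onI continuous_intros)
  show ?thesis unfolding dil_def by measurable
qed

section \<open>Change of variables under dilations and unitarity of \<open>U\<close>\<close>

lemma nn_integral_scale_components:
  fixes g :: "real^'n \<Rightarrow> ennreal"
  assumes [measurable]: "g \<in> borel_measurable borel"
  shows "(\<integral>\<^sup>+x. g x \<partial>lborel) = ennreal (exp (\<Sum>k\<in>UNIV. w $ k)) * (\<integral>\<^sup>+x. g (\<chi> k. exp (w $ k) * x $ k) \<partial>lborel)"
proof -
  define c where "c j = exp (w \<bullet> j)" for j :: "real^'n"
  define T where "T x = 0 + (\<Sum>j\<in>Basis. (c j * (x \<bullet> j)) *\<^sub>R j)" for x :: "real^'n"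
  have B: "Basis = range (\<lambda>k::'n. axis k (1::real))"
    by (auto simp: Basis_vec_def)
  have inj: "inj (\<lambda>k::'n. axis k (1::real))"
    by (auto simp: inj_def axis_eq_axis)
  have T: "T x = (\<chi> k. exp (w $ k) * x $ k)" for x
    unfolding T_def B sum.reindex[OF inj]
    by (simp add: vec_eq_iff c_def inner_axis) (simp add: axis_def if_distrib cong: if_cong)
  have P: "(\<Prod>j\<in>Basis. \<bar>c j\<bar>) = exp (\<Sum>k\<in>UNIV. w $ k)"
    unfolding B prod.reindex[OF inj] by (simp add: c_def exp_sum inner_axis)
  have [measurable]: "T \<in> borel \<rightarrow>\<^sub>M borel" unfolding T_def by measurable
  have "lborel = density (distr lborel borel T) (\<lambda>_. ennreal (exp (\<Sum>k\<in>UNIV. w $ k)))"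
    using lborel_affine_euclidean[of c 0] by (simp add: c_def[of "_"] P[symmetric] T_def[abs_def] prod_ennreal)
  then have "(\<integral>\<^sup>+x. g x \<partial>lborel) = (\<integral>\<^sup>+x. g x \<partial>density (distr lborel borel T) (\<lambda>_. ennreal (exp (\<Sum>k\<in>UNIV. w $ k))))"
    by simp
  then show ?thesis
    by (simp add: nn_integral_density nn_integral_distr nn_integral_cmult T)
qed

text \<open>Rotate by \<open>C\<close>, scale the coordinates, rotate back; the Jacobian is that of
  the middle step.\<close>

lemma nn_integral_dilation:
  assumes [measurable]: "g \<in> borel_measurable borel"
  shows "(\<integral>\<^sup>+x. g x \<partial>lborel) = ennreal (exp (\<Sum>k\<in>UNIV. w $ k)) * (\<integral>\<^sup>+x. g (dilation w x) \<partial>lborel)"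
proof -
  have oT: "orthogonal_matrix (transpose C)"
    using orth by (simp add: orthogonal_matrix_transpose)
  let ?S = "\<lambda>x::real^'n. \<chi> k. exp (w $ k) * x $ k"
  have [measurable]: "?S \<in> borel \<rightarrow>\<^sub>M borel"
    by (intro borel_measurable_continuous_onI continuous_intros continuous_on_vec_lambda)
  have "(\<integral>\<^sup>+x. g x \<partial>lborel) = (\<integral>\<^sup>+x. g (C *v x) \<partial>lborel)"
    by (rule nn_integral_lborel_orthogonal[OF orth, symmetric]) measurable
  also have "\<dots> = ennreal (exp (\<Sum>k\<in>UNIV. w $ k)) * (\<integral>\<^sup>+x. g (C *v ?S x) \<partial>lborel)"
    by (rule nn_integral_scale_components) measurable
  also have "(\<integral>\<^sup>+x. g (C *v ?S x) \<partial>lborel) = (\<integral>\<^sup>+x. g (C *v ?S (transpose C *v x)) \<partial>lborel)"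
    by (rule nn_integral_lborel_orthogonal[OF oT, symmetric]) measurable
  finally show ?thesis by (simp add: dilation_def)
qed

lemma lborel_dilation:
  "lborel = density (distr lborel borel (dilation w)) (\<lambda>_. ennreal (exp (\<Sum>k\<in>UNIV. w $ k)))"
proof (rule measure_eqI)
  fix X :: "(real^'n) set" assume "X \<in> sets lborel"
  then have [measurable]: "X \<in> sets borel" by simp
  have "emeasure lborel X = (\<integral>\<^sup>+x. indicator X x \<partial>lborel)" by simp
  also have "\<dots> = ennreal (exp (\<Sum>k\<in>UNIV. w $ k)) * (\<integral>\<^sup>+x. indicator X (dilation w x) \<partial>lborel)"
    by (rule nn_integral_dilation) measurable
  also have "\<dots> = emeasure (density (distr lborel borel (dilation w)) (\<lambda>_. ennreal (exp (\<Sum>k\<in>UNIV. w $ k)))) X"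
    by (simp add: emeasure_density nn_integral_cmult nn_integral_distr del: nn_integral_indicator)
  finally show "emeasure lborel X = \<dots>" .
qed simp

lemma integral_dilation:
  fixes f :: "real^'n \<Rightarrow> complex"
  assumes [measurable]: "f \<in> borel_measurable borel"
  shows "(LINT x|lborel. f x) = exp (\<Sum>k\<in>UNIV. w $ k) *\<^sub>R (LINT x|lborel. f (dilation w x))"
  by (subst lborel_dilation[of w]) (simp add: integral_density integral_distr)

lemma AE_dilation:
  assumes "AE x in lebesgue. P x"
  shows "AE x in lebesgue. P (dilation w x)"
proof -
  have "AE x in lborel. P x" using assms by (simp add: AE_completion_iff)
  then obtain N where N: "{x. \<not> P x} \<subseteq> N" "emeasure lborel N = 0" "N \<in> sets borel"
    by (auto elim: AE_E)
  have "0 = (\<integral>\<^sup>+x. indicator N x \<partial>(lborel::(real^'n) measure))"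
    using N by simp
  also have "\<dots> = ennreal (exp (\<Sum>k\<in>UNIV. w $ k)) * (\<integral>\<^sup>+x. indicator N (dilation w x) \<partial>lborel)"
    using N by (intro nn_integral_dilation) auto
  finally have "(\<integral>\<^sup>+x. indicator N (dilation w x) \<partial>(lborel::(real^'n) measure)) = 0"
    by (simp add: ennreal_eq_0_iff not_le)
  then have "AE x in lborel. (indicator N (dilation w x) :: ennreal) = 0"
    using N by (subst (asm) nn_integral_0_iff_AE) auto
  then have "AE x in lborel. P (dilation w x)"
    by eventually_elim (use N in \<open>auto simp: indicator_def split: if_splits\<close>)
  then show ?thesis by (rule AE_completion)
qed

lemma AE_dil: "AE x in lebesgue. f x = g x \<Longrightarrow> AE x in lebesgue. dil w f x = dil w g x"
  unfolding dil_def by (drule AE_dilation[of _ w]) (auto elim: eventually_mono)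

lemma cmod_dil_square: "(cmod (dil w f x))\<^sup>2 = exp (\<Sum>k\<in>UNIV. w $ k) * (cmod (f (dilation w x)))\<^sup>2"
  by (simp add: dil_def norm_mult power_mult_distrib flip: exp_double)

lemma nn_integral_dil:
  assumes [measurable]: "f \<in> borel_measurable borel"
  shows "(\<integral>\<^sup>+x. ennreal ((cmod (dil w f x))\<^sup>2) \<partial>lborel) = (\<integral>\<^sup>+x. ennreal ((cmod (f x))\<^sup>2) \<partial>lborel)"
  by (subst nn_integral_dilation[of "\<lambda>x. ennreal ((cmod (f x))\<^sup>2)" w])
    (simp_all add: cmod_dil_square ennreal_mult nn_integral_cmult)

lemma square_integrable_dil:
  assumes "square_integrable f" shows "square_integrable (dil w f)"
proof -
  obtain f0 where f0[measurable]: "f0 \<in> borel_measurable borel" and sq: "square_integrable f0"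
      and ae: "AE x in lebesgue. f x = f0 x"
    using assms by (rule square_integrable_borel_version)
  have "square_integrable (dil w f0)"
  proof (rule square_integrableI_nn_integral)
    show "dil w f0 \<in> borel_measurable lebesgue"
      by (rule measurable_completion) measurable
    show "(\<integral>\<^sup>+x. ennreal ((cmod (dil w f0 x))\<^sup>2) \<partial>lebesgue) < \<infinity>"
      using nn_integral_norm_abs_L2[OF sq] by (simp add: nn_integral_completion nn_integral_dil)
  qed
  moreover have ae': "AE x in lebesgue. dil w f0 x = dil w f x"
    using ae by (intro AE_dil) (auto elim: eventually_mono)
  moreover have "dil w f \<in> borel_measurable lebesgue"
    using ae' \<open>square_integrable (dil w f0)\<close> by (auto simp: square_integrable_def intro: borel_measurable_AE)
  ultimately have "L2_eq (dil w f0) (dil w f)"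
    by (intro L2_eqI)
  then show ?thesis by (simp add: L2_eq_def)
qed

lemma U_abs_L2:
  assumes "square_integrable f" shows "U w (abs_L2 f) = abs_L2 (dil w f)"
  unfolding U_def
  by (intro abs_L2_eqI) (simp add: L2_eq_def square_integrable_dil square_integrable_rep_L2 assms AE_dil AE_rep_abs_L2)

lemma U_zero: "U 0 f = f"
  by (simp add: U_def dil_def[abs_def] dilation_zero abs_rep_L2)

lemma dil_dil: "dil v (dil w f) = dil (v + w) f"
  by (simp add: fun_eq_iff dil_def dilation_add sum.distrib add_divide_distrib exp_add)

lemma U_U: "U v (U w f) = U (v + w) f"
proof -
  have "U w f = abs_L2 (dil w (rep_L2 f))" by (simp add: U_def)
  then show ?thesis
    by (simp add: U_abs_L2 square_integrable_dil square_integrable_rep_L2 dil_dil) (simp add: U_def)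
qed

lemma cinner_U_U: "cinner_L2 (U w f) (U w g) = cinner_L2 f g"
proof -
  obtain f0 g0 where [measurable]: "f0 \<in> borel_measurable borel" "g0 \<in> borel_measurable borel"
      and sq: "square_integrable f0" "square_integrable g0" and "abs_L2 f0 = f" "abs_L2 g0 = g"
    by (metis ex_borel_square_integrable)
  have [measurable]: "cnj \<in> borel \<rightarrow>\<^sub>M borel"
    by (intro borel_measurable_continuous_onI continuous_intros)
  have meas: "(\<lambda>x. f0 x * cnj (g0 x)) \<in> borel_measurable borel" by measurable
  define e where "e = exp ((\<Sum>k\<in>UNIV. w $ k) / 2)"
  have e: "exp (\<Sum>k\<in>UNIV. w $ k) = e * e" unfolding e_def by (simp flip: exp_add)
  have "cinner_L2 (U w f) (U w g) = (LINT x|lebesgue. dil w f0 x * cnj (dil w g0 x))"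
    using sq by (simp add: U_abs_L2 cinner_abs_L2 square_integrable_dil flip: \<open>abs_L2 f0 = f\<close> \<open>abs_L2 g0 = g\<close>)
  also have "\<dots> = (LINT x|lborel. dil w f0 x * cnj (dil w g0 x))"
    by (rule integral_completion) measurable
  also have "\<dots> = (LINT x|lborel. exp (\<Sum>k\<in>UNIV. w $ k) *\<^sub>R (f0 (dilation w x) * cnj (g0 (dilation w x))))"
    by (intro Bochner_Integration.integral_cong refl)
      (simp add: dil_def scaleR_conv_of_real e flip: e_def)
  also have "\<dots> = (LINT x|lborel. f0 x * cnj (g0 x))"
    by (subst integral_dilation[OF meas, of w]) simp
  also have "\<dots> = (LINT x|lebesgue. f0 x * cnj (g0 x))"
    by (rule integral_completion[symmetric]) measurable
  also have "\<dots> = cinner_L2 f g"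
    using sq by (simp add: cinner_abs_L2 flip: \<open>abs_L2 f0 = f\<close> \<open>abs_L2 g0 = g\<close>)
  finally show ?thesis .
qed

lemma norm_U: "norm (U w f) = norm f"
  using cinner_U_U[of w f f] by (simp add: cinner_self flip: of_real_power)

lemma cinner_U_left: "cinner_L2 (U w f) g = cinner_L2 f (U (- w) g)"
  using cinner_U_U[of "- w" "U w f" g] by (simp add: U_U U_zero)

text \<open>Linearity is read off from the adjoint \<open>U (- w)\<close>, which avoids any work
  with representatives.\<close>

lemma U_add: "U w (f + g) = U w f + U w g"
  by (rule L2_ext) (simp add: cinner_U_left cinner_add_left)

lemma U_diff: "U w (f - g) = U w f - U w g"
  by (rule L2_ext) (simp add: cinner_U_left cinner_diff_left)

lemma U_scaleC: "U w (c *\<^sub>C f) = c *\<^sub>C U w f"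
  by (rule L2_ext) (simp add: cinner_U_left cinner_scaleC_left)

text \<open>For continuous functions of compact support this is dominated convergence. Since every
  \<open>U w\<close> is an isometry, the coefficient depends on \<open>f\<close> continuously and
  uniformly in \<open>w\<close>, so the general case is a uniform limit of continuous
  functions.\<close>

lemma continuous_cinner_U: "continuous_on UNIV (\<lambda>w. cinner_L2 (U w f) f)"
proof -
  have cont0: "continuous_on UNIV (\<lambda>w. cinner_L2 (U w (abs_L2 g)) (abs_L2 g))"
    if g: "continuous_on UNIV g" "\<And>x. norm x > R \<Longrightarrow> g x = 0" "\<And>x. cmod (g x) \<le> B" "square_integrable g"
    for g :: "real^'n \<Rightarrow> complex" and R B
  proof -
    have [measurable]: "g \<in> borel_measurable borel"
      using g by (intro borel_measurable_continuous_onI)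
    have [measurable]: "cnj \<in> borel \<rightarrow>\<^sub>M borel"
      by (intro borel_measurable_continuous_onI continuous_intros)
    let ?I = "\<lambda>w. LINT x|lborel. dil w g x * cnj (g x)"
    have eq: "cinner_L2 (U w (abs_L2 g)) (abs_L2 g) = ?I w" for w
      using g(4) by (simp add: U_abs_L2 cinner_abs_L2 square_integrable_dil) (rule integral_completion, measurable)
    have "(\<lambda>n. ?I (W n)) \<longlonglongrightarrow> ?I w0" if W: "W \<longlonglongrightarrow> w0" for W w0
    proof -
      let ?J = "\<lambda>w::real^'n. exp ((\<Sum>k\<in>UNIV. w $ k) / 2)"
      have Jlim: "(\<lambda>n. ?J (W n)) \<longlonglongrightarrow> ?J w0"
        by (intro tendsto_intros W) simp
      then obtain M where M: "\<And>n. norm (?J (W n)) \<le> M"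
        using convergent_imp_Bseq[of "\<lambda>n. ?J (W n)"] by (auto simp: Bseq_def convergent_def)
      have B: "0 \<le> B" using g(3)[of 0] norm_ge_zero order_trans by blast
      have M0: "0 \<le> M" using M[of 0] norm_ge_zero order_trans by blast
      let ?w = "\<lambda>x::real^'n. M * B * B * indicat_real (cball 0 R) x"
      show ?thesis
      proof (rule integral_dominated_convergence[where w = ?w])
      have fin: "emeasure lborel (cball 0 R :: (real^'n) set) < \<infinity>"
        by (rule emeasure_lborel_cball_finite)
      show "integrable lborel ?w"
        by (intro integrable_mult_right integrable_real_indicator fin) auto
      show "AE x in lborel. norm (dil (W n) g x * cnj (g x)) \<le> ?w x" for n
      proof (intro AE_I2)
        fix x
        have "norm (dil (W n) g x * cnj (g x)) \<le> M * B * cmod (g x)"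
          unfolding norm_mult complex_mod_cnj dil_def norm_of_real
          using M[of n] g(3) M0 B by (intro mult_mono mult_nonneg_nonneg) auto
        also have "\<dots> \<le> M * B * (B * indicat_real (cball 0 R) x)"
          using g(2,3) M0 B by (intro mult_left_mono) (auto simp: indicator_def not_le)
        finally show "norm (dil (W n) g x * cnj (g x)) \<le> ?w x" by (simp add: mult.assoc)
      qed
      show "AE x in lborel. (\<lambda>n. dil (W n) g x * cnj (g x)) \<longlonglongrightarrow> dil w0 g x * cnj (g x)"
      proof (intro AE_I2 tendsto_mult tendsto_const)
        fix x
        have "(\<lambda>n. (\<lambda>(w, x). dilation w x) (W n, x)) \<longlonglongrightarrow> (\<lambda>(w, x). dilation w x) (w0, x)"
          using continuous_dilation W
          by (intro isCont_tendsto_compose[OF _ tendsto_Pair]) (auto simp: continuous_on_eq_continuous_at)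
        then have "(\<lambda>n. g (dilation (W n) x)) \<longlonglongrightarrow> g (dilation w0 x)"
          using g(1) by (intro isCont_tendsto_compose[of _ g]) (auto simp: continuous_on_eq_continuous_at)
        then show "(\<lambda>n. dil (W n) g x) \<longlonglongrightarrow> dil w0 g x"
          unfolding dil_def by (intro tendsto_mult tendsto_of_real Jlim)
      qed
      qed measurable
    qed
    then show ?thesis
      unfolding eq by (simp add: continuous_on_sequentially o_def)
  qed
  have approx: "\<exists>G. continuous_on UNIV G \<and> (\<forall>w. dist (G w) (cinner_L2 (U w f) f) < e)" if "e > 0" for e
  proof -
    \<comment> \<open>The bound 1 keeps \<open>norm h\<close> below \<open>norm f + 1\<close>; the
      quotient makes the two error terms add up to less than \<open>e\<close>, and its denominator
      stays positive when \<open>f = 0\<close>.\<close>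
    define d where "d = min 1 (e / (2 * norm f + 2))"
    have d: "d > 0" using \<open>e > 0\<close> by (simp add: d_def add_nonneg_pos)
    obtain g R B where g: "continuous_on UNIV g" "\<And>x. norm x > R \<Longrightarrow> g x = 0"
      "\<And>x. cmod (g x) \<le> B" "square_integrable g" "norm (f - abs_L2 g) < d"
      using continuous_compact_support_dense[OF d, of f] by blast
    define h where "h = abs_L2 g"
    have "dist (cinner_L2 (U w h) h) (cinner_L2 (U w f) f) < e" for w
    proof -
      have "cinner_L2 (U w f) f - cinner_L2 (U w h) h = cinner_L2 (U w (f - h)) f + cinner_L2 (U w h) (f - h)"
        by (simp add: U_diff cinner_diff_left cinner_diff_right)
      then have "cmod (cinner_L2 (U w f) f - cinner_L2 (U w h) h) \<le> norm (f - h) * norm f + norm h * norm (f - h)"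
        using norm_triangle_ineq[of "cinner_L2 (U w (f - h)) f" "cinner_L2 (U w h) (f - h)"]
          cinner_Cauchy_Schwarz[of "U w (f - h)" f] cinner_Cauchy_Schwarz[of "U w h" "f - h"]
        by (simp add: norm_U)
      also have "\<dots> \<le> norm (f - h) * (2 * norm f + 1)"
      proof -
        have "norm h \<le> norm f + norm (f - h)"
          using norm_triangle_ineq4[of f "f - h"] by simp
        also have "norm (f - h) \<le> 1" using g(5) by (simp add: h_def d_def)
        finally show ?thesis
          using mult_left_mono[of "norm h" "norm f + 1" "norm (f - h)"] by (simp add: algebra_simps)
      qed
      also have "\<dots> < d * (2 * norm f + 2)"
        using g(5) d by (intro mult_strict_mono') (auto simp: h_def)
      also have "\<dots> \<le> e / (2 * norm f + 2) * (2 * norm f + 2)"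
        by (intro mult_right_mono) (auto simp: d_def)
      also have "\<dots> = e"
        using add_nonneg_pos[of "2 * norm f" 2]
        by (simp only: times_divide_eq_left nonzero_mult_div_cancel_right) auto
      finally show ?thesis by (simp add: dist_norm norm_minus_commute)
    qed
    then show ?thesis
      using cont0[OF g(1-4)] by (intro exI[of _ "\<lambda>w. cinner_L2 (U w h) h"]) (auto simp: h_def)
  qed
  then obtain G where G: "\<And>n. continuous_on UNIV (G n)"
      "\<And>n w. dist (G n w) (cinner_L2 (U w f) f) < inverse (Suc n)" 
    using approx[of "inverse (Suc _)"] by (metis inverse_positive_iff_positive of_nat_0_less_iff zero_less_Suc)
  have "uniform_limit UNIV G (\<lambda>w. cinner_L2 (U w f) f) sequentially"
  proof (rule uniform_limitI)
    fix e :: real assume "e > 0"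
    then have "\<forall>\<^sub>F n in sequentially. inverse (Suc n) < e"
      using order_tendstoD(2)[OF LIMSEQ_inverse_real_of_nat] by simp
    then show "\<forall>\<^sub>F n in sequentially. \<forall>w\<in>UNIV. dist (G n w) (cinner_L2 (U w f) f) < e"
      by eventually_elim (use G(2) less_trans in blast)
  qed
  then show ?thesis
    by (rule uniform_limit_theorem[rotated]) (auto simp: G)
qed

end

section \<open>Averages over the dilation group\<close>

lemma (in pair_sigma_finite) integrable_pairI:
  fixes f :: "'a \<Rightarrow> 'b \<Rightarrow> 'c::{banach, second_countable_topology}"
  assumes [measurable]: "case_prod f \<in> borel_measurable (M1 \<Otimes>\<^sub>M M2)"
    and "(\<integral>\<^sup>+x. (\<integral>\<^sup>+y. ennreal (norm (f x y)) \<partial>M2) \<partial>M1) < \<infinity>"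
  shows "integrable (M1 \<Otimes>\<^sub>M M2) (case_prod f)"
  using assms(2) by (simp add: integrable_iff_bounded case_prod_beta M2.nn_integral_fst[symmetric])

lemma measurable_cnj[measurable]: "cnj \<in> borel \<rightarrow>\<^sub>M borel"
  by (intro borel_measurable_continuous_onI continuous_intros)

text \<open>Tonelli for null sets. It moves an exceptional set from "for each \<open>u\<close>,
  almost every \<open>x\<close>" to "for almost every \<open>x\<close>, almost every
  \<open>u\<close>", which is how the choice of a representative of \<open>f\<close> is seen to be
  immaterial.\<close>

lemma AE_null_pair:
  assumes "pair_sigma_finite M1 M2" and [measurable]: "Measurable.pred (M1 \<Otimes>\<^sub>M M2) (case_prod P)"
    and "\<And>x. x \<in> space M1 \<Longrightarrow> AE y in M2. \<not> P x y"
  shows "AE y in M2. AE x in M1. \<not> P x y"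
proof -
  interpret pair_sigma_finite M1 M2 by fact
  let ?f = "\<lambda>x y. indicator {p. case_prod P p} (x, y) :: ennreal"
  have [measurable]: "case_prod ?f \<in> borel_measurable (M1 \<Otimes>\<^sub>M M2)"
    by (simp add: case_prod_eta) measurable
  have "(\<integral>\<^sup>+y. (\<integral>\<^sup>+x. ?f x y \<partial>M1) \<partial>M2) = (\<integral>\<^sup>+x. (\<integral>\<^sup>+y. ?f x y \<partial>M2) \<partial>M1)"
    by (rule Fubini') measurable
  also have "\<dots> = (\<integral>\<^sup>+x. 0 \<partial>M1)"
  proof (intro nn_integral_cong)
    fix x assume x: "x \<in> space M1"
    have "(\<integral>\<^sup>+y. ?f x y \<partial>M2) = (\<integral>\<^sup>+y. 0 \<partial>M2)"
      using assms(3)[OF x] by (intro nn_integral_cong_AE) (auto simp: indicator_def)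
    then show "(\<integral>\<^sup>+y. ?f x y \<partial>M2) = 0" by simp
  qed
  finally have "(\<integral>\<^sup>+y. (\<integral>\<^sup>+x. ?f x y \<partial>M1) \<partial>M2) = 0" by simp
  then have "AE y in M2. (\<integral>\<^sup>+x. ?f x y \<partial>M1) = 0"
    by (subst (asm) nn_integral_0_iff_AE) auto
  then show ?thesis
    using AE_space
  proof eventually_elim
    case (elim y)
    then have "AE x in M1. ?f x y = 0"
      by (subst (asm) nn_integral_0_iff_AE) auto
    then show ?case by eventually_elim (simp add: indicator_def split: if_splits)
  qed
qed

context dilation_group
begin

text \<open>The Schwarz inequality with \<open>cmod (\<kappa> u)\<close> split into two square roots
  bounds the squared average by the mass of \<open>\<kappa>\<close> times the average
  \<open>G\<close> of the squared moduli. The integral of \<open>G\<close> over \<open>x\<close> is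
  explicit because dilations preserve the norm. The identity for inner products is Fubini's theorem,
  whose absolute convergence follows from bounding a product by the sum of the two squares.\<close>

lemma average_borel:
  assumes N: "sigma_finite_measure N" and \<kappa>: "integrable N \<kappa>" and [measurable]: "\<tau> \<in> N \<rightarrow>\<^sub>M borel"
    and [measurable]: "f \<in> borel_measurable borel" and f: "square_integrable f"
  shows "AE x in lebesgue. integrable N (\<lambda>u. \<kappa> u * dil (\<tau> u) f x)"
    and "square_integrable (\<lambda>x. LINT u|N. \<kappa> u * dil (\<tau> u) f x)"
    and "integrable N (\<lambda>u. \<kappa> u * cinner_L2 (U (\<tau> u) (abs_L2 f)) g)"
    and "cinner_L2 (abs_L2 (\<lambda>x. LINT u|N. \<kappa> u * dil (\<tau> u) f x)) g
      = (LINT u|N. \<kappa> u * cinner_L2 (U (\<tau> u) (abs_L2 f)) g)"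
proof -
  interpret N: sigma_finite_measure N by fact
  interpret P: pair_sigma_finite N "lborel :: (real^'n) measure" ..
  have [measurable]: "\<kappa> \<in> borel_measurable N" using \<kappa> by auto
  define h where "h u x = \<kappa> u * dil (\<tau> u) f x" for u x
  define k where "k = (\<integral>\<^sup>+u. ennreal (cmod (\<kappa> u)) \<partial>N)"
  have k: "k < \<infinity>" using \<kappa> by (simp add: k_def integrable_iff_bounded)
  define F where "F = (\<integral>\<^sup>+x. ennreal ((cmod (f x))\<^sup>2) \<partial>lborel)"
  have F: "F < \<infinity>"
    using nn_integral_norm_abs_L2[OF f] by (simp add: F_def nn_integral_completion)
  have h_meas[measurable]: "case_prod h \<in> borel_measurable (N \<Otimes>\<^sub>M lborel)"
    unfolding h_def by measurable
  define G where "G x = (\<integral>\<^sup>+u. ennreal (cmod (\<kappa> u)) * ennreal ((cmod (dil (\<tau> u) f x))\<^sup>2) \<partial>N)" for x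
  have [measurable]: "G \<in> borel_measurable borel"
    unfolding G_def by measurable
  have G: "(\<integral>\<^sup>+x. G x \<partial>lborel) = k * F"
  proof -
    have "(\<integral>\<^sup>+x. G x \<partial>lborel) = (\<integral>\<^sup>+u. (\<integral>\<^sup>+x. ennreal (cmod (\<kappa> u)) * ennreal ((cmod (dil (\<tau> u) f x))\<^sup>2) \<partial>lborel) \<partial>N)"
      unfolding G_def by (rule P.Fubini') measurable
    also have "\<dots> = (\<integral>\<^sup>+u. ennreal (cmod (\<kappa> u)) * F \<partial>N)"
      by (intro nn_integral_cong) (simp add: nn_integral_cmult nn_integral_dil F_def)
    also have "\<dots> = k * F"
      by (simp add: k_def nn_integral_multc)
    finally show ?thesis .
  qed
  have CS: "(\<integral>\<^sup>+u. ennreal (cmod (h u x)) \<partial>N)\<^sup>2 \<le> k * G x" for x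
  proof -
    have "(\<integral>\<^sup>+u. ennreal (cmod (h u x)) \<partial>N)\<^sup>2
        = (\<integral>\<^sup>+u. ennreal (sqrt (cmod (\<kappa> u))) * ennreal (sqrt (cmod (\<kappa> u)) * cmod (dil (\<tau> u) f x)) \<partial>N)\<^sup>2"
      by (simp add: h_def norm_mult flip: ennreal_mult mult.assoc)
    also have "\<dots> \<le> (\<integral>\<^sup>+u. (ennreal (sqrt (cmod (\<kappa> u))))\<^sup>2 \<partial>N)
        * (\<integral>\<^sup>+u. (ennreal (sqrt (cmod (\<kappa> u)) * cmod (dil (\<tau> u) f x)))\<^sup>2 \<partial>N)"
      by (rule Cauchy_Schwarz_nn_integral) measurable
    also have "\<dots> = k * G x"
      by (simp add: k_def G_def ennreal_power power_mult_distrib flip: ennreal_mult)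
    finally show ?thesis .
  qed
  have int_h: "AE x in lborel. integrable N (\<lambda>u. h u x)"
  proof -
    have "AE x in lborel. G x \<noteq> \<infinity>"
    proof (rule nn_integral_PInf_AE)
      show "(\<integral>\<^sup>+x. G x \<partial>lborel) \<noteq> \<infinity>"
        using k F unfolding G by (simp add: ennreal_mult_eq_top_iff less_top[symmetric])
    qed measurable
    then show ?thesis
    proof eventually_elim
      case (elim x)
      then have "k * G x < \<infinity>"
        using k by (simp add: ennreal_mult_less_top less_top)
      then have "(\<integral>\<^sup>+u. ennreal (cmod (h u x)) \<partial>N)\<^sup>2 < \<infinity>"
        using CS[of x] by (rule le_less_trans[rotated])
      then show ?case
        by (simp add: integrable_iff_bounded power_less_top_ennreal)
    qed
  qed
  then show "AE x in lebesgue. integrable N (\<lambda>u. \<kappa> u * dil (\<tau> u) f x)"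
    unfolding h_def by (rule AE_completion)
  define v where "v x = (LINT u|N. h u x)" for x
  have [measurable]: "v \<in> borel_measurable borel"
    unfolding v_def by measurable
  have v_le: "ennreal ((cmod (v x))\<^sup>2) \<le> k * G x" for x
  proof (cases "integrable N (\<lambda>u. h u x)")
    case True
    have "ennreal (cmod (v x)) \<le> (\<integral>\<^sup>+u. ennreal (cmod (h u x)) \<partial>N)"
      unfolding v_def using True by (rule integral_norm_bound_ennreal)
    then have "(ennreal (cmod (v x)))\<^sup>2 \<le> (\<integral>\<^sup>+u. ennreal (cmod (h u x)) \<partial>N)\<^sup>2"
      by (intro power_mono) auto
    also note CS
    finally show ?thesis by (simp add: ennreal_power)
  qed (simp add: v_def not_integrable_integral_eq)
  have v: "square_integrable v"
  proof (rule square_integrableI_nn_integral)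
    show "v \<in> borel_measurable lebesgue" by (rule measurable_completion) measurable
    have "(\<integral>\<^sup>+x. ennreal ((cmod (v x))\<^sup>2) \<partial>lebesgue) \<le> (\<integral>\<^sup>+x. k * G x \<partial>lborel)"
      unfolding nn_integral_completion by (intro nn_integral_mono v_le)
    also have "\<dots> = k * (k * F)" by (simp add: nn_integral_cmult G)
    also have "\<dots> < \<infinity>" using k F by (simp add: ennreal_mult_less_top)
    finally show "(\<integral>\<^sup>+x. ennreal ((cmod (v x))\<^sup>2) \<partial>lebesgue) < \<infinity>" .
  qed
  then show "square_integrable (\<lambda>x. LINT u|N. \<kappa> u * dil (\<tau> u) f x)"
    by (simp add: v_def[abs_def] h_def)
  obtain g0 where [measurable]: "g0 \<in> borel_measurable borel" and g0: "square_integrable g0" "abs_L2 g0 = g"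
    by (rule ex_borel_square_integrable)
  define F' where "F' = (\<integral>\<^sup>+x. ennreal ((cmod (g0 x))\<^sup>2) \<partial>lborel)"
  have F': "F' < \<infinity>"
    using nn_integral_norm_abs_L2[OF g0(1)] by (simp add: F'_def nn_integral_completion)
  let ?H = "\<lambda>u x. h u x * cnj (g0 x)"
  have int: "integrable (N \<Otimes>\<^sub>M lborel) (case_prod ?H)"
  proof (rule P.integrable_pairI)
    have "(\<integral>\<^sup>+u. (\<integral>\<^sup>+x. ennreal (cmod (?H u x)) \<partial>lborel) \<partial>N) \<le> (\<integral>\<^sup>+u. ennreal (cmod (\<kappa> u)) * (F + F') \<partial>N)"
    proof (rule nn_integral_mono)
      fix u
      have "(\<integral>\<^sup>+x. ennreal (cmod (?H u x)) \<partial>lborel)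
          \<le> (\<integral>\<^sup>+x. ennreal (cmod (\<kappa> u)) * (ennreal ((cmod (dil (\<tau> u) f x))\<^sup>2) + ennreal ((cmod (g0 x))\<^sup>2)) \<partial>lborel)"
      proof (rule nn_integral_mono)
        fix x
        have "cmod (dil (\<tau> u) f x) * cmod (g0 x) \<le> 2 * cmod (dil (\<tau> u) f x) * cmod (g0 x)"
          by simp
        also have "\<dots> \<le> (cmod (dil (\<tau> u) f x))\<^sup>2 + (cmod (g0 x))\<^sup>2"
          by (rule sum_squares_bound)
        finally have "cmod (?H u x) \<le> cmod (\<kappa> u) * ((cmod (dil (\<tau> u) f x))\<^sup>2 + (cmod (g0 x))\<^sup>2)"
          unfolding h_def norm_mult complex_mod_cnj mult.assoc by (intro mult_left_mono) auto
        then show "ennreal (cmod (?H u x)) \<le> ennreal (cmod (\<kappa> u)) * (ennreal ((cmod (dil (\<tau> u) f x))\<^sup>2) + ennreal ((cmod (g0 x))\<^sup>2))"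
          by (simp flip: ennreal_plus ennreal_mult)
      qed
      also have "\<dots> = ennreal (cmod (\<kappa> u)) * (F + F')"
        by (simp add: nn_integral_cmult nn_integral_add nn_integral_dil F_def F'_def)
      finally show "(\<integral>\<^sup>+x. ennreal (cmod (?H u x)) \<partial>lborel) \<le> ennreal (cmod (\<kappa> u)) * (F + F')" .
    qed
    also have "\<dots> = k * (F + F')" by (simp add: k_def nn_integral_multc)
    also have "\<dots> < \<infinity>" using k F F' by (simp add: ennreal_mult_less_top)
    finally show "(\<integral>\<^sup>+u. (\<integral>\<^sup>+x. ennreal (cmod (?H u x)) \<partial>lborel) \<partial>N) < \<infinity>" .
  qed measurable
  have inner: "(LINT x|lborel. ?H u x) = \<kappa> u * cinner_L2 (U (\<tau> u) (abs_L2 f)) g" for u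
  proof -
    have [measurable]: "(\<lambda>x. dil (\<tau> u) f x) \<in> borel_measurable borel"
      by measurable
    have "cinner_L2 (U (\<tau> u) (abs_L2 f)) g = (LINT x|lebesgue. dil (\<tau> u) f x * cnj (g0 x))"
      using f g0(1) by (simp add: U_abs_L2 cinner_abs_L2 square_integrable_dil flip: g0(2))
    also have "\<dots> = (LINT x|lborel. dil (\<tau> u) f x * cnj (g0 x))"
      by (rule integral_completion) measurable
    finally show ?thesis by (simp add: h_def mult.assoc)
  qed
  show "integrable N (\<lambda>u. \<kappa> u * cinner_L2 (U (\<tau> u) (abs_L2 f)) g)"
    using P.integrable_fst'[OF int] by (simp add: inner)
  have "cinner_L2 (abs_L2 v) g = (LINT x|lebesgue. v x * cnj (g0 x))"
    using v g0(1) by (simp add: cinner_abs_L2 flip: g0(2))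
  also have "\<dots> = (LINT x|lborel. v x * cnj (g0 x))"
    by (rule integral_completion) measurable
  also have "\<dots> = (LINT x|lborel. (LINT u|N. ?H u x))"
    by (simp add: v_def)
  also have "\<dots> = (LINT u|N. (LINT x|lborel. ?H u x))"
    using int by (rule P.Fubini_integral)
  also have "\<dots> = (LINT u|N. \<kappa> u * cinner_L2 (U (\<tau> u) (abs_L2 f)) g)"
    by (simp add: inner)
  finally show "cinner_L2 (abs_L2 (\<lambda>x. LINT u|N. \<kappa> u * dil (\<tau> u) f x)) g
      = (LINT u|N. \<kappa> u * cinner_L2 (U (\<tau> u) (abs_L2 f)) g)"
    by (simp add: v_def[abs_def] h_def)
qed

text \<open>The weak (Pettis) integral of \<open>\<kappa> u *\<^sub>C U (\<tau> u)\<close>. Testing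
  against vectors determines \<open>T\<close> and keeps representatives out of the operator
  calculus. Integrability is demanded explicitly, since a divergent integral would have the default
  value 0.\<close>

definition is_average :: "'b measure \<Rightarrow> ('b \<Rightarrow> complex) \<Rightarrow> ('b \<Rightarrow> real^'n) \<Rightarrow> ((real^'n) L2 \<Rightarrow> (real^'n) L2) \<Rightarrow> bool" where
  "is_average N \<kappa> \<tau> T \<longleftrightarrow> (\<forall>f g. integrable N (\<lambda>u. \<kappa> u * cinner_L2 (U (\<tau> u) f) g) \<and>
     cinner_L2 (T f) g = (LINT u|N. \<kappa> u * cinner_L2 (U (\<tau> u) f) g))"

lemma ex_average:
  assumes "sigma_finite_measure N" "integrable N \<kappa>" "\<tau> \<in> N \<rightarrow>\<^sub>M borel"
  obtains T where "is_average N \<kappa> \<tau> T"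
proof -
  have "\<exists>h. \<forall>g. integrable N (\<lambda>u. \<kappa> u * cinner_L2 (U (\<tau> u) f) g) \<and>
     cinner_L2 h g = (LINT u|N. \<kappa> u * cinner_L2 (U (\<tau> u) f) g)" for f
  proof -
    obtain f0 where f0: "f0 \<in> borel_measurable borel" "square_integrable f0" "abs_L2 f0 = f"
      by (rule ex_borel_square_integrable)
    show ?thesis
      using average_borel(3,4)[OF assms f0(1,2)] unfolding f0(3) by blast
  qed
  then show ?thesis using that unfolding is_average_def by metis
qed

lemma cinner_average_le:
  assumes "is_average N \<kappa> \<tau> T" "integrable N \<kappa>"
  shows "cmod (cinner_L2 (T f) g) \<le> (LINT u|N. cmod (\<kappa> u)) * (norm f * norm g)"
proof -
  have "cmod (cinner_L2 (T f) g) \<le> (LINT u|N. cmod (\<kappa> u * cinner_L2 (U (\<tau> u) f) g))"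
    using assms(1) by (simp add: is_average_def)
  also have "\<dots> \<le> (LINT u|N. cmod (\<kappa> u) * (norm f * norm g))"
  proof (rule integral_mono)
    show "integrable N (\<lambda>u. cmod (\<kappa> u * cinner_L2 (U (\<tau> u) f) g))"
      using assms(1) by (simp add: is_average_def)
    show "integrable N (\<lambda>u. cmod (\<kappa> u) * (norm f * norm g))"
      using assms(2) by auto
    show "cmod (\<kappa> u * cinner_L2 (U (\<tau> u) f) g) \<le> cmod (\<kappa> u) * (norm f * norm g)" for u
      using cinner_Cauchy_Schwarz[of "U (\<tau> u) f" g] by (simp add: norm_mult norm_U mult_left_mono)
  qed
  finally show ?thesis by simp
qed

lemma bounded_operator_average:
  assumes T: "is_average N \<kappa> \<tau> T" and \<kappa>: "integrable N \<kappa>"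
  shows "bounded_operator T"
proof -
  have int: "integrable N (\<lambda>u. \<kappa> u * cinner_L2 (U (\<tau> u) f) g)"
    and eq: "cinner_L2 (T f) g = (LINT u|N. \<kappa> u * cinner_L2 (U (\<tau> u) f) g)" for f g
    using T by (auto simp: is_average_def)
  have add: "T (f + g) = T f + T g" for f g
    by (rule L2_ext) (simp add: eq U_add cinner_add_left distrib_left int)
  have scale: "T (c *\<^sub>C f) = c *\<^sub>C T f" for c f
    by (rule L2_ext) (simp add: eq U_scaleC cinner_scaleC_left mult.left_commute[of _ c])
  have "norm (T f) \<le> norm f * (LINT u|N. cmod (\<kappa> u))" for f
  proof (cases "T f = 0")
    case False
    have "norm (T f) * norm (T f) = cmod (cinner_L2 (T f) (T f))"
      by (simp add: cinner_self power2_eq_square norm_mult)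
    also have "\<dots> \<le> (LINT u|N. cmod (\<kappa> u)) * (norm f * norm (T f))"
      by (rule cinner_average_le[OF T \<kappa>])
    finally show ?thesis using False by (simp add: mult_ac)
  qed simp
  then show ?thesis
    unfolding bounded_operator_def
    by (intro conjI bounded_linear_intro[where K = "LINT u|N. cmod (\<kappa> u)"])
      (auto simp: add scale scaleR_scaleC)
qed

lemma average_commute:
  assumes "is_average N \<kappa> \<tau> T"
  shows "T (U w f) = U w (T f)"
proof (rule L2_ext)
  fix h
  show "cinner_L2 (T (U w f)) h = cinner_L2 (U w (T f)) h"
    using assms by (simp add: is_average_def cinner_U_left U_U) (simp add: minus_diff_commute)
qed

text \<open>Passage from a Borel representative \<open>f0\<close> to an arbitrary \<open>f\<close>.
  The two differ inside a Borel null set \<open>Z\<close>, and for almost every \<open>x\<close> the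
  points \<open>dilation (\<tau> u) x\<close> avoid \<open>Z\<close> for almost every
  \<open>u\<close>, so the integrals over \<open>u\<close> agree.\<close>

lemma average_lebesgue:
  fixes \<tau> :: "'b::euclidean_space \<Rightarrow> real^'n"
  assumes \<kappa>: "integrable lebesgue \<kappa>" and [measurable]: "\<tau> \<in> lebesgue \<rightarrow>\<^sub>M borel"
    and N: "sigma_finite_measure (lebesgue :: 'b measure)"
    and f: "square_integrable f"
  shows "AE x in lebesgue. integrable lebesgue (\<lambda>u. \<kappa> u * dil (\<tau> u) f x)"
    and "square_integrable (\<lambda>x. LINT u|lebesgue. \<kappa> u * dil (\<tau> u) f x)"
    and "is_average lebesgue \<kappa> \<tau> T \<Longrightarrow> T (abs_L2 f) = abs_L2 (\<lambda>x. LINT u|lebesgue. \<kappa> u * dil (\<tau> u) f x)"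
proof -
  interpret N: sigma_finite_measure "lebesgue :: 'b measure" by fact
  have P: "pair_sigma_finite (lebesgue :: 'b measure) (lborel :: (real^'n) measure)" ..
  have [measurable]: "\<kappa> \<in> borel_measurable lebesgue" using \<kappa> by auto
  obtain f0 where [measurable]: "f0 \<in> borel_measurable borel" and sq: "square_integrable f0"
      and ae: "AE x in lebesgue. f x = f0 x"
    using f by (rule square_integrable_borel_version)
  note f0 = average_borel[OF N \<kappa> \<open>\<tau> \<in> lebesgue \<rightarrow>\<^sub>M borel\<close> \<open>f0 \<in> borel_measurable borel\<close> sq]
  have "AE x in lborel. f x = f0 x" using ae by (simp add: AE_completion_iff)
  then obtain Z where Z: "{x. f x \<noteq> f0 x} \<subseteq> Z" "emeasure lborel Z = 0" "Z \<in> sets borel"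
    by (auto elim: AE_E)
  have Z': "f x = f0 x" if "x \<notin> Z" for x using Z(1) that by auto
  have "AE x in lborel. AE u in lebesgue. \<not> (dilation (\<tau> u) x \<in> Z)"
  proof (rule AE_null_pair[OF P])
    have [measurable]: "Z \<in> sets borel" by fact
    show "Measurable.pred (lebesgue \<Otimes>\<^sub>M lborel) (\<lambda>(u, x). dilation (\<tau> u) x \<in> Z)"
      by measurable
    fix u
    have "AE x in lborel. x \<notin> Z" using Z by (intro AE_not_in) auto
    then have "AE x in lebesgue. dilation (\<tau> u) x \<notin> Z" by (intro AE_dilation AE_completion)
    then show "AE x in lborel. \<not> (dilation (\<tau> u) x \<in> Z)" by (simp add: AE_completion_iff)
  qed
  then have "AE x in lborel. AE u in lebesgue. \<kappa> u * dil (\<tau> u) f0 x = \<kappa> u * dil (\<tau> u) f x"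
  proof eventually_elim
    case (elim x)
    then show ?case by eventually_elim (simp add: dil_def Z')
  qed
  then have ae2: "AE x in lebesgue. AE u in lebesgue. \<kappa> u * dil (\<tau> u) f0 x = \<kappa> u * dil (\<tau> u) f x"
    by (rule AE_completion)
  have ae3: "AE x in lebesgue. integrable lebesgue (\<lambda>u. \<kappa> u * dil (\<tau> u) f x) \<and>
      (LINT u|lebesgue. \<kappa> u * dil (\<tau> u) f0 x) = (LINT u|lebesgue. \<kappa> u * dil (\<tau> u) f x)"
    using f0(1) ae2
  proof eventually_elim
    case (elim x)
    have m0: "(\<lambda>u. \<kappa> u * dil (\<tau> u) f0 x) \<in> borel_measurable lebesgue" by measurable
    then have m: "(\<lambda>u. \<kappa> u * dil (\<tau> u) f x) \<in> borel_measurable lebesgue"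
      using elim(2) by (rule borel_measurable_AE)
    show ?case
      using elim(1) integrable_cong_AE[OF m0 m elim(2)] integral_cong_AE[OF m0 m elim(2)] by blast
  qed
  then show "AE x in lebesgue. integrable lebesgue (\<lambda>u. \<kappa> u * dil (\<tau> u) f x)"
    by eventually_elim simp
  have ae4: "AE x in lebesgue. (LINT u|lebesgue. \<kappa> u * dil (\<tau> u) f0 x) = (LINT u|lebesgue. \<kappa> u * dil (\<tau> u) f x)"
    using ae3 by eventually_elim simp
  have eq: "L2_eq (\<lambda>x. LINT u|lebesgue. \<kappa> u * dil (\<tau> u) f0 x) (\<lambda>x. LINT u|lebesgue. \<kappa> u * dil (\<tau> u) f x)"
  proof (rule L2_eqI[OF f0(2) _ ae4])
    show "(\<lambda>x. LINT u|lebesgue. \<kappa> u * dil (\<tau> u) f x) \<in> borel_measurable lebesgue"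
      using f0(2) by (intro borel_measurable_AE[OF _ ae4]) (simp add: square_integrable_def)
  qed
  then show "square_integrable (\<lambda>x. LINT u|lebesgue. \<kappa> u * dil (\<tau> u) f x)"
    by (simp add: L2_eq_def)
  assume T: "is_average lebesgue \<kappa> \<tau> T"
  have "abs_L2 f0 = abs_L2 f"
    using ae f sq by (intro abs_L2_eqI) (auto simp: L2_eq_def elim: eventually_mono)
  then have "T (abs_L2 f) = abs_L2 (\<lambda>x. LINT u|lebesgue. \<kappa> u * dil (\<tau> u) f0 x)"
    using T f0(4) by (intro L2_ext) (simp add: is_average_def)
  then show "T (abs_L2 f) = abs_L2 (\<lambda>x. LINT u|lebesgue. \<kappa> u * dil (\<tau> u) f x)"
    using abs_L2_eqI[OF eq] by simp
qed

end

lemma sigma_finite_lebesgue: "sigma_finite_measure (lebesgue :: 'a::euclidean_space measure)"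
proof
  obtain A :: "'a set set" where A: "countable A" "A \<subseteq> sets lborel" "\<Union>A = space lborel" "\<forall>a\<in>A. emeasure lborel a \<noteq> \<infinity>"
    using lborel.sigma_finite_countable by blast
  then have "A \<subseteq> sets lebesgue" "\<Union>A = space lebesgue" "\<forall>a\<in>A. emeasure lebesgue a \<noteq> \<infinity>"
    by auto
  with A(1) show "\<exists>A. countable A \<and> A \<subseteq> sets (lebesgue :: 'a measure) \<and> \<Union>A = space lebesgue \<and> (\<forall>a\<in>A. emeasure lebesgue a \<noteq> \<infinity>)"
    by blast
qed

section \<open>Gaussians and approximate spectral measures\<close>

text \<open>Up to the factor \<open>sqrt (2 * pi)\<close> this is the characteristic function of the
  standard normal distribution.\<close>

lemma gaussian_fourier_real:
  "integrable lborel (\<lambda>t::real. complex_of_real (exp (- t\<^sup>2 / 2)) * cis (- (t * c)))"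
  "(LINT t|lborel. complex_of_real (exp (- t\<^sup>2 / 2)) * cis (- (t * c))) = of_real (sqrt (2 * pi) * exp (- c\<^sup>2 / 2))"
proof -
  have eq: "complex_of_real (exp (- t\<^sup>2 / 2)) * cis (- (t * c)) =
      of_real (sqrt (2 * pi)) * (std_normal_density t *\<^sub>R iexp ((- c) * t))" for t
    by (simp add: std_normal_density_def scaleR_conv_of_real cis_conv_exp mult.commute)
  have int: "integrable lborel (\<lambda>t. std_normal_density t *\<^sub>R iexp ((- c) * t))"
    by (rule Bochner_Integration.integrable_bound[OF integrable_normal_density[of 1 0]]) auto
  then show "integrable lborel (\<lambda>t::real. complex_of_real (exp (- t\<^sup>2 / 2)) * cis (- (t * c)))"
    unfolding eq by (rule integrable_mult_right)
  have "(LINT t|lborel. std_normal_density t *\<^sub>R iexp ((- c) * t)) = char std_normal_distribution (- c)"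
    unfolding char_def by (subst integral_density) auto
  also have "\<dots> = of_real (exp (- c\<^sup>2 / 2))"
    by (simp only: char_std_normal_distribution) simp
  finally show "(LINT t|lborel. complex_of_real (exp (- t\<^sup>2 / 2)) * cis (- (t * c))) = of_real (sqrt (2 * pi) * exp (- c\<^sup>2 / 2))"
    unfolding eq by (simp only: integral_mult_right_zero of_real_mult)
qed

lemma gaussian_fourier:
  fixes w :: "'a::euclidean_space"
  shows "integrable lborel (\<lambda>s. complex_of_real (exp (- (s \<bullet> s) / 2)) * cis (- (s \<bullet> w)))" (is ?I)
    and "(LINT s|lborel. complex_of_real (exp (- (s \<bullet> s) / 2)) * cis (- (s \<bullet> w)))
      = of_real (sqrt (2 * pi) ^ DIM('a) * exp (- (w \<bullet> w) / 2))" (is ?E)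
proof -
  interpret P: product_sigma_finite "\<lambda>_ :: 'a. lborel :: real measure" ..
  let ?g = "\<lambda>b t. complex_of_real (exp (- t\<^sup>2 / 2)) * cis (- (t * (w \<bullet> b)))"
  let ?S = "\<lambda>f. \<Sum>b\<in>Basis. f b *\<^sub>R b :: 'a"
  have exp_inner: "exp (- (v \<bullet> v) / 2) = (\<Prod>b\<in>Basis. exp (- (v \<bullet> b)\<^sup>2 / 2))" for v :: 'a
    by (subst euclidean_inner) (simp add: exp_sum[symmetric] sum_negf sum_divide_distrib power2_eq_square)
  have cis_sum: "cis (sum f A) = (\<Prod>x\<in>A. cis (f x))" if "finite A" for f and A :: "'a set"
    using that by induction (auto simp flip: cis_mult)
  have prod: "complex_of_real (exp (- (s \<bullet> s) / 2)) * cis (- (s \<bullet> w)) = (\<Prod>b\<in>Basis. ?g b (s \<bullet> b))" for s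
  proof -
    have "cis (- (s \<bullet> w)) = (\<Prod>b\<in>Basis. cis (- ((s \<bullet> b) * (w \<bullet> b))))"
      by (subst euclidean_inner) (simp add: sum_negf[symmetric] cis_sum)
    then show ?thesis unfolding exp_inner by (simp add: prod.distrib)
  qed
  have coord: "(\<Prod>b\<in>Basis. ?g b (?S f \<bullet> b)) = (\<Prod>b\<in>Basis. ?g b (f b))" for f
    by (intro prod.cong refl) simp
  have [measurable]: "?S \<in> (\<Pi>\<^sub>M b\<in>Basis. lborel) \<rightarrow>\<^sub>M borel" by measurable
  have [measurable]: "cis \<in> borel \<rightarrow>\<^sub>M borel"
    by (intro borel_measurable_continuous_onI continuous_intros)
  show ?I
    unfolding prod by (subst lborel_eq, subst integrable_distr_eq)
      (use gaussian_fourier_real(1) in \<open>auto simp: coord intro!: P.product_integrable_prod\<close>)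
  have "(LINT s|lborel. complex_of_real (exp (- (s \<bullet> s) / 2)) * cis (- (s \<bullet> w)))
      = (\<integral>f. (\<Prod>b\<in>Basis. ?g b (?S f \<bullet> b)) \<partial>(\<Pi>\<^sub>M b\<in>Basis. lborel))"
    unfolding prod by (subst lborel_eq, rule integral_distr) measurable
  also have "\<dots> = (\<integral>f. (\<Prod>b\<in>Basis. ?g b (f b)) \<partial>(\<Pi>\<^sub>M b\<in>Basis. lborel))"
    by (simp only: coord)
  also have "\<dots> = (\<Prod>b\<in>Basis. LINT t|lborel. ?g b t)"
    by (rule P.product_integral_prod) (simp, rule gaussian_fourier_real(1))
  also have "\<dots> = of_real (sqrt (2 * pi) ^ DIM('a) * exp (- (w \<bullet> w) / 2))"
    by (simp only: gaussian_fourier_real(2) of_real_mult prod.distrib exp_inner of_real_prod prod_constant of_real_power)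
  finally show ?E .
qed

lemma measurable_cis[measurable]: "cis \<in> borel \<rightarrow>\<^sub>M borel"
  by (intro borel_measurable_continuous_onI continuous_intros)

lemma lborel_affine_complex:
  fixes f :: "'a::euclidean_space \<Rightarrow> complex"
  assumes [measurable]: "f \<in> borel_measurable borel" and c: "c > 0"
  shows "(LINT x|lborel. f x) = c ^ DIM('a) *\<^sub>R (LINT x|lborel. f (t + c *\<^sub>R x))"
    and "integrable lborel f \<longleftrightarrow> integrable lborel (\<lambda>x. f (t + c *\<^sub>R x))"
proof -
  have eq: "lborel = density (distr lborel borel (\<lambda>x. t + c *\<^sub>R x)) (\<lambda>_. ennreal (c ^ DIM('a)))"
    using lborel_affine[of c t] c by simp
  show "(LINT x|lborel. f x) = c ^ DIM('a) *\<^sub>R (LINT x|lborel. f (t + c *\<^sub>R x))"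
    by (subst eq) (use c in \<open>simp add: integral_density integral_distr\<close>)
  show "integrable lborel f \<longleftrightarrow> integrable lborel (\<lambda>x. f (t + c *\<^sub>R x))"
  proof -
    have "integrable lborel f \<longleftrightarrow> integrable lborel (\<lambda>x. c ^ DIM('a) *\<^sub>R f (t + c *\<^sub>R x))"
      by (subst eq) (use c in \<open>simp add: integrable_density integrable_distr_eq\<close>)
    also have "\<dots> \<longleftrightarrow> integrable lborel (\<lambda>x. f (t + c *\<^sub>R x))"
    proof
      assume "integrable lborel (\<lambda>x. c ^ DIM('a) *\<^sub>R f (t + c *\<^sub>R x))"
      then have "integrable lborel (\<lambda>x. (1 / c ^ DIM('a)) *\<^sub>R c ^ DIM('a) *\<^sub>R f (t + c *\<^sub>R x))"
        by (rule integrable_scaleR_right)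
      then show "integrable lborel (\<lambda>x. f (t + c *\<^sub>R x))" using c by simp
    qed (rule integrable_scaleR_right)
    finally show ?thesis .
  qed
qed

text \<open>The parameter is a reciprocal width: as \<open>c\<close> tends to 0 the function tends
  to 1 pointwise, so it serves as a damping factor, while its Fourier transform is a multiple of
  \<open>gaussian (1 / c)\<close> and concentrates at 0.\<close>

definition gaussian :: "real \<Rightarrow> 'a::euclidean_space \<Rightarrow> real" where
  "gaussian c x = exp (- (c\<^sup>2 * (x \<bullet> x)) / 2)"

lemma measurable_gaussian[measurable]: "gaussian c \<in> borel \<rightarrow>\<^sub>M borel"
  unfolding gaussian_def by measurable

lemma gaussian_pos: "0 < gaussian c x"
  by (simp add: gaussian_def)

lemma gaussian_le_1: "gaussian c x \<le> 1"
  by (simp add: gaussian_def)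

lemma gaussian_scale: "gaussian c (d *\<^sub>R x) = gaussian (c * d) x"
  by (simp add: gaussian_def power2_eq_square mult_ac)

lemma gaussian_scaled_fourier:
  fixes w :: "'a::euclidean_space"
  assumes c: "c > 0"
  shows "integrable lborel (\<lambda>s. of_real (gaussian c s) * cis (- (s \<bullet> w)))"
    and "(LINT s|lborel. of_real (gaussian c s) * cis (- (s \<bullet> w)))
      = of_real ((sqrt (2 * pi) / c) ^ DIM('a) * gaussian (1 / c) w)"
proof -
  let ?w = "(1 / c) *\<^sub>R w"
  let ?f = "\<lambda>s. complex_of_real (exp (- (s \<bullet> s) / 2)) * cis (- (s \<bullet> ?w))"
  have f: "?f (0 + c *\<^sub>R s) = of_real (gaussian c s) * cis (- (s \<bullet> w))" for s
    using c by (simp add: gaussian_def power2_eq_square mult_ac)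
  have [measurable]: "?f \<in> borel_measurable borel" by measurable
  show "integrable lborel (\<lambda>s. of_real (gaussian c s) * cis (- (s \<bullet> w)))"
    using gaussian_fourier(1)[of ?w] lborel_affine_complex(2)[of ?f c 0] c unfolding f by simp
  have "of_real (sqrt (2 * pi) ^ DIM('a) * gaussian (1 / c) w) = (LINT s|lborel. ?f s)"
    unfolding gaussian_fourier(2) by (simp add: gaussian_def power2_eq_square)
  also have "\<dots> = c ^ DIM('a) *\<^sub>R (LINT s|lborel. of_real (gaussian c s) * cis (- (s \<bullet> w)))"
    using lborel_affine_complex(1)[of ?f c 0] c unfolding f by simp
  finally have "(LINT s|lborel. of_real (gaussian c s) * cis (- (s \<bullet> w)))
      = of_real (sqrt (2 * pi) ^ DIM('a) * gaussian (1 / c) w) / of_real (c ^ DIM('a))"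
    using c by (simp add: scaleR_conv_of_real)
  then show "(LINT s|lborel. of_real (gaussian c s) * cis (- (s \<bullet> w)))
      = of_real ((sqrt (2 * pi) / c) ^ DIM('a) * gaussian (1 / c) w)"
    by (simp add: power_divide)
qed

lemma integrable_gaussian:
  assumes "c > 0" shows "integrable lborel (gaussian c :: 'a::euclidean_space \<Rightarrow> real)"
proof -
  have "integrable lborel (\<lambda>s::'a. complex_of_real (gaussian c s))"
    using gaussian_scaled_fourier(1)[OF assms, of 0] by simp
  then show ?thesis by (simp add: complex_of_real_integrable_eq)
qed

lemma integral_gaussian:
  assumes "c > 0"
  shows "(LINT s::'a::euclidean_space|lborel. gaussian c s) = (sqrt (2 * pi) / c) ^ DIM('a)"
proof -
  have "(LINT s::'a|lborel. complex_of_real (gaussian c s)) = of_real ((sqrt (2 * pi) / c) ^ DIM('a))"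
    using gaussian_scaled_fourier(2)[OF assms, of 0] by (simp add: gaussian_def)
  then show ?thesis by (simp only: integral_complex_of_real of_real_eq_iff)
qed

context dilation_group
begin

section \<open>Approximate spectral densities of a vector\<close>

lemma cinner_U_le: "cmod (cinner_L2 (U w f) f) \<le> (norm f)\<^sup>2"
  using cinner_Cauchy_Schwarz[of "U w f" f] by (simp add: norm_U power2_eq_square)

lemma measurable_cinner_U[measurable]: "(\<lambda>w. cinner_L2 (U w f) f) \<in> borel_measurable borel"
  by (intro borel_measurable_continuous_onI continuous_cinner_U)

text \<open>
  Positivity of the Gaussian regularization of the spectral density: up to a positive factor
  it is the squared norm of the average of \<open>cis (s \<bullet> x) U x f\<close> with a Gaussian weight.
\<close>

lemma spectral_density_nonneg:
  assumes c: "c > 0"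
  obtains r where "r \<ge> 0"
    "(LINT w|lborel. cinner_L2 (U w f) f * of_real (gaussian c w) * cis (s \<bullet> w)) = complex_of_real r"
proof -
  \<comment> \<open>With \<open>d\<^sup>2 = 2 * c\<^sup>2\<close> the parallelogram identity, after
    centering \<open>y\<close> at \<open>- w / 2\<close>, turns
    \<open>gaussian d (y + w) * gaussian d y\<close> into
    \<open>gaussian c w * gaussian (2 * c) y\<close>. The first factor is the prescribed damping;
    the second integrates to the constant \<open>k\<close> at the end.\<close>
  define d where "d = sqrt 2 * c"
  have d: "d > 0" "d\<^sup>2 = 2 * c\<^sup>2" using c by (auto simp: d_def power_mult_distrib)
  define h where "h x = complex_of_real (gaussian d x) * cis (s \<bullet> x)" for x :: "real^'n"
  define F where "F w = cinner_L2 (U w f) f" for w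
  have [measurable]: "F \<in> borel_measurable borel" unfolding F_def by measurable
  have [measurable]: "h \<in> borel_measurable borel" unfolding h_def by measurable
  have h: "integrable lborel h"
    by (rule Bochner_Integration.integrable_bound[OF integrable_gaussian[OF d(1)]])
      (auto simp: h_def norm_mult)
  have cmod_h: "cmod (h x) = gaussian d x" for x
    by (simp add: h_def norm_mult gaussian_pos less_imp_le)
  obtain T where T: "is_average lborel h (\<lambda>x. x) T"
    by (rule ex_average[OF lborel.sigma_finite_measure_axioms h]) auto
  have inner: "cinner_L2 (T f) (U x f) = (LINT y|lborel. h y * cnj (F (x - y)))" for x
  proof -
    have "cinner_L2 (U y f) (U x f) = cnj (F (x - y))" for y
      unfolding F_def by (subst cinner_commute) (simp add: cinner_U_left U_U)
    then show ?thesis using T by (simp add: is_average_def)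
  qed
  have FF: "cmod (F w) \<le> (norm f)\<^sup>2" for w unfolding F_def by (rule cinner_U_le)
  have int: "integrable (lborel \<Otimes>\<^sub>M lborel) (\<lambda>(x, y). h x * (cnj (h y) * F (x - y)))"
  proof (rule lborel_pair.integrable_pairI)
    have "(\<integral>\<^sup>+x. (\<integral>\<^sup>+y. ennreal (cmod (h x * (cnj (h y) * F (x - y)))) \<partial>lborel) \<partial>lborel)
      \<le> (\<integral>\<^sup>+x. (\<integral>\<^sup>+y. ennreal (gaussian d x) * (ennreal (gaussian d y) * ennreal ((norm f)\<^sup>2)) \<partial>(lborel :: (real^'n) measure)) \<partial>(lborel :: (real^'n) measure))"
    proof (intro nn_integral_mono)
      fix x y
      have "cmod (h x * (cnj (h y) * F (x - y))) \<le> gaussian d x * (gaussian d y * (norm f)\<^sup>2)"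
        unfolding norm_mult complex_mod_cnj cmod_h
        using FF by (intro mult_left_mono) (auto simp: gaussian_pos less_imp_le)
      then show "ennreal (cmod (h x * (cnj (h y) * F (x - y))))
          \<le> ennreal (gaussian d x) * (ennreal (gaussian d y) * ennreal ((norm f)\<^sup>2))"
        by (simp add: gaussian_pos less_imp_le flip: ennreal_mult)
    qed
    also have "\<dots> < \<infinity>"
      using integrable_gaussian[OF d(1), where 'a = "real^'n"]
      by (simp add: nn_integral_cmult nn_integral_multc ennreal_mult_less_top nn_integral_eq_integral gaussian_pos less_imp_le)
    finally show "(\<integral>\<^sup>+x. (\<integral>\<^sup>+y. ennreal (cmod (h x * (cnj (h y) * F (x - y)))) \<partial>lborel) \<partial>lborel) < \<infinity>" .
  qed measurable
  have shift: "(LINT x|lborel. k x) = (LINT x|lborel. k (t + x))" if "k \<in> borel_measurable borel"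
    for k :: "real^'n \<Rightarrow> complex" and t
    using lborel_affine_complex(1)[OF that, of 1 t] by simp
  \<comment> \<open>Expanding both occurrences of \<open>T f\<close> gives the double integral of
    \<open>h x * cnj (h y) * F (x - y)\<close>, the quadratic form of a positive definite function.
    Substituting \<open>w = x - y\<close> leaves \<open>F w\<close> times the autocorrelation of
    \<open>h\<close>.\<close>
  have "of_real ((norm (T f))\<^sup>2) = (LINT x|lborel. h x * cinner_L2 (U x f) (T f))"
    using T by (simp only: cinner_self[symmetric] is_average_def)
  also have "\<dots> = (LINT x|lborel. h x * (LINT y|lborel. cnj (h y) * F (x - y)))"
  proof (intro Bochner_Integration.integral_cong refl arg_cong2[where f = "(*)"])
    fix x
    have "cinner_L2 (U x f) (T f) = cnj (LINT y|lborel. h y * cnj (F (x - y)))"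
      by (simp only: cinner_commute[of "U x f"] inner)
    also have "\<dots> = (LINT y|lborel. cnj (h y * cnj (F (x - y))))"
      by (rule Bochner_Integration.integral_cnj[symmetric])
    finally show "cinner_L2 (U x f) (T f) = (LINT y|lborel. cnj (h y) * F (x - y))" by simp
  qed
  also have "\<dots> = (LINT x|lborel. LINT y|lborel. h x * (cnj (h y) * F (x - y)))"
    by simp
  also have "\<dots> = (LINT y|lborel. LINT x|lborel. h x * (cnj (h y) * F (x - y)))"
    using int by (rule lborel_pair.Fubini_integral[symmetric])
  also have "\<dots> = (LINT y|lborel. LINT w|lborel. h (y + w) * (cnj (h y) * F w))"
  proof (rule Bochner_Integration.integral_cong[OF refl])
    fix y
    show "(LINT x|lborel. h x * (cnj (h y) * F (x - y))) = (LINT w|lborel. h (y + w) * (cnj (h y) * F w))"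
    proof -
      have "(\<lambda>x. h x * (cnj (h y) * F (x - y))) \<in> borel_measurable borel" by measurable
      from shift[OF this, of y] show ?thesis by simp
    qed
  qed
  also have "\<dots> = (LINT w|lborel. LINT y|lborel. h (y + w) * (cnj (h y) * F w))"
  proof (rule lborel_pair.Fubini_integral, rule lborel_pair.integrable_pairI)
    have "(\<integral>\<^sup>+w. (\<integral>\<^sup>+y. ennreal (cmod (h (y + w) * (cnj (h y) * F w))) \<partial>lborel) \<partial>lborel)
      = (\<integral>\<^sup>+y. (\<integral>\<^sup>+w. ennreal (cmod (h (y + w) * (cnj (h y) * F w))) \<partial>lborel) \<partial>lborel)"
      by (rule lborel_pair.Fubini'[symmetric]) measurable
    also have "\<dots> = (\<integral>\<^sup>+y. (\<integral>\<^sup>+x. ennreal (cmod (h x * (cnj (h y) * F (x - y)))) \<partial>lborel) \<partial>lborel)"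
    proof (rule nn_integral_cong)
      fix y
      show "(\<integral>\<^sup>+w. ennreal (cmod (h (y + w) * (cnj (h y) * F w))) \<partial>lborel)
        = (\<integral>\<^sup>+x. ennreal (cmod (h x * (cnj (h y) * F (x - y)))) \<partial>lborel)"
      proof -
        have "(\<lambda>x. ennreal (cmod (h x * (cnj (h y) * F (x - y))))) \<in> borel_measurable borel" by measurable
        from nn_integral_lborel_shift[OF this, of y] show ?thesis by simp
      qed
    qed
    also have "\<dots> = (\<integral>\<^sup>+x. (\<integral>\<^sup>+y. ennreal (cmod (h x * (cnj (h y) * F (x - y)))) \<partial>lborel) \<partial>lborel)"
      by (rule lborel_pair.Fubini') measurable
    also have "\<dots> < \<infinity>"
      using int by (simp add: integrable_iff_bounded lborel.nn_integral_fst[symmetric] case_prod_beta)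
    finally show "(\<integral>\<^sup>+w. (\<integral>\<^sup>+y. ennreal (cmod (h (y + w) * (cnj (h y) * F w))) \<partial>lborel) \<partial>lborel) < \<infinity>" .
  qed measurable
  also have "\<dots> = (LINT w|lborel. of_real ((sqrt (2 * pi) / (2 * c)) ^ CARD('n)) * (F w * of_real (gaussian c w) * cis (s \<bullet> w)))"
  proof (rule Bochner_Integration.integral_cong[OF refl])
    fix w
    have hh: "h (y + w) * cnj (h y) = of_real (gaussian d (y + w) * gaussian d y) * cis (s \<bullet> w)" for y
    proof -
      have "cis (s \<bullet> (y + w)) * cnj (cis (s \<bullet> y)) = cis (s \<bullet> w)"
        by (simp add: cis_cnj cis_mult inner_add_right)
      then show ?thesis by (simp add: h_def mult_ac) 
    qed
    have sq: "gaussian d (- (1/2) *\<^sub>R w + y + w) * gaussian d (- (1/2) *\<^sub>R w + y) = gaussian c w * gaussian (2 * c) y" for y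
      unfolding gaussian_def d(2)
      by (simp add: exp_add[symmetric] inner_add_left inner_add_right inner_diff_left inner_diff_right
          inner_commute[of w y] field_simps)
    have "(LINT y|lborel. h (y + w) * (cnj (h y) * F w)) = (LINT y|lborel. (of_real (gaussian d (y + w) * gaussian d y)) * (cis (s \<bullet> w) * F w))"
      by (simp add: hh mult.assoc[symmetric])
    also have "\<dots> = (LINT y|lborel. of_real (gaussian d (y + w) * gaussian d y)) * (cis (s \<bullet> w) * F w)"
      by simp
    also have "(LINT y|lborel. complex_of_real (gaussian d (y + w) * gaussian d y))
        = (LINT y|lborel. complex_of_real (gaussian d (- (1/2) *\<^sub>R w + y + w) * gaussian d (- (1/2) *\<^sub>R w + y)))"
      by (rule shift) measurable
    also have "\<dots> = (LINT y|(lborel :: (real^'n) measure). complex_of_real (gaussian c w * gaussian (2 * c) y))"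
      by (simp only: sq)
    also have "\<dots> = of_real (gaussian c w) * of_real ((sqrt (2 * pi) / (2 * c)) ^ CARD('n))"
      using c by (simp add: integral_gaussian)
    finally show "(LINT y|lborel. h (y + w) * (cnj (h y) * F w))
      = of_real ((sqrt (2 * pi) / (2 * c)) ^ CARD('n)) * (F w * of_real (gaussian c w) * cis (s \<bullet> w))"
      by (simp add: mult_ac)
  qed
  also have "\<dots> = of_real ((sqrt (2 * pi) / (2 * c)) ^ CARD('n)) * (LINT w|lborel. F w * of_real (gaussian c w) * cis (s \<bullet> w))"
    by simp
  finally have eq: "of_real ((norm (T f))\<^sup>2) = of_real ((sqrt (2 * pi) / (2 * c)) ^ CARD('n)) *
     (LINT w|lborel. F w * of_real (gaussian c w) * cis (s \<bullet> w))" .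
  define k where "k = (sqrt (2 * pi) / (2 * c)) ^ CARD('n)"
  have k: "k > 0" using c by (simp add: k_def)
  show ?thesis
  proof (rule that)
    show "0 \<le> (norm (T f))\<^sup>2 / k"
      using k by simp
    show "(LINT w|lborel. cinner_L2 (U w f) f * of_real (gaussian c w) * cis (s \<bullet> w)) = of_real ((norm (T f))\<^sup>2 / k)"
      using eq k by (simp only: of_real_divide k_def[symmetric] F_def) simp
  qed
qed

text \<open>\<open>F\<close> is damped by a Gaussian so that its Fourier transform \<open>P\<close>
  exists, and \<open>P\<close> is non-negative by the preceding lemma. So far \<open>P\<close> is
  known to be bounded but not integrable, so a second Gaussian multiplies it. On the other side this
  convolves the damped \<open>F\<close> with a narrow Gaussian, which is the right-hand side after
  the substitution \<open>w = v + c *\<^sub>R z\<close>.\<close>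

lemma ex_regularized_spectral_density:
  assumes c: "c > 0"
  obtains \<rho> where "\<rho> \<in> borel_measurable borel" "integrable lborel \<rho>" "\<And>s. \<rho> s \<ge> 0"
    "\<And>v. (LINT s|lborel. of_real (\<rho> s) * cis (- (s \<bullet> v))) =
       of_real ((1 / sqrt (2 * pi)) ^ CARD('n)) *
       (LINT z|lborel. cinner_L2 (U (v + c *\<^sub>R z) f) f * of_real (gaussian c (v + c *\<^sub>R z)) * of_real (gaussian 1 z))"
proof -
  define F where "F w = cinner_L2 (U w f) f" for w
  have [measurable]: "F \<in> borel_measurable borel" unfolding F_def by measurable
  have F_le: "cmod (F w) \<le> (norm f)\<^sup>2" for w unfolding F_def by (rule cinner_U_le)
  define P where "P s = (LINT w|lborel. F w * of_real (gaussian c w) * cis (s \<bullet> w))" for s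
  have [measurable]: "P \<in> borel_measurable borel" unfolding P_def by measurable
  have P: "P s = of_real (Re (P s))" "Re (P s) \<ge> 0" for s
  proof -
    obtain r where r: "r \<ge> 0"
      "(LINT w|lborel. cinner_L2 (U w f) f * of_real (gaussian c w) * cis (s \<bullet> w)) = complex_of_real r"
      by (rule spectral_density_nonneg[OF c])
    then have "P s = of_real r" unfolding P_def F_def by blast
    then show "P s = of_real (Re (P s))" "Re (P s) \<ge> 0" using r(1) by simp_all
  qed
  let ?g = "gaussian c :: real^'n \<Rightarrow> real"
  have g: "integrable lborel ?g" by (rule integrable_gaussian[OF c])
  have P_le: "cmod (P s) \<le> (norm f)\<^sup>2 * (LINT w|lborel. ?g w)" for s
  proof -
    have "cmod (P s) \<le> (LINT w|lborel. cmod (F w * of_real (?g w) * cis (s \<bullet> w)))"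
      unfolding P_def by (rule integral_norm_bound)
    also have "\<dots> \<le> (LINT w|lborel. (norm f)\<^sup>2 * ?g w)"
      using F_le g by (intro integral_mono' integrable_mult_right)
        (auto simp: norm_mult gaussian_pos less_imp_le mult_right_mono)
    finally show ?thesis by simp
  qed
  \<comment> \<open>The power of \<open>1 / (2 * pi)\<close> is the constant of Fourier inversion,
    and \<open>?g s\<close> is the second Gaussian.\<close>
  define \<rho> where "\<rho> s = (1 / (2 * pi)) ^ CARD('n) * (?g s * Re (P s))" for s
  have \<rho>_meas[measurable]: "\<rho> \<in> borel_measurable borel" unfolding \<rho>_def by measurable
  have \<rho>_int: "integrable lborel \<rho>"
    unfolding \<rho>_def
  proof (intro integrable_mult_right Bochner_Integration.integrable_bound[OF integrable_mult_left[OF g]])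
    show "AE s in lborel. norm (?g s * Re (P s)) \<le> norm (?g s * ((norm f)\<^sup>2 * (LINT w|lborel. ?g w)))"
    proof (rule AE_I2)
      fix s
      have "\<bar>Re (P s)\<bar> \<le> (norm f)\<^sup>2 * (LINT w|lborel. ?g w)"
        using abs_Re_le_cmod P_le by (rule order_trans)
      also have "\<dots> \<le> \<bar>(norm f)\<^sup>2 * (LINT w|lborel. ?g w)\<bar>" by (rule abs_ge_self)
      finally show "norm (?g s * Re (P s)) \<le> norm (?g s * ((norm f)\<^sup>2 * (LINT w|lborel. ?g w)))"
        by (simp only: real_norm_def abs_mult[of "?g s"]) (intro mult_left_mono abs_ge_zero)
    qed
  qed measurable
  have \<rho>_nonneg: "\<rho> s \<ge> 0" for s
    using P by (simp add: \<rho>_def gaussian_pos less_imp_le)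
  have "(LINT s|lborel. of_real (\<rho> s) * cis (- (s \<bullet> v))) =
       of_real ((1 / sqrt (2 * pi)) ^ CARD('n)) *
       (LINT z|lborel. F (v + c *\<^sub>R z) * of_real (?g (v + c *\<^sub>R z)) * of_real (gaussian 1 z))" for v
  proof -
    let ?k = "complex_of_real ((1 / (2 * pi)) ^ CARD('n))"
    let ?h = "\<lambda>w s. of_real (?g s) * cis (- (s \<bullet> (v - w))) * (F w * of_real (?g w))"
    have "(LINT s|lborel. of_real (\<rho> s) * cis (- (s \<bullet> v))) = (LINT s|lborel. ?k * (LINT w|lborel. ?h w s))"
    proof (rule Bochner_Integration.integral_cong[OF refl])
      fix s
      have "of_real (\<rho> s) * cis (- (s \<bullet> v)) = ?k * (of_real (?g s) * (P s * cis (- (s \<bullet> v))))"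
        by (subst P) (simp add: \<rho>_def mult_ac)
      also have "of_real (?g s) * (P s * cis (- (s \<bullet> v))) = (LINT w|lborel. of_real (?g s) * ((F w * of_real (?g w) * cis (s \<bullet> w)) * cis (- (s \<bullet> v))))"
        unfolding P_def by simp
      also have "\<dots> = (LINT w|lborel. ?h w s)"
      proof (rule Bochner_Integration.integral_cong[OF refl])
        fix w
        have "cis (s \<bullet> w) * cis (- (s \<bullet> v)) = cis (- (s \<bullet> (v - w)))"
          by (simp add: cis_mult inner_diff_right)
        then show "of_real (?g s) * ((F w * of_real (?g w) * cis (s \<bullet> w)) * cis (- (s \<bullet> v))) = ?h w s"
          by (metis (no_types, lifting) mult.assoc mult.commute)
      qed
      finally show "of_real (\<rho> s) * cis (- (s \<bullet> v)) = ?k * (LINT w|lborel. ?h w s)" .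
    qed
    also have "\<dots> = ?k * (LINT s|lborel. LINT w|lborel. ?h w s)"
      by simp
    also have "(LINT s|lborel. LINT w|lborel. ?h w s) = (LINT w|lborel. LINT s|lborel. ?h w s)"
    proof (rule lborel_pair.Fubini_integral, rule lborel_pair.integrable_pairI)
      have "(\<integral>\<^sup>+w. (\<integral>\<^sup>+s. ennreal (cmod (?h w s)) \<partial>lborel) \<partial>lborel)
        \<le> (\<integral>\<^sup>+w. (\<integral>\<^sup>+s. ennreal (?g s) * (ennreal ((norm f)\<^sup>2) * ennreal (?g w)) \<partial>lborel) \<partial>lborel)"
      proof (intro nn_integral_mono)
        fix w s
        have "cmod (?h w s) \<le> ?g s * ((norm f)\<^sup>2 * ?g w)"
          using F_le[of w] by (simp add: norm_mult gaussian_pos less_imp_le mult_left_mono mult_right_mono)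
        then show "ennreal (cmod (?h w s)) \<le> ennreal (?g s) * (ennreal ((norm f)\<^sup>2) * ennreal (?g w))"
          by (simp add: gaussian_pos less_imp_le flip: ennreal_mult)
      qed
      also have "\<dots> < \<infinity>"
        using g by (simp add: nn_integral_cmult nn_integral_multc ennreal_mult_less_top nn_integral_eq_integral gaussian_pos less_imp_le)
      finally show "(\<integral>\<^sup>+w. (\<integral>\<^sup>+s. ennreal (cmod (?h w s)) \<partial>lborel) \<partial>lborel) < \<infinity>" .
    qed measurable
    also have "\<dots> = (LINT w|lborel. of_real ((sqrt (2 * pi) / c) ^ CARD('n) * gaussian (1 / c) (v - w)) * (F w * of_real (?g w)))"
      by (simp only: integral_mult_left_zero gaussian_scaled_fourier(2)[OF c]) simp
    also have "\<dots> = c ^ CARD('n) *\<^sub>R (LINT z|lborel. of_real ((sqrt (2 * pi) / c) ^ CARD('n) * gaussian (1 / c) (v - (v + c *\<^sub>R z))) * (F (v + c *\<^sub>R z) * of_real (?g (v + c *\<^sub>R z))))"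
    proof -
      have "(\<lambda>w. of_real ((sqrt (2 * pi) / c) ^ CARD('n) * gaussian (1 / c) (v - w)) * (F w * of_real (?g w))) \<in> borel_measurable borel"
        by measurable
      from lborel_affine_complex(1)[OF this c, of v] show ?thesis by simp
    qed
    also have "\<dots> = (LINT z|lborel. of_real (sqrt (2 * pi) ^ CARD('n)) * (F (v + c *\<^sub>R z) * of_real (?g (v + c *\<^sub>R z)) * of_real (gaussian 1 z)))"
    proof -
      have "gaussian (1 / c) (v - (v + c *\<^sub>R z)) = gaussian 1 z" for z :: "real^'n"
        using gaussian_scale[of "1 / c" "- c" z] c by (simp add: gaussian_def)
      moreover have "c ^ CARD('n) *\<^sub>R (of_real ((sqrt (2 * pi) / c) ^ CARD('n) * q) * B) = of_real (sqrt (2 * pi) ^ CARD('n)) * (B * of_real q)"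
        for q and B :: complex
      proof -
        have "c ^ CARD('n) *\<^sub>R (of_real ((sqrt (2 * pi) / c) ^ CARD('n) * q) * B)
            = of_real (c ^ CARD('n) * (sqrt (2 * pi) / c) ^ CARD('n)) * (B * of_real q)"
          by (simp only: scaleR_conv_of_real of_real_mult mult_ac)
        also have "c ^ CARD('n) * (sqrt (2 * pi) / c) ^ CARD('n) = sqrt (2 * pi) ^ CARD('n)"
          using c by (simp add: power_divide)
        finally show ?thesis .
      qed
      ultimately show ?thesis
        by (simp only: integral_scaleR_right[symmetric])
    qed
    also have "?k * \<dots> = of_real ((1 / sqrt (2 * pi)) ^ CARD('n)) *
       (LINT z|lborel. F (v + c *\<^sub>R z) * of_real (?g (v + c *\<^sub>R z)) * of_real (gaussian 1 z))"
    proof -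
      have "(1 / (2 * pi)) ^ CARD('n) * sqrt (2 * pi) ^ CARD('n) = (1 / sqrt (2 * pi)) ^ CARD('n)"
        by (simp add: power_mult_distrib[symmetric] sqrt_divide_self_eq inverse_eq_divide)
      then have "?k * of_real (sqrt (2 * pi) ^ CARD('n)) = of_real ((1 / sqrt (2 * pi)) ^ CARD('n))"
        by (simp only: of_real_mult[symmetric])
      then show ?thesis
        by (simp only: integral_mult_right_zero) (simp only: mult.assoc[symmetric])
    qed
    finally show ?thesis .
  qed
  then show ?thesis
    using that[OF \<rho>_meas \<rho>_int \<rho>_nonneg] unfolding F_def by blast
qed

text \<open>A substitute for Bochner's theorem, which would provide the spectral measure of \<open>f\<close>.\<close>

lemma ex_spectral_densities:
  obtains \<rho> where "\<And>k::nat. \<rho> k \<in> borel_measurable borel" "\<And>k. integrable lborel (\<rho> k)" "\<And>k s. \<rho> k s \<ge> 0"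
    "\<And>k. (LINT s|lborel. \<rho> k s) \<le> (norm f)\<^sup>2"
    "\<And>v. (\<lambda>k. LINT s|lborel. of_real (\<rho> k s) * cis (- (s \<bullet> v))) \<longlonglongrightarrow> cinner_L2 (U v f) f"
proof -
  define F where "F w = cinner_L2 (U w f) f" for w
  have F_cont: "continuous_on UNIV F" unfolding F_def by (rule continuous_cinner_U)
  have [measurable]: "F \<in> borel_measurable borel" unfolding F_def by measurable
  have F_le: "cmod (F w) \<le> (norm f)\<^sup>2" for w unfolding F_def by (rule cinner_U_le)
  define c where "c k = inverse (real (Suc k))" for k
  have c: "c k > 0" for k by (simp add: c_def)
  have c0: "c \<longlonglongrightarrow> 0" unfolding c_def by (rule LIMSEQ_inverse_real_of_nat)
  define a where "a = (1 / sqrt (2 * pi)) ^ CARD('n)"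
  have a0: "a \<ge> 0" by (simp add: a_def)
  let ?J = "\<lambda>k v z. F (v + c k *\<^sub>R z) * of_real (gaussian (c k) (v + c k *\<^sub>R z)) * of_real (gaussian 1 z)"
  have "\<exists>\<rho>. \<rho> \<in> borel_measurable borel \<and> integrable lborel \<rho> \<and> (\<forall>s. \<rho> s \<ge> 0) \<and>
    (\<forall>v. (LINT s|lborel. of_real (\<rho> s) * cis (- (s \<bullet> v))) = of_real a * (LINT z|lborel. ?J k v z))" for k
  proof -
    obtain r where r: "r \<in> borel_measurable borel" "integrable lborel r" "\<And>s. r s \<ge> 0"
      "\<And>v. (LINT s|lborel. of_real (r s) * cis (- (s \<bullet> v))) = of_real ((1 / sqrt (2 * pi)) ^ CARD('n)) *
       (LINT z|lborel. cinner_L2 (U (v + c k *\<^sub>R z) f) f * of_real (gaussian (c k) (v + c k *\<^sub>R z)) * of_real (gaussian 1 z))"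
      by (rule ex_regularized_spectral_density[OF c[of k], where f = f]) blast
    then show ?thesis unfolding F_def a_def by blast
  qed
  then obtain \<rho> where \<rho>: "\<And>k. \<rho> k \<in> borel_measurable borel" "\<And>k. integrable lborel (\<rho> k)" "\<And>k s. \<rho> k s \<ge> 0"
      "\<And>k v. (LINT s|lborel. of_real (\<rho> k s) * cis (- (s \<bullet> v))) = of_real a * (LINT z|lborel. ?J k v z)"
    by metis
  have g: "integrable lborel (gaussian 1 :: real^'n \<Rightarrow> real)" by (rule integrable_gaussian) simp
  \<comment> \<open>With this normalization the right-hand side is an expectation under the standard
    normal law. Taking \<open>v = 0\<close> bounds the masses; letting \<open>c k\<close> tend to 0
    removes the damping and contracts the argument of \<open>F\<close> to \<open>v\<close>, with
    \<open>J_le\<close> as the majorant.\<close>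
  have ag: "a * (LINT z|(lborel :: (real^'n) measure). gaussian 1 z) = 1"
    by (simp add: a_def integral_gaussian power_divide)
  have J_le: "cmod (?J k v z) \<le> (norm f)\<^sup>2 * gaussian 1 z" for k v z
    using mult_mono[OF F_le[of "v + c k *\<^sub>R z"] gaussian_le_1[of "c k" "v + c k *\<^sub>R z"]]
    by (simp add: norm_mult gaussian_pos less_imp_le mult_right_mono)
  have bound: "(LINT s|lborel. \<rho> k s) \<le> (norm f)\<^sup>2" for k
  proof -
    have "(LINT s|lborel. \<rho> k s) = cmod (LINT s|lborel. of_real (\<rho> k s) * cis (- (s \<bullet> 0)))"
      using \<rho>(3) by simp
    also have "\<dots> = a * cmod (LINT z|lborel. ?J k 0 z)"
      unfolding \<rho>(4) norm_mult norm_of_real using a0 by simp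
    also have "\<dots> \<le> a * (LINT z|(lborel :: (real^'n) measure). (norm f)\<^sup>2 * gaussian 1 z)"
    proof (rule mult_left_mono[OF _ a0])
      have "integrable lborel (\<lambda>z::real^'n. (norm f)\<^sup>2 * gaussian 1 z)"
        using g by (rule integrable_mult_right)
      then have "(LINT z|lborel. cmod (?J k 0 z)) \<le> (LINT z|(lborel :: (real^'n) measure). (norm f)\<^sup>2 * gaussian 1 z)"
        by (rule integral_mono') (rule J_le, simp add: gaussian_pos less_imp_le)
      then show "cmod (LINT z|lborel. ?J k 0 z) \<le> (LINT z|(lborel :: (real^'n) measure). (norm f)\<^sup>2 * gaussian 1 z)"
        using integral_norm_bound by (rule order_trans[rotated])
    qed
    also have "\<dots> = (norm f)\<^sup>2" using ag by (simp add: mult.left_commute)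
    finally show ?thesis .
  qed
  have lim: "(\<lambda>k. LINT s|lborel. of_real (\<rho> k s) * cis (- (s \<bullet> v))) \<longlonglongrightarrow> F v" for v
  proof -
    have "(\<lambda>k. LINT z|lborel. ?J k v z) \<longlonglongrightarrow> (LINT z|(lborel :: (real^'n) measure). F v * of_real (gaussian 1 z))"
    proof (rule integral_dominated_convergence)
      show "integrable lborel (\<lambda>z::real^'n. (norm f)\<^sup>2 * gaussian 1 z)"
        using g by (rule integrable_mult_right)
      show "AE z in lborel. cmod (?J k v z) \<le> (norm f)\<^sup>2 * gaussian 1 z" for k
        using J_le by (intro AE_I2)
      show "AE z in lborel. (\<lambda>k. ?J k v z) \<longlonglongrightarrow> F v * of_real (gaussian 1 z)"
      proof (intro AE_I2 tendsto_mult tendsto_const)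
        fix z
        have *: "(\<lambda>k. v + c k *\<^sub>R z) \<longlonglongrightarrow> v + 0 *\<^sub>R z"
          by (intro tendsto_intros c0)
        have "isCont F (v + 0 *\<^sub>R z)"
          using F_cont by (simp add: continuous_on_eq_continuous_at)
        from isCont_tendsto_compose[OF this *]
        have 1: "(\<lambda>k. F (v + c k *\<^sub>R z)) \<longlonglongrightarrow> F v" by simp
        have "(\<lambda>k. gaussian (c k) (v + c k *\<^sub>R z)) \<longlonglongrightarrow> exp (- (0\<^sup>2 * ((v + 0 *\<^sub>R z) \<bullet> (v + 0 *\<^sub>R z))) / 2)"
          unfolding gaussian_def by (intro tendsto_intros c0) simp
        then have "(\<lambda>k. complex_of_real (gaussian (c k) (v + c k *\<^sub>R z))) \<longlonglongrightarrow> of_real 1"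
          by (intro tendsto_of_real) simp
        from tendsto_mult[OF 1 this]
        show "(\<lambda>k. F (v + c k *\<^sub>R z) * of_real (gaussian (c k) (v + c k *\<^sub>R z))) \<longlonglongrightarrow> F v" by simp
      qed
    qed measurable
    then have "(\<lambda>k. of_real a * (LINT z|lborel. ?J k v z)) \<longlonglongrightarrow> of_real a * (LINT z|(lborel :: (real^'n) measure). F v * of_real (gaussian 1 z))"
      by (intro tendsto_intros)
    also have "of_real a * (LINT z|(lborel :: (real^'n) measure). F v * complex_of_real (gaussian 1 z)) = F v * of_real (a * (LINT z|(lborel :: (real^'n) measure). gaussian 1 z))"
      by simp
    finally show ?thesis unfolding \<rho>(4) ag by simp
  qed
  show ?thesis
  proof (rule that[of \<rho>])
    show "(\<lambda>k. LINT s|lborel. of_real (\<rho> k s) * cis (- (s \<bullet> v))) \<longlonglongrightarrow> cinner_L2 (U v f) f" for v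
      using lim[of v] unfolding F_def .
  qed (use \<rho>(1-3) bound in auto)
qed

end

section \<open>Symbols and functional calculus\<close>

lemma bounded_operatorI:
  assumes "\<And>f g. S (f + g) = S f + S g" "\<And>c f. S (c *\<^sub>C f) = c *\<^sub>C S f" "\<And>f. norm (S f) \<le> K * norm f"
  shows "bounded_operator S"
  unfolding bounded_operator_def using assms
  by (auto intro!: bounded_linear_intro[where K = K] simp: scaleR_scaleC mult.commute)

lemma bounded_operator_add: "bounded_operator S \<Longrightarrow> S (f + g) = S f + S g"
  by (simp add: bounded_operator_def linear_simps)

lemma bounded_operator_diff: "bounded_operator S \<Longrightarrow> S (f - g) = S f - S g"
  by (simp add: bounded_operator_def linear_simps)

lemma bounded_operator_scaleC: "bounded_operator S \<Longrightarrow> S (c *\<^sub>C f) = c *\<^sub>C S f"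
  by (simp add: bounded_operator_def)

lemma bounded_operator_bound:
  assumes "bounded_operator S"
  obtains K where "K \<ge> 0" "\<And>f. norm (S f) \<le> K * norm f"
  using bounded_linear.nonneg_bounded[of S] assms by (auto simp: bounded_operator_def mult.commute)

lemma bounded_operator_id: "bounded_operator (\<lambda>f. f)"
  by (rule bounded_operatorI[where K = 1]) auto

lemma bounded_operator_plus:
  assumes S: "bounded_operator S" and T: "bounded_operator T"
  shows "bounded_operator (\<lambda>f. S f + T f)"
proof -
  obtain K L where K: "\<And>f. norm (S f) \<le> K * norm f" and L: "\<And>f. norm (T f) \<le> L * norm f"
    using S T by (metis bounded_operator_bound)
  show ?thesis
  proof (rule bounded_operatorI[where K = "K + L"])
    fix f
    show "norm (S f + T f) \<le> (K + L) * norm f"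
      using K[of f] L[of f] norm_triangle_ineq[of "S f" "T f"] by (simp add: distrib_right)
  qed (use S T in \<open>simp_all add: bounded_operator_add bounded_operator_scaleC scaleC_add_right\<close>)
qed

lemma bounded_operator_scale:
  assumes S: "bounded_operator S"
  shows "bounded_operator (\<lambda>f. c *\<^sub>C S f)"
proof -
  obtain K where K: "\<And>f. norm (S f) \<le> K * norm f"
    using S by (metis bounded_operator_bound)
  show ?thesis
  proof (rule bounded_operatorI[where K = "cmod c * K"])
    fix f
    show "norm (c *\<^sub>C S f) \<le> cmod c * K * norm f"
      using mult_left_mono[OF K[of f], of "cmod c"] by (simp add: norm_scaleC mult.assoc)
  qed (use S in \<open>simp_all add: bounded_operator_add bounded_operator_scaleC scaleC_add_right scaleC_scaleC mult.commute\<close>)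
qed

lemma bounded_operator_comp:
  assumes S: "bounded_operator S" and T: "bounded_operator T"
  shows "bounded_operator (\<lambda>f. S (T f))"
proof -
  obtain K L where K: "K \<ge> 0" "\<And>f. norm (S f) \<le> K * norm f" and L: "\<And>f. norm (T f) \<le> L * norm f"
    using S T by (metis bounded_operator_bound)
  show ?thesis
  proof (rule bounded_operatorI[where K = "K * L"])
    fix f
    show "norm (S (T f)) \<le> K * L * norm f"
      using K(2)[of "T f"] mult_left_mono[OF L[of f] K(1)] by simp
  qed (use S T in \<open>simp_all add: bounded_operator_add bounded_operator_scaleC\<close>)
qed

lemma parallelogram:
  fixes x y :: "'a::real_inner"
  shows "(norm (x + y))\<^sup>2 + (norm (x - y))\<^sup>2 = 2 * (norm x)\<^sup>2 + 2 * (norm y)\<^sup>2"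
  by (simp add: power2_norm_eq_inner inner_add_left inner_add_right inner_diff_left inner_diff_right)

text \<open>Polarization and the parallelogram identity pass from the quadratic form to
  \<open>cinner_L2 (S f) g\<close>. Symbols control quadratic forms, so this is how they control
  norms. The factor 2 does no harm: in every application the bound is 0 or tends to 0.\<close>

lemma norm_le_numerical_radius:
  assumes S: "bounded_operator S" and c: "\<And>f. cmod (cinner_L2 (S f) f) \<le> c * (norm f)\<^sup>2"
  shows "norm (S f) \<le> 2 * c * norm f"
proof (cases "S f = 0 \<or> f = 0")
  case True
  then show ?thesis
  proof
    assume "S f = 0"
    moreover have "0 \<le> c * (norm f)\<^sup>2" using c[of f] norm_ge_zero order_trans by blast
    then have "0 \<le> c * norm f" by (auto simp: zero_le_mult_iff)
    ultimately show ?thesis by simp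
  next
    assume "f = 0"
    then show ?thesis using bounded_operator_diff[OF S, of 0 0] by simp
  qed
next
  case False
  let ?q = "\<lambda>f. cinner_L2 (S f) f"
  have polar: "cmod (cinner_L2 (S f) g) \<le> c * ((norm f)\<^sup>2 + (norm g)\<^sup>2)" for f g
  proof -
    have "4 * cinner_L2 (S f) g = ?q (f + g) - ?q (f - g) + \<i> * ?q (f + \<i> *\<^sub>C g) - \<i> * ?q (f - \<i> *\<^sub>C g)"
      by (simp add: bounded_operator_add[OF S] bounded_operator_diff[OF S] bounded_operator_scaleC[OF S]
          cinner_add_left cinner_add_right cinner_diff_left cinner_diff_right cinner_scaleC_left cinner_scaleC_right
          algebra_simps)
    also have "cmod \<dots> \<le> cmod (?q (f + g)) + cmod (?q (f - g)) + cmod (\<i> * ?q (f + \<i> *\<^sub>C g)) + cmod (\<i> * ?q (f - \<i> *\<^sub>C g))"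
      by (intro norm_triangle_le norm_triangle_le_diff add_mono order_refl)
    also have "\<dots> \<le> c * (norm (f + g))\<^sup>2 + c * (norm (f - g))\<^sup>2 + c * (norm (f + \<i> *\<^sub>C g))\<^sup>2 + c * (norm (f - \<i> *\<^sub>C g))\<^sup>2"
      unfolding norm_mult norm_ii mult_1_left by (intro add_mono c)
    also have "\<dots> = c * (((norm (f + g))\<^sup>2 + (norm (f - g))\<^sup>2) + ((norm (f + \<i> *\<^sub>C g))\<^sup>2 + (norm (f - \<i> *\<^sub>C g))\<^sup>2))"
      by (simp add: algebra_simps)
    also have "\<dots> = 4 * (c * ((norm f)\<^sup>2 + (norm g)\<^sup>2))"
      by (simp add: parallelogram norm_scaleC)
    finally show ?thesis by (simp add: norm_mult)
  qed
  \<comment> \<open>This makes the test vector \<open>r *\<^sub>R S f\<close> as long as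
    \<open>f\<close>.\<close>
  define r where "r = norm f / norm (S f)"
  have r: "r > 0" using False by (simp add: r_def)
  have "r * (norm (S f))\<^sup>2 = cmod (cinner_L2 (S f) (r *\<^sub>R S f))"
    using r by (simp add: scaleR_scaleC cinner_scaleC_right cinner_self norm_mult norm_power)
  also have "\<dots> \<le> c * ((norm f)\<^sup>2 + (norm (r *\<^sub>R S f))\<^sup>2)" by (rule polar)
  also have "norm (r *\<^sub>R S f) = norm f" using False by (simp add: r_def)
  finally have "norm f * norm (S f) \<le> c * (2 * (norm f)\<^sup>2)"
    using False by (simp add: r_def power2_eq_square)
  then show ?thesis using False by (simp add: power2_eq_square mult_ac)
qed

section \<open>Symbols relative to the dilation group\<close>

lemma integrable_mult_bounded:
  fixes r :: "'b \<Rightarrow> complex"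
  assumes r: "integrable M r" and [measurable]: "p \<in> borel_measurable M" and p: "\<And>s. cmod (p s) \<le> c"
  shows "integrable M (\<lambda>s. r s * p s)" "(LINT s|M. cmod (r s * p s)) \<le> c * (LINT s|M. cmod (r s))"
proof -
  have [measurable]: "r \<in> borel_measurable M" using r by auto
  have c: "0 \<le> c" using p norm_ge_zero order_trans by blast
  have le: "cmod (r s * p s) \<le> c * cmod (r s)" for s
    using mult_left_mono[OF p[of s] norm_ge_zero[of "r s"]] by (simp add: norm_mult mult.commute)
  have int: "integrable M (\<lambda>s. c * cmod (r s))" using r by (intro integrable_mult_right integrable_norm)
  show "integrable M (\<lambda>s. r s * p s)"
    by (rule Bochner_Integration.integrable_bound[OF int]) (use le c in \<open>auto simp: abs_mult\<close>)
  have "(LINT s|M. cmod (r s * p s)) \<le> (LINT s|M. c * cmod (r s))"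
    by (rule integral_mono'[OF int le]) (use c in auto)
  then show "(LINT s|M. cmod (r s * p s)) \<le> c * (LINT s|M. cmod (r s))" by simp
qed

context dilation_group
begin

text \<open>For \<open>f\<close> different from \<open>g\<close> the spectral measure is complex,
  and multiplying densities by a complex symbol must lead to admissible densities again; hence
  complex values and, in place of positivity, a bound on the total masses. That bound supplies the
  majorants for passing to the limit in \<open>k\<close>.\<close>

definition spectral_approx :: "(nat \<Rightarrow> real^'n \<Rightarrow> complex) \<Rightarrow> (real^'n) L2 \<Rightarrow> (real^'n) L2 \<Rightarrow> bool" where
  "spectral_approx \<rho> f g \<longleftrightarrow> (\<forall>k. integrable lborel (\<rho> k)) \<and> (\<exists>B. \<forall>k. (LINT s|lborel. cmod (\<rho> k s)) \<le> B) \<and>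
     (\<forall>w. (\<lambda>k. LINT s|lborel. \<rho> k s * cis (- (s \<bullet> w))) \<longlonglongrightarrow> cinner_L2 (U w f) g)"

text \<open>
  The operator \<open>S\<close> acts as multiplication by \<open>\<psi>\<close> in the spectral representation of the
  dilation group, whose spectral measures are replaced by approximating densities.
\<close>

definition has_symbol :: "((real^'n) L2 \<Rightarrow> (real^'n) L2) \<Rightarrow> (real^'n \<Rightarrow> complex) \<Rightarrow> bool" where
  "has_symbol S \<psi> \<longleftrightarrow> bounded_operator S \<and> (\<forall>w f. S (U w f) = U w (S f)) \<and>
     \<psi> \<in> borel_measurable borel \<and> (\<exists>M. \<forall>s. cmod (\<psi> s) \<le> M) \<and>
     (\<forall>\<rho> f g. spectral_approx \<rho> f g \<longrightarrow> (\<lambda>k. LINT s|lborel. \<rho> k s * \<psi> s) \<longlonglongrightarrow> cinner_L2 (S f) g)"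

lemma has_symbol_lim:
  "has_symbol S \<psi> \<Longrightarrow> spectral_approx \<rho> f g \<Longrightarrow> (\<lambda>k. LINT s|lborel. \<rho> k s * \<psi> s) \<longlonglongrightarrow> cinner_L2 (S f) g"
  unfolding has_symbol_def by blast

lemma has_symbol_commute: "has_symbol S \<psi> \<Longrightarrow> S (U w f) = U w (S f)"
  unfolding has_symbol_def by blast

text \<open>Fubini's theorem moves the densities inside the average. There they converge for every
  fixed \<open>\<tau> u\<close>, dominated by \<open>cmod (\<kappa> u)\<close> times the bound on
  the masses.\<close>

lemma average_has_symbol:
  assumes T: "is_average N \<kappa> \<tau> T" and N: "sigma_finite_measure N" and \<kappa>: "integrable N \<kappa>"
    and [measurable]: "\<tau> \<in> N \<rightarrow>\<^sub>M borel"
  shows "has_symbol T (\<lambda>s. LINT u|N. \<kappa> u * cis (- (s \<bullet> \<tau> u)))"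
  unfolding has_symbol_def
proof (intro conjI allI impI)
  interpret N: sigma_finite_measure N by fact
  interpret P: pair_sigma_finite N "lborel :: (real^'n) measure" ..
  have [measurable]: "\<kappa> \<in> borel_measurable N" using \<kappa> by auto
  show "bounded_operator T" using T \<kappa> by (rule bounded_operator_average)
  show "T (U w f) = U w (T f)" for w f using T by (rule average_commute)
  show "(\<lambda>s. LINT u|N. \<kappa> u * cis (- (s \<bullet> \<tau> u))) \<in> borel_measurable borel" by measurable
  have "cmod (LINT u|N. \<kappa> u * cis (- (s \<bullet> \<tau> u))) \<le> (LINT u|N. cmod (\<kappa> u))" for s
    by (rule order_trans[OF integral_norm_bound]) (simp add: norm_mult)
  then show "\<exists>M. \<forall>s. cmod (LINT u|N. \<kappa> u * cis (- (s \<bullet> \<tau> u))) \<le> M" by blast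
  fix \<rho> f g assume "spectral_approx \<rho> f g"
  then obtain B where \<rho>: "\<And>k. integrable lborel (\<rho> k)" and B: "\<And>k. (LINT s|lborel. cmod (\<rho> k s)) \<le> B"
    and lim: "\<And>w. (\<lambda>k. LINT s|lborel. \<rho> k s * cis (- (s \<bullet> w))) \<longlonglongrightarrow> cinner_L2 (U w f) g"
    by (auto simp: spectral_approx_def)
  have [measurable]: "\<rho> k \<in> borel_measurable borel" for k
    using \<rho>[of k] by auto
  have swap: "(LINT s|lborel. \<rho> k s * (LINT u|N. \<kappa> u * cis (- (s \<bullet> \<tau> u))))
      = (LINT u|N. \<kappa> u * (LINT s|lborel. \<rho> k s * cis (- (s \<bullet> \<tau> u))))" for k
  proof -
    have int: "integrable (N \<Otimes>\<^sub>M lborel) (\<lambda>(u, s). \<rho> k s * (\<kappa> u * cis (- (s \<bullet> \<tau> u))))"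
    proof (rule P.integrable_pairI)
      have "(\<integral>\<^sup>+u. (\<integral>\<^sup>+s. ennreal (cmod (\<rho> k s * (\<kappa> u * cis (- (s \<bullet> \<tau> u))))) \<partial>lborel) \<partial>N)
        = (\<integral>\<^sup>+u. (\<integral>\<^sup>+s. ennreal (cmod (\<rho> k s)) * ennreal (cmod (\<kappa> u)) \<partial>lborel) \<partial>N)"
        by (simp add: norm_mult ennreal_mult)
      also have "\<dots> < \<infinity>"
        using \<rho>[of k] \<kappa> by (simp add: nn_integral_cmult nn_integral_multc ennreal_mult_less_top integrable_iff_bounded)
      finally show "(\<integral>\<^sup>+u. (\<integral>\<^sup>+s. ennreal (cmod (\<rho> k s * (\<kappa> u * cis (- (s \<bullet> \<tau> u))))) \<partial>lborel) \<partial>N) < \<infinity>" .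
    qed measurable
    have "(LINT s|lborel. \<rho> k s * (LINT u|N. \<kappa> u * cis (- (s \<bullet> \<tau> u))))
        = (LINT s|lborel. (LINT u|N. \<rho> k s * (\<kappa> u * cis (- (s \<bullet> \<tau> u)))))"
      by simp
    also have "\<dots> = (LINT u|N. (LINT s|lborel. \<rho> k s * (\<kappa> u * cis (- (s \<bullet> \<tau> u)))))"
      using int by (rule P.Fubini_integral)
    also have "\<dots> = (LINT u|N. \<kappa> u * (LINT s|lborel. \<rho> k s * cis (- (s \<bullet> \<tau> u))))"
      by (simp add: mult.left_commute[of "\<rho> _ _"])
    finally show ?thesis .
  qed
  have "(\<lambda>k. LINT u|N. \<kappa> u * (LINT s|lborel. \<rho> k s * cis (- (s \<bullet> \<tau> u))))
      \<longlonglongrightarrow> (LINT u|N. \<kappa> u * cinner_L2 (U (\<tau> u) f) g)"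
  proof (rule integral_dominated_convergence[where w = "\<lambda>u. cmod (\<kappa> u) * B"])
    show "integrable N (\<lambda>u. cmod (\<kappa> u) * B)" using \<kappa> by (intro integrable_mult_left integrable_norm)
    show "AE u in N. (\<lambda>k. \<kappa> u * (LINT s|lborel. \<rho> k s * cis (- (s \<bullet> \<tau> u)))) \<longlonglongrightarrow> \<kappa> u * cinner_L2 (U (\<tau> u) f) g"
      by (intro AE_I2 tendsto_intros lim)
    show "AE u in N. cmod (\<kappa> u * (LINT s|lborel. \<rho> k s * cis (- (s \<bullet> \<tau> u)))) \<le> cmod (\<kappa> u) * B" for k
    proof (rule AE_I2)
      fix u
      have "cmod (LINT s|lborel. \<rho> k s * cis (- (s \<bullet> \<tau> u))) \<le> (LINT s|lborel. cmod (\<rho> k s))"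
        by (rule order_trans[OF integral_norm_bound]) (simp add: norm_mult)
      also note B
      finally show "cmod (\<kappa> u * (LINT s|lborel. \<rho> k s * cis (- (s \<bullet> \<tau> u)))) \<le> cmod (\<kappa> u) * B"
        by (simp add: norm_mult mult_left_mono)
    qed
    show "(\<lambda>u. \<kappa> u * cinner_L2 (U (\<tau> u) f) g) \<in> borel_measurable N"
      using T unfolding is_average_def by (blast intro: borel_measurable_integrable)
  qed measurable
  then show "(\<lambda>k. LINT s|lborel. \<rho> k s * (LINT u|N. \<kappa> u * cis (- (s \<bullet> \<tau> u)))) \<longlonglongrightarrow> cinner_L2 (T f) g"
    using T by (simp add: swap is_average_def)
qed

lemma has_symbol_id: "has_symbol (\<lambda>f. f) (\<lambda>s. 1)"
proof -
  have "(\<lambda>k. LINT s|lborel. \<rho> k s) \<longlonglongrightarrow> cinner_L2 f g" if "spectral_approx \<rho> f g" for \<rho> f g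
    using that unfolding spectral_approx_def by (elim conjE allE[of _ 0]) (simp add: U_zero)
  then show ?thesis by (auto simp: has_symbol_def bounded_operator_id)
qed

lemma has_symbol_scale:
  assumes "has_symbol S \<psi>" shows "has_symbol (\<lambda>f. c *\<^sub>C S f) (\<lambda>s. c * \<psi> s)"
  unfolding has_symbol_def
proof (intro conjI allI impI)
  obtain M where "\<And>s. cmod (\<psi> s) \<le> M" using assms by (auto simp: has_symbol_def)
  then have "\<forall>s. cmod (c * \<psi> s) \<le> cmod c * M" by (simp add: norm_mult mult_left_mono)
  then show "\<exists>M. \<forall>s. cmod (c * \<psi> s) \<le> M" by blast
  fix \<rho> f g assume "spectral_approx \<rho> f g"
  then have "(\<lambda>k. LINT s|lborel. \<rho> k s * \<psi> s) \<longlonglongrightarrow> cinner_L2 (S f) g"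
    using assms by (simp add: has_symbol_def)
  then have "(\<lambda>k. c * (LINT s|lborel. \<rho> k s * \<psi> s)) \<longlonglongrightarrow> c * cinner_L2 (S f) g"
    by (rule tendsto_mult_left)
  then show "(\<lambda>k. LINT s|lborel. \<rho> k s * (c * \<psi> s)) \<longlonglongrightarrow> cinner_L2 (c *\<^sub>C S f) g"
    by (simp add: cinner_scaleC_left mult.left_commute[of _ c])
qed (use assms in \<open>auto simp: has_symbol_def bounded_operator_scale U_scaleC\<close>)

lemma has_symbol_add:
  assumes S: "has_symbol S \<psi>" and T: "has_symbol T \<phi>"
  shows "has_symbol (\<lambda>f. S f + T f) (\<lambda>s. \<psi> s + \<phi> s)"
  unfolding has_symbol_def
proof (intro conjI allI impI)
  have [measurable]: "\<psi> \<in> borel_measurable borel" "\<phi> \<in> borel_measurable borel"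
    using S T by (auto simp: has_symbol_def)
  obtain M M' where M: "\<And>s. cmod (\<psi> s) \<le> M" "\<And>s. cmod (\<phi> s) \<le> M'"
    using S T unfolding has_symbol_def by blast
  then have "\<forall>s. cmod (\<psi> s + \<phi> s) \<le> M + M'" by (meson norm_triangle_mono)
  then show "\<exists>M. \<forall>s. cmod (\<psi> s + \<phi> s) \<le> M" by blast
  fix \<rho> f g assume \<rho>: "spectral_approx \<rho> f g"
  then have int: "integrable lborel (\<rho> k)" for k by (simp add: spectral_approx_def)
  have "(\<lambda>k. (LINT s|lborel. \<rho> k s * \<psi> s) + (LINT s|lborel. \<rho> k s * \<phi> s)) \<longlonglongrightarrow> cinner_L2 (S f) g + cinner_L2 (T f) g"
    using S T \<rho> by (intro tendsto_add) (auto simp: has_symbol_def)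
  moreover have "integrable lborel (\<lambda>s. \<rho> k s * \<psi> s)" "integrable lborel (\<lambda>s. \<rho> k s * \<phi> s)" for k
    by (rule integrable_mult_bounded(1)[OF int _ M(1)], simp) (rule integrable_mult_bounded(1)[OF int _ M(2)], simp)
  ultimately show "(\<lambda>k. LINT s|lborel. \<rho> k s * (\<psi> s + \<phi> s)) \<longlonglongrightarrow> cinner_L2 (S f + T f) g"
    by (simp add: distrib_left cinner_add_left)
qed (use S T in \<open>auto simp: has_symbol_def bounded_operator_plus U_add\<close>)

lemma has_symbol_diff:
  assumes S: "has_symbol S \<psi>" and T: "has_symbol T \<phi>"
  shows "has_symbol (\<lambda>f. S f - T f) (\<lambda>s. \<psi> s - \<phi> s)"
proof -
  have "(- 1) *\<^sub>C h = - h" for h :: "(real^'n) L2"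
    using scaleR_scaleC[of "-1" h] by simp
  then show ?thesis
    using has_symbol_add[OF S has_symbol_scale[OF T, of "- 1"]] by simp
qed

text \<open>If \<open>\<rho>\<close> approximates the pair \<open>f\<close>, \<open>g\<close>, then
  \<open>\<rho>\<close> times the symbol of \<open>T\<close> approximates \<open>T f\<close>,
  \<open>g\<close>, and to these densities the symbol of \<open>S\<close> can be applied.\<close>

lemma has_symbol_comp:
  assumes S: "has_symbol S \<psi>" and T: "has_symbol T \<phi>"
  shows "has_symbol (\<lambda>f. S (T f)) (\<lambda>s. \<psi> s * \<phi> s)"
  unfolding has_symbol_def
proof (intro conjI allI impI)
  have [measurable]: "\<psi> \<in> borel_measurable borel" "\<phi> \<in> borel_measurable borel"
    using S T by (auto simp: has_symbol_def)
  obtain M M' where M: "\<And>s. cmod (\<psi> s) \<le> M" "\<And>s. cmod (\<phi> s) \<le> M'"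
    using S T unfolding has_symbol_def by blast
  then have "\<forall>s. cmod (\<psi> s * \<phi> s) \<le> M * M'"
    unfolding norm_mult by (metis mult_mono' norm_ge_zero)
  then show "\<exists>M. \<forall>s. cmod (\<psi> s * \<phi> s) \<le> M" by blast
  fix \<rho> f g assume \<rho>: "spectral_approx \<rho> f g"
  then have int: "integrable lborel (\<rho> k)" for k by (simp add: spectral_approx_def)
  obtain B where B: "\<And>k. (LINT s|lborel. cmod (\<rho> k s)) \<le> B"
    using \<rho> by (auto simp: spectral_approx_def)
  have M': "0 \<le> M'" using M(2) norm_ge_zero order_trans by blast
  have "spectral_approx (\<lambda>k s. \<rho> k s * \<phi> s) (T f) g"
    unfolding spectral_approx_def
  proof (intro conjI allI)
    show "integrable lborel (\<lambda>s. \<rho> k s * \<phi> s)" for k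
      by (rule integrable_mult_bounded(1)[OF int _ M(2)]) simp
    have "(LINT s|lborel. cmod (\<rho> k s * \<phi> s)) \<le> M' * B" for k
    proof -
      have "(LINT s|lborel. cmod (\<rho> k s * \<phi> s)) \<le> M' * (LINT s|lborel. cmod (\<rho> k s))"
        using int M(2) by (intro integrable_mult_bounded(2)) auto
      also have "\<dots> \<le> M' * B" using M' B by (intro mult_left_mono)
      finally show ?thesis .
    qed
    then show "\<exists>B. \<forall>k. (LINT s|lborel. cmod (\<rho> k s * \<phi> s)) \<le> B" by blast
    fix w
    \<comment> \<open>Modulating the densities replaces \<open>f\<close> by \<open>U w f\<close>.
      The symbol of \<open>T\<close> then gives the coefficient of \<open>T (U w f)\<close>, and
      commutation with the group rewrites it as the coefficient of \<open>U w (T f)\<close>.\<close>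
    have "spectral_approx (\<lambda>k s. \<rho> k s * cis (- (s \<bullet> w))) (U w f) g"
      unfolding spectral_approx_def
    proof (intro conjI allI)
      show "integrable lborel (\<lambda>s. \<rho> k s * cis (- (s \<bullet> w)))" for k
        using int by (intro integrable_mult_bounded(1)[where c = 1]) auto
      show "\<exists>B. \<forall>k. (LINT s|lborel. cmod (\<rho> k s * cis (- (s \<bullet> w)))) \<le> B"
        using B by (auto simp: norm_mult)
      fix v
      have "(\<lambda>k. LINT s|lborel. \<rho> k s * cis (- (s \<bullet> (v + w)))) \<longlonglongrightarrow> cinner_L2 (U (v + w) f) g"
        using \<rho> unfolding spectral_approx_def by blast
      then show "(\<lambda>k. LINT s|lborel. \<rho> k s * cis (- (s \<bullet> w)) * cis (- (s \<bullet> v))) \<longlonglongrightarrow> cinner_L2 (U v (U w f)) g"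
        by (simp add: U_U mult.assoc cis_mult inner_add_right minus_diff_commute)
    qed
    then have "(\<lambda>k. LINT s|lborel. \<rho> k s * cis (- (s \<bullet> w)) * \<phi> s) \<longlonglongrightarrow> cinner_L2 (T (U w f)) g"
      by (rule has_symbol_lim[OF T])
    then show "(\<lambda>k. LINT s|lborel. \<rho> k s * \<phi> s * cis (- (s \<bullet> w))) \<longlonglongrightarrow> cinner_L2 (U w (T f)) g"
      by (simp add: has_symbol_commute[OF T] mult.assoc mult.commute[of "\<phi> _"])
  qed
  then have "(\<lambda>k. LINT s|lborel. \<rho> k s * \<phi> s * \<psi> s) \<longlonglongrightarrow> cinner_L2 (S (T f)) g"
    using S by (simp add: has_symbol_def)
  then show "(\<lambda>k. LINT s|lborel. \<rho> k s * (\<psi> s * \<phi> s)) \<longlonglongrightarrow> cinner_L2 (S (T f)) g"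
    by (simp add: mult.assoc mult.commute[of "\<phi> _"])
qed (use S T in \<open>auto simp: has_symbol_def bounded_operator_comp\<close>)

lemma has_symbol_cinner_limit:
  assumes S: "has_symbol S \<psi>"
  obtains \<rho> :: "nat \<Rightarrow> real^'n \<Rightarrow> real" where "\<And>k. integrable lborel (\<rho> k)" "\<And>k s. \<rho> k s \<ge> 0"
    "\<And>k. (LINT s|lborel. \<rho> k s) \<le> (norm f)\<^sup>2"
    "(\<lambda>k. LINT s|lborel. of_real (\<rho> k s) * \<psi> s) \<longlonglongrightarrow> cinner_L2 (S f) f"
proof -
  obtain \<rho> where \<rho>: "\<And>k::nat. \<rho> k \<in> borel_measurable borel" "\<And>k. integrable lborel (\<rho> k)" "\<And>k s. \<rho> k s \<ge> 0"
    "\<And>k. (LINT s|lborel. \<rho> k s) \<le> (norm f)\<^sup>2"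
    "\<And>v. (\<lambda>k. LINT s|lborel. of_real (\<rho> k s) * cis (- (s \<bullet> v))) \<longlonglongrightarrow> cinner_L2 (U v f) f"
    by (rule ex_spectral_densities[where f = f]) blast
  have "spectral_approx (\<lambda>k s. of_real (\<rho> k s)) f f"
    using \<rho> by (auto simp: spectral_approx_def)
  then have "(\<lambda>k. LINT s|lborel. of_real (\<rho> k s) * \<psi> s) \<longlonglongrightarrow> cinner_L2 (S f) f"
    using S by (simp add: has_symbol_def)
  with \<rho> that show ?thesis by blast
qed

lemma has_symbol_norm_le:
  assumes S: "has_symbol S \<psi>" and c: "\<And>s. cmod (\<psi> s) \<le> c"
  shows "norm (S f) \<le> 2 * c * norm f"
proof (rule norm_le_numerical_radius)
  show "bounded_operator S" using S by (simp add: has_symbol_def)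
  have c0: "0 \<le> c" using c norm_ge_zero order_trans by blast
  have [measurable]: "\<psi> \<in> borel_measurable borel" using S by (simp add: has_symbol_def)
  fix f
  obtain \<rho> :: "nat \<Rightarrow> real^'n \<Rightarrow> real" where \<rho>: "\<And>k. integrable lborel (\<rho> k)" "\<And>k s. \<rho> k s \<ge> 0"
    "\<And>k. (LINT s|lborel. \<rho> k s) \<le> (norm f)\<^sup>2"
    "(\<lambda>k. LINT s|lborel. of_real (\<rho> k s) * \<psi> s) \<longlonglongrightarrow> cinner_L2 (S f) f"
    by (rule has_symbol_cinner_limit[OF S, where f = f]) blast
  have "cmod (LINT s|lborel. of_real (\<rho> k s) * \<psi> s) \<le> c * (norm f)\<^sup>2" for k
  proof -
    have "cmod (LINT s|lborel. of_real (\<rho> k s) * \<psi> s) \<le> (LINT s|lborel. cmod (of_real (\<rho> k s) * \<psi> s))"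
      by (rule integral_norm_bound)
    also have "\<dots> \<le> c * (LINT s|lborel. cmod (of_real (\<rho> k s)))"
      using \<rho>(1) c by (intro integrable_mult_bounded(2)) auto
    also have "\<dots> \<le> c * (norm f)\<^sup>2"
      using \<rho>(2,3) c0 by (intro mult_left_mono) auto
    finally show ?thesis .
  qed
  then show "cmod (cinner_L2 (S f) f) \<le> c * (norm f)\<^sup>2"
    by (intro LIMSEQ_le_const2[OF tendsto_norm[OF \<rho>(4)]]) auto
qed

lemma has_symbol_nonneg:
  assumes S: "has_symbol S \<psi>" and nonneg: "\<And>s. \<psi> s \<in> \<real>\<^sub>\<ge>\<^sub>0"
  shows "nonneg_operator S"
  unfolding nonneg_operator_def
proof (intro conjI allI)
  show "bounded_operator S" using S by (simp add: has_symbol_def)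
  fix f
  obtain \<rho> :: "nat \<Rightarrow> real^'n \<Rightarrow> real" where \<rho>: "\<And>k. integrable lborel (\<rho> k)" "\<And>k s. \<rho> k s \<ge> 0"
    "\<And>k. (LINT s|lborel. \<rho> k s) \<le> (norm f)\<^sup>2"
    "(\<lambda>k. LINT s|lborel. of_real (\<rho> k s) * \<psi> s) \<longlonglongrightarrow> cinner_L2 (S f) f"
    by (rule has_symbol_cinner_limit[OF S, where f = f]) blast
  have \<psi>: "\<psi> s = of_real (Re (\<psi> s))" "Re (\<psi> s) \<ge> 0" for s
    using nonneg[of s] by (auto simp: complex_nonneg_Reals_iff complex_eq_iff)
  have "(LINT s|lborel. of_real (\<rho> k s) * \<psi> s) = of_real (LINT s|lborel. \<rho> k s * Re (\<psi> s))" for k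
    by (subst \<psi>) (simp flip: of_real_mult)
  moreover have "(LINT s|lborel. \<rho> k s * Re (\<psi> s)) \<ge> 0" for k
    using \<rho>(2) \<psi>(2) by (intro Bochner_Integration.integral_nonneg) auto
  ultimately have "(LINT s|lborel. of_real (\<rho> k s) * \<psi> s) \<in> \<real>\<^sub>\<ge>\<^sub>0" for k
    by simp
  then show "cinner_L2 (S f) f \<in> \<real>\<^sub>\<ge>\<^sub>0"
    by (intro Lim_in_closed_set[OF closed_nonneg_Reals_complex _ _ \<rho>(4)]) auto
qed

text \<open>Operators are approximated in norm and symbols uniformly. Because the masses of the
  densities are bounded, replacing the symbol costs an error independent of \<open>k\<close>, so the
  limit in \<open>k\<close> survives.\<close>

lemma has_symbol_limit:
  assumes S: "bounded_operator S" and [measurable]: "\<psi> \<in> borel_measurable borel"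
    and lim: "\<And>e. e > 0 \<Longrightarrow> \<exists>T \<phi>. has_symbol T \<phi> \<and> (\<forall>f. norm (S f - T f) \<le> e * norm f) \<and> (\<forall>s. cmod (\<psi> s - \<phi> s) \<le> e)"
  shows "has_symbol S \<psi>"
  unfolding has_symbol_def
proof (intro conjI allI impI S)
  fix w f
  have "norm (S (U w f) - U w (S f)) \<le> e" if e: "e > 0" for e
  proof -
    define d where "d = e / (2 * norm f + 1)"
    have d: "d > 0" using e by (simp add: d_def add_nonneg_pos)
    obtain T \<phi> where T: "has_symbol T \<phi>" "\<And>f. norm (S f - T f) \<le> d * norm f"
      using lim[OF d] by blast
    have eq: "S (U w f) - U w (S f) = (S (U w f) - T (U w f)) - U w (S f - T f)"
      by (simp add: has_symbol_commute[OF T(1)] U_diff)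
    have "norm (S (U w f) - U w (S f)) \<le> d * norm f + d * norm f"
      unfolding eq using norm_triangle_ineq4[of "S (U w f) - T (U w f)" "U w (S f - T f)"] T(2)[of f] T(2)[of "U w f"]
      by (simp add: norm_U)
    also have "\<dots> \<le> d * (2 * norm f + 1)"
      using d by (simp add: algebra_simps)
    also have "\<dots> = e"
      using add_nonneg_pos[of "2 * norm f" 1] by (simp add: d_def)
    finally show ?thesis .
  qed
  then have "norm (S (U w f) - U w (S f)) \<le> 0" by (rule field_le_epsilon[where y = 0, simplified])
  then show "S (U w f) = U w (S f)" by simp
next
  obtain T \<phi> where T: "has_symbol T \<phi>" "\<And>s. cmod (\<psi> s - \<phi> s) \<le> 1"
    using lim[of 1] by auto
  then obtain M where M: "\<And>s. cmod (\<phi> s) \<le> M" by (auto simp: has_symbol_def)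
  have "cmod (\<psi> s) \<le> M + 1" for s
    using norm_triangle_ineq[of "\<phi> s" "\<psi> s - \<phi> s"] T(2)[of s] M[of s] by simp
  then show "\<exists>M. \<forall>s. cmod (\<psi> s) \<le> M" by blast
next
  fix \<rho> f g assume \<rho>: "spectral_approx \<rho> f g"
  then have int: "integrable lborel (\<rho> k)" for k by (simp add: spectral_approx_def)
  obtain B where B: "\<And>k. (LINT s|lborel. cmod (\<rho> k s)) \<le> B"
    using \<rho> by (auto simp: spectral_approx_def)
  have B0: "0 \<le> B" using B[of 0] by (rule order_trans[rotated]) (simp add: Bochner_Integration.integral_nonneg)
  show "(\<lambda>k. LINT s|lborel. \<rho> k s * \<psi> s) \<longlonglongrightarrow> cinner_L2 (S f) g"
  proof (rule LIMSEQ_I)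
    fix e :: real assume e: "e > 0"
    \<comment> \<open>The symbol error is at most \<open>d * B\<close> and the operator error at
      most \<open>d * (norm f * norm g)\<close>; together they stay within \<open>e / 2\<close>. The
      summand 1 keeps the denominator positive.\<close>
    define d where "d = e / (2 * (B + norm f * norm g + 1))"
    have den: "0 < B + norm f * norm g + 1" using B0 by (simp add: add_nonneg_pos)
    have d: "d > 0" using e den by (simp add: d_def)
    obtain T \<phi> where T: "has_symbol T \<phi>" "\<And>f. norm (S f - T f) \<le> d * norm f" "\<And>s. cmod (\<psi> s - \<phi> s) \<le> d"
      using lim[OF d] by blast
    have [measurable]: "\<phi> \<in> borel_measurable borel" using T(1) by (simp add: has_symbol_def)
    obtain M where M: "\<And>s. cmod (\<phi> s) \<le> M" using T(1) by (auto simp: has_symbol_def)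
    have i1: "integrable lborel (\<lambda>s. \<rho> k s * \<phi> s)" for k
      by (rule integrable_mult_bounded(1)[OF int _ M]) simp
    have i2: "integrable lborel (\<lambda>s. \<rho> k s * (\<psi> s - \<phi> s))" for k
      by (rule integrable_mult_bounded(1)[OF int _ T(3)]) simp
    have limT: "(\<lambda>k. LINT s|lborel. \<rho> k s * \<phi> s) \<longlonglongrightarrow> cinner_L2 (T f) g"
      using T(1) \<rho> by (rule has_symbol_lim)
    obtain n where n: "\<And>k. k \<ge> n \<Longrightarrow> cmod ((LINT s|lborel. \<rho> k s * \<phi> s) - cinner_L2 (T f) g) < e / 2"
      using LIMSEQ_D[OF limT, of "e / 2"] e by auto
    have "cmod ((LINT s|lborel. \<rho> k s * \<psi> s) - cinner_L2 (S f) g) < e" if "k \<ge> n" for k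
    proof -
      have "(LINT s|lborel. \<rho> k s * \<psi> s) = (LINT s|lborel. \<rho> k s * \<phi> s + \<rho> k s * (\<psi> s - \<phi> s))"
        by (simp add: algebra_simps)
      also have "\<dots> = (LINT s|lborel. \<rho> k s * \<phi> s) + (LINT s|lborel. \<rho> k s * (\<psi> s - \<phi> s))"
        using i1 i2 by (rule Bochner_Integration.integral_add)
      finally have eq: "(LINT s|lborel. \<rho> k s * \<psi> s) - cinner_L2 (S f) g
        = ((LINT s|lborel. \<rho> k s * \<phi> s) - cinner_L2 (T f) g) + ((LINT s|lborel. \<rho> k s * (\<psi> s - \<phi> s)) - cinner_L2 (S f - T f) g)"
        by (simp add: cinner_diff_left)
      have "cmod ((LINT s|lborel. \<rho> k s * \<psi> s) - cinner_L2 (S f) g)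
        \<le> cmod ((LINT s|lborel. \<rho> k s * \<phi> s) - cinner_L2 (T f) g) + (cmod (LINT s|lborel. \<rho> k s * (\<psi> s - \<phi> s)) + cmod (cinner_L2 (S f - T f) g))"
        unfolding eq by (rule order_trans[OF norm_triangle_ineq add_left_mono[OF norm_triangle_ineq4]])
      also have "cmod (LINT s|lborel. \<rho> k s * (\<psi> s - \<phi> s)) \<le> d * B"
      proof -
        have "cmod (LINT s|lborel. \<rho> k s * (\<psi> s - \<phi> s)) \<le> (LINT s|lborel. cmod (\<rho> k s * (\<psi> s - \<phi> s)))"
          by (rule integral_norm_bound)
        also have "\<dots> \<le> d * (LINT s|lborel. cmod (\<rho> k s))"
          by (rule integrable_mult_bounded(2)[OF int _ T(3)]) simp
        also have "\<dots> \<le> d * B" using B d by (intro mult_left_mono) auto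
        finally show ?thesis .
      qed
      also have "cmod (cinner_L2 (S f - T f) g) \<le> d * (norm f * norm g)"
        using cinner_Cauchy_Schwarz[of "S f - T f" g] mult_right_mono[OF T(2)[of f] norm_ge_zero[of g]]
        by (simp add: mult.assoc)
      also have "d * B + d * (norm f * norm g) \<le> d * (B + norm f * norm g + 1)"
        using d by (simp add: algebra_simps)
      also have "\<dots> = e / 2"
      proof -
        have "e / (2 * q) * q = e / 2" if "q > 0" for q :: real using that by simp
        from this[OF den] show ?thesis by (simp only: d_def)
      qed
      finally show ?thesis using n[OF that] by simp
    qed
    then show "\<exists>no. \<forall>k\<ge>no. cmod ((LINT s|lborel. \<rho> k s * \<psi> s) - cinner_L2 (S f) g) < e"
      by blast
  qed
qed simp

lemma has_symbol_polynomial: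
  assumes B: "has_symbol B (\<lambda>s. of_real (\<phi> s))" and p: "real_polynomial_function p"
  shows "\<exists>S. has_symbol S (\<lambda>s. of_real (p (\<phi> s)))"
  using p
proof (induction rule: real_polynomial_function.induct)
  case (linear p)
  have "p x = p 1 * x" for x
    using linear_cmul[OF bounded_linear.linear[OF linear], of x 1] by (simp add: mult.commute)
  then have "(\<lambda>s. complex_of_real (p (\<phi> s))) = (\<lambda>s. of_real (p 1) * of_real (\<phi> s))"
    by (metis of_real_mult)
  then show ?case using has_symbol_scale[OF B, of "of_real (p 1)"] by auto
next
  case (const c)
  show ?case using has_symbol_scale[OF has_symbol_id, of "of_real c"] by auto
next
  case (add p q)
  then show ?case using has_symbol_add by fastforce
next
  case (mult p q)
  then show ?case using has_symbol_comp by fastforce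
qed

text \<open>The range of the symbol plays the part of the spectrum. The norm bound for differences
  makes the operators of the approximating polynomials Cauchy with a rate independent of
  \<open>f\<close> up to \<open>norm f\<close>, so their limit is again bounded and inherits the
  limiting symbol.\<close>

theorem ex_functional_calculus:
  fixes h :: "real \<Rightarrow> complex"
  assumes B: "has_symbol B (\<lambda>s. of_real (\<phi> s))" and \<phi>: "\<And>s. \<phi> s \<in> {0..M}"
    and h: "continuous_on {0..M} h"
  shows "\<exists>S. has_symbol S (\<lambda>s. h (\<phi> s))"
proof -
  have [measurable]: "\<phi> \<in> borel_measurable borel"
  proof -
    have "(\<lambda>s. complex_of_real (\<phi> s)) \<in> borel_measurable borel" using B by (simp add: has_symbol_def)
    then have "(\<lambda>s. Re (complex_of_real (\<phi> s))) \<in> borel_measurable borel" by measurable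
    then show ?thesis by simp
  qed
  define e where "e n = inverse (real (Suc n))" for n
  have e: "e n > 0" for n by (simp add: e_def)
  have e0: "e \<longlonglongrightarrow> 0" unfolding e_def by (rule LIMSEQ_inverse_real_of_nat)
  have "\<exists>g. polynomial_function g \<and> (\<forall>x\<in>{0..M}. norm (h x - g x) < e n)" for n
    using Stone_Weierstrass_polynomial_function[OF compact_Icc h e[of n]] by blast
  then obtain g where g: "\<And>n. polynomial_function (g n)" "\<And>n x. x \<in> {0..M} \<Longrightarrow> norm (h x - g n x) < e n"
    by metis
  have "\<exists>S. has_symbol S (\<lambda>s. g n (\<phi> s))" for n
  proof -
    have "real_polynomial_function (Re \<circ> g n)" "real_polynomial_function (Im \<circ> g n)"
      using g(1)[of n] bounded_linear_Re bounded_linear_Im by (auto simp: polynomial_function_def)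
    then obtain S T where "has_symbol S (\<lambda>s. of_real ((Re \<circ> g n) (\<phi> s)))" "has_symbol T (\<lambda>s. of_real ((Im \<circ> g n) (\<phi> s)))"
      using has_symbol_polynomial[OF B] by blast
    from has_symbol_add[OF this(1) has_symbol_scale[OF this(2), of \<i>]]
    show ?thesis by (auto simp: complex_eq[symmetric])
  qed
  then obtain S where S: "\<And>n. has_symbol (S n) (\<lambda>s. g n (\<phi> s))" by metis
  have bop: "bounded_operator (S n)" for n using S[of n] by (simp add: has_symbol_def)
  have diff: "norm (S n f - S m f) \<le> 2 * (e n + e m) * norm f" for n m f
  proof (rule has_symbol_norm_le[OF has_symbol_diff[OF S S]])
    fix s
    have eq: "g n (\<phi> s) - g m (\<phi> s) = (h (\<phi> s) - g m (\<phi> s)) - (h (\<phi> s) - g n (\<phi> s))" by simp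
    show "cmod (g n (\<phi> s) - g m (\<phi> s)) \<le> e n + e m"
      unfolding eq using norm_triangle_ineq4[of "h (\<phi> s) - g m (\<phi> s)" "h (\<phi> s) - g n (\<phi> s)"] g(2)[OF \<phi>[of s], of n] g(2)[OF \<phi>[of s], of m]
      by linarith
  qed
  have "convergent (\<lambda>n. S n f)" for f
  proof (rule Cauchy_convergent, rule CauchyI)
    fix d :: real assume d: "d > 0"
    have "(\<lambda>n. 4 * e n * norm f) \<longlonglongrightarrow> 4 * 0 * norm f" by (intro tendsto_intros e0)
    then have "\<forall>\<^sub>F n in sequentially. 4 * e n * norm f < d" using d by (intro order_tendstoD(2)) auto
    then obtain N where N: "4 * e N * norm f < d" by (auto simp: eventually_sequentially)
    have "norm (S n f - S m f) < d" if "n \<ge> N" "m \<ge> N" for n m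
    proof -
      have "e n \<le> e N" "e m \<le> e N" using that by (auto simp: e_def intro!: le_imp_inverse_le)
      then have "2 * (e n + e m) * norm f \<le> 4 * e N * norm f" by (intro mult_right_mono) auto
      then show ?thesis using diff[of n f m] N by linarith
    qed
    then show "\<exists>N. \<forall>m\<ge>N. \<forall>n\<ge>N. norm (S m f - S n f) < d" by blast
  qed
  then obtain L where L: "\<And>f. (\<lambda>n. S n f) \<longlonglongrightarrow> L f" unfolding convergent_def by metis
  have near: "norm (L f - S n f) \<le> 2 * e n * norm f" for n f
  proof (rule LIMSEQ_le)
    show "(\<lambda>m. norm (S m f - S n f)) \<longlonglongrightarrow> norm (L f - S n f)" by (intro tendsto_intros L)
    show "(\<lambda>m. 2 * (e m + e n) * norm f) \<longlonglongrightarrow> 2 * e n * norm f"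
      using tendsto_mult_right[OF tendsto_mult_left[OF tendsto_add[OF e0 tendsto_const[of "e n"]], of 2], of "norm f"] by simp
  qed (use diff in auto)
  have "bounded_operator L"
  proof -
    obtain K where K: "\<And>f. norm (S 0 f) \<le> K * norm f" using bop by (metis bounded_operator_bound)
    show ?thesis
    proof (rule bounded_operatorI[where K = "K + 2 * e 0"])
      show "L (f + g) = L f + L g" for f g
        by (rule LIMSEQ_unique[OF L]) (simp add: bounded_operator_add[OF bop] tendsto_add[OF L L])
      show "L (c *\<^sub>C f) = c *\<^sub>C L f" for c f
        by (rule LIMSEQ_unique[OF L]) (simp add: bounded_operator_scaleC[OF bop] bounded_linear.tendsto[OF bounded_linear_scaleC L])
      show "norm (L f) \<le> (K + 2 * e 0) * norm f" for f
        using norm_triangle_ineq[of "S 0 f" "L f - S 0 f"] K[of f] near[of f 0] by (simp add: distrib_right)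
    qed
  qed
  moreover have "(\<lambda>s. h (\<phi> s)) \<in> borel_measurable borel"
  proof (rule measurable_compose[of \<phi> borel "restrict_space borel {0..M}"])
    show "\<phi> \<in> borel \<rightarrow>\<^sub>M restrict_space borel {0..M}"
      using \<phi> by (auto intro!: measurable_restrict_space2)
    show "h \<in> restrict_space borel {0..M} \<rightarrow>\<^sub>M borel"
      by (rule borel_measurable_continuous_on_restrict[OF h])
  qed
  ultimately have "has_symbol L (\<lambda>s. h (\<phi> s))"
  proof (rule has_symbol_limit)
    fix d :: real assume d: "d > 0"
    have "(\<lambda>n. 2 * e n) \<longlonglongrightarrow> 2 * 0" by (intro tendsto_intros e0)
    then have "\<forall>\<^sub>F n in sequentially. 2 * e n < d" using d by (intro order_tendstoD(2)) auto
    then obtain n where n: "2 * e n < d" by (auto simp: eventually_sequentially)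
    show "\<exists>T \<psi>. has_symbol T \<psi> \<and> (\<forall>f. norm (L f - T f) \<le> d * norm f) \<and> (\<forall>s. cmod (h (\<phi> s) - \<psi> s) \<le> d)"
    proof (intro exI conjI allI)
      show "has_symbol (S n) (\<lambda>s. g n (\<phi> s))" by (rule S)
      show "norm (L f - S n f) \<le> d * norm f" for f
        using near[of f n] mult_right_mono[of "2 * e n" d "norm f"] n by simp
      show "cmod (h (\<phi> s) - g n (\<phi> s)) \<le> d" for s
        using g(2)[OF \<phi>[of s], of n] n e[of n] by simp
    qed
  qed
  then show ?thesis by blast
qed

end

section \<open>The Beta integral on the half-line\<close>

text \<open>
  Complex powers of positive numbers, set to 0 on the other numbers so that integrals over
  the half-line need no indicator.
\<close>

definition cpow :: "complex \<Rightarrow> real \<Rightarrow> complex" where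
  "cpow z t = (if t > 0 then exp (z * of_real (ln t)) else 0)"

lemma measurable_cpow[measurable]: "cpow z \<in> borel \<rightarrow>\<^sub>M borel"
  unfolding cpow_def by measurable

lemma cpow_eq_powr: "t > 0 \<Longrightarrow> cpow z t = of_real t powr z"
  by (simp add: cpow_def powr_def Ln_of_real)

lemma cpow_mult: "x > 0 \<Longrightarrow> t > 0 \<Longrightarrow> cpow z (x * t) = cpow z x * cpow z t"
  by (simp add: cpow_def ln_mult distrib_left exp_add)

lemma cpow_add: "cpow (z + w) t = cpow z t * cpow w t"
  by (simp add: cpow_def distrib_right exp_add)

lemma cpow_1: "t > 0 \<Longrightarrow> cpow 1 t = of_real t"
  by (simp add: cpow_def exp_of_real)

lemma cpow_minus: "t > 0 \<Longrightarrow> cpow (- z) t = inverse (cpow z t)"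
  by (simp add: cpow_def exp_minus)

lemma cpow_of_nat: "t > 0 \<Longrightarrow> cpow (of_nat m) t = of_real (t ^ m)"
  by (simp add: cpow_eq_powr powr_nat)

lemma cpow_nonzero: "t > 0 \<Longrightarrow> cpow z t \<noteq> 0"
  by (simp add: cpow_def)

text \<open>Reduces absolute convergence for a complex exponent to the same integral at its real
  part, as in the step \<open>H_abs\<close> below.\<close>

lemma cpow_Re: "cpow (of_real (Re z)) t = of_real (cmod (cpow z t))"
  by (simp add: cpow_def exp_of_real flip: of_real_mult)

lemma Gamma_nonzero: "Re z > 0 \<Longrightarrow> Gamma z \<noteq> 0"
  by (auto simp: Gamma_eq_zero_iff elim!: nonpos_Ints_cases)

text \<open>Carries the gauge integral for Gamma over to the Lebesgue integral, for which Fubini's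
  theorem and substitutions are available.\<close>

lemma Gamma_lborel:
  assumes z: "Re z > 0"
  shows "integrable lborel (\<lambda>t. cpow (z - 1) t * of_real (exp (- t)))" (is ?I)
    and "(LINT t|lborel. cpow (z - 1) t * of_real (exp (- t))) = Gamma z"
proof -
  let ?f = "\<lambda>t. complex_of_real t powr (z - 1) / of_real (exp t)"
  have eq: "(\<lambda>t. indicator {0<..} t *\<^sub>R ?f t) = (\<lambda>t. cpow (z - 1) t * of_real (exp (- t)))"
    by (auto simp: fun_eq_iff cpow_eq_powr indicator_def exp_minus divide_inverse) (simp add: cpow_def)
  have m: "(\<lambda>t. cpow (z - 1) t * of_real (exp (- t))) \<in> borel_measurable lborel" by measurable
  have ai: "set_integrable lebesgue {0<..} ?f"
    using absolutely_integrable_Gamma_integral'[OF z] by simp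
  then have "integrable lebesgue (\<lambda>t. cpow (z - 1) t * of_real (exp (- t)))"
    unfolding set_integrable_def eq .
  then show ?I using m by (simp add: integrable_completion)
  have "(?f has_integral (LINT t:{0<..}|lebesgue. ?f t)) {0<..}"
    by (rule has_integral_set_lebesgue[OF ai])
  then have "(LINT t:{0<..}|lebesgue. ?f t) = Gamma z"
    using Gamma_integral_complex'[OF z] by (rule has_integral_unique)
  then show "(LINT t|lborel. cpow (z - 1) t * of_real (exp (- t))) = Gamma z"
    unfolding set_lebesgue_integral_def eq using integral_completion[OF m] by simp
qed

lemma Gamma_lborel_scaled:
  assumes z: "Re z > 0" and x: "x > 0"
  shows "integrable lborel (\<lambda>t. cpow (z - 1) t * of_real (exp (- (x * t))))" (is ?I)
    and "(LINT t|lborel. cpow (z - 1) t * of_real (exp (- (x * t)))) = Gamma z * cpow (- z) x" (is ?E)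
proof -
  let ?f = "\<lambda>t. cpow (z - 1) t * complex_of_real (exp (- t))"
  have f: "?f (0 + x * t) = cpow (z - 1) x * (cpow (z - 1) t * of_real (exp (- (x * t))))" for t
    using x cpow_mult[of x t "z - 1"] by (cases "t > 0") (auto simp: cpow_def zero_less_mult_iff)
  have nz: "cpow (z - 1) x \<noteq> 0" using x by (rule cpow_nonzero)
  have "integrable lborel (\<lambda>t. ?f (0 + x * t))"
    using Gamma_lborel(1)[OF z] x by (subst lborel_integrable_real_affine_iff) auto
  then have "integrable lborel (\<lambda>t. inverse (cpow (z - 1) x) * ?f (0 + x * t))"
    by (rule integrable_mult_right)
  then show ?I unfolding f using nz by (simp add: mult.assoc[symmetric])
  have "Gamma z = x *\<^sub>R (LINT t|lborel. ?f (0 + x * t))"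
    using lborel_integral_real_affine[of x ?f 0] x Gamma_lborel(2)[OF z] by simp
  also have "\<dots> = of_real x * cpow (z - 1) x * (LINT t|lborel. cpow (z - 1) t * of_real (exp (- (x * t))))"
    unfolding f by (simp add: scaleR_conv_of_real mult.assoc)
  also have "of_real x * cpow (z - 1) x = cpow z x"
    using cpow_add[of 1 "z - 1" x] cpow_1[OF x] by simp
  finally show ?E using cpow_nonzero[OF x, of z] by (simp add: cpow_minus[OF x])
qed

text \<open>
  The Beta integral on the half-line, from the two iterated integrals of
  \<open>t powr (\<alpha> - 1) * x powr (m - 1) * exp (- x * (1 + t))\<close>.
\<close>

lemma Beta_half_line:
  fixes m :: nat
  assumes \<alpha>: "0 < Re \<alpha>" "Re \<alpha> < real m"
  shows "integrable lborel (\<lambda>t. cpow (\<alpha> - 1) t * of_real ((1 / (t + 1)) ^ m))"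
    and "(LINT t|lborel. cpow (\<alpha> - 1) t * of_real ((1 / (t + 1)) ^ m)) = Gamma \<alpha> * Gamma (of_nat m - \<alpha>) / Gamma (of_nat m)"
proof -
  have m: "m > 0" using \<alpha> by (cases m) auto
  define H where "H \<alpha> x t = cpow (of_nat m - 1) x * of_real (exp (- x)) * (cpow (\<alpha> - 1) t * of_real (exp (- (x * t))))" for \<alpha> x t
  have H_meas[measurable]: "case_prod (H \<alpha>) \<in> borel_measurable (lborel \<Otimes>\<^sub>M lborel)" for \<alpha>
    unfolding H_def by measurable
  have Ht: "integrable lborel (H \<alpha> x)"
    "(LINT t|lborel. H \<alpha> x t) = Gamma \<alpha> * (cpow (of_nat m - \<alpha> - 1) x * of_real (exp (- x)))"
    if "Re \<alpha> > 0" for \<alpha> x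
  proof -
    have "integrable lborel (H \<alpha> x) \<and>
      (LINT t|lborel. H \<alpha> x t) = Gamma \<alpha> * (cpow (of_nat m - \<alpha> - 1) x * of_real (exp (- x)))"
    proof (cases "x > 0")
      case True
      have eq: "cpow (of_nat m - \<alpha> - 1) x = cpow (of_nat m - 1) x * cpow (- \<alpha>) x"
        using cpow_add[of "of_nat m - 1" "- \<alpha>" x] by (simp add: algebra_simps)
      have "integrable lborel (H \<alpha> x)"
        unfolding H_def by (intro integrable_mult_right Gamma_lborel_scaled(1)[OF that True])
      moreover have "(LINT t|lborel. H \<alpha> x t) = cpow (of_nat m - 1) x * of_real (exp (- x)) * (Gamma \<alpha> * cpow (- \<alpha>) x)"
        unfolding H_def by (simp only: integral_mult_right_zero Gamma_lborel_scaled(2)[OF that True])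
      ultimately show ?thesis by (simp add: eq mult_ac)
    next
      case False
      then show ?thesis by (simp add: H_def[abs_def] cpow_def)
    qed
    then show "integrable lborel (H \<alpha> x)"
      "(LINT t|lborel. H \<alpha> x t) = Gamma \<alpha> * (cpow (of_nat m - \<alpha> - 1) x * of_real (exp (- x)))" by auto
  qed
  have Hx: "(LINT x|lborel. H \<alpha> x t) = Gamma (of_nat m) * (cpow (\<alpha> - 1) t * of_real ((1 / (t + 1)) ^ m))" for t
  proof (cases "t > 0")
    case True
    then have t1: "1 + t > 0" by simp
    have eq: "H \<alpha> x t = cpow (\<alpha> - 1) t * (cpow (of_nat m - 1) x * of_real (exp (- ((1 + t) * x))))" for x
      by (simp add: H_def algebra_simps exp_add[symmetric] flip: of_real_mult)
    have "(LINT x|lborel. H \<alpha> x t) = cpow (\<alpha> - 1) t * (Gamma (of_nat m) * cpow (- of_nat m) (1 + t))"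
      unfolding eq using Gamma_lborel_scaled(2)[of "of_nat m" "1 + t"] m t1 by simp
    also have "cpow (- of_nat m) (1 + t) = of_real ((1 / (t + 1)) ^ m)"
      using t1 by (simp add: cpow_minus cpow_of_nat power_one_over inverse_eq_divide add.commute)
    finally show ?thesis by (simp add: mult_ac)
  next
    case False
    then show ?thesis by (simp add: H_def cpow_def)
  qed
  have H_abs: "of_real (cmod (H \<alpha> x t)) = H (of_real (Re \<alpha>)) x t" for x t
  proof -
    have "cpow (of_real (Re \<alpha>) - 1) t = of_real (cmod (cpow (\<alpha> - 1) t))"
      using cpow_Re[of "\<alpha> - 1" t] by simp
    moreover have "cpow (of_nat m - 1) x = of_real (cmod (cpow (of_nat m - 1) x))"
      using cpow_Re[of "of_nat m - 1" x] by simp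
    ultimately show ?thesis by (simp add: H_def norm_mult)
  qed
  \<comment> \<open>By \<open>H_abs\<close> the modulus integrates in \<open>t\<close> to a multiple
    of the Gamma integrand with parameter \<open>m - Re \<alpha>\<close>, which is integrable
    because \<open>Re \<alpha> < m\<close>.\<close>
  have int: "integrable (lborel \<Otimes>\<^sub>M lborel) (case_prod (H \<alpha>))"
  proof (rule lborel_pair.Fubini_integrable)
    have "(LINT t|lborel. cmod (H \<alpha> x t)) = Re (Gamma (of_real (Re \<alpha>)) * (cpow (of_nat m - of_real (Re \<alpha>) - 1) x * of_real (exp (- x))))" for x
    proof -
      have "complex_of_real (LINT t|lborel. cmod (H \<alpha> x t)) = (LINT t|lborel. H (of_real (Re \<alpha>)) x t)"
        by (simp flip: H_abs)
      also have "\<dots> = Gamma (of_real (Re \<alpha>)) * (cpow (of_nat m - of_real (Re \<alpha>) - 1) x * of_real (exp (- x)))"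
        using \<alpha> by (intro Ht(2)) simp
      finally show ?thesis by (metis Re_complex_of_real)
    qed
    moreover have "integrable lborel (\<lambda>x. Re (Gamma (of_real (Re \<alpha>)) * (cpow (of_nat m - of_real (Re \<alpha>) - 1) x * of_real (exp (- x)))))"
      using \<alpha> by (intro integrable_Re integrable_mult_right Gamma_lborel(1)) simp
    ultimately show "integrable lborel (\<lambda>x. LINT t|lborel. cmod (case (x, t) of (x, t) \<Rightarrow> H \<alpha> x t))" by simp
    show "AE x in lborel. integrable lborel (\<lambda>t. case (x, t) of (x, t) \<Rightarrow> H \<alpha> x t)"
      using Ht(1)[OF \<alpha>(1)] by simp
  qed measurable
  have Gm: "Gamma (of_nat m) \<noteq> (0 :: complex)"
    using m by (intro Gamma_nonzero) simp
  have "integrable lborel (\<lambda>t. LINT x|lborel. H \<alpha> x t)"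
    using lborel_pair.integrable_snd[OF int] .
  then have "integrable lborel (\<lambda>t. inverse (Gamma (of_nat m)) * (Gamma (of_nat m) * (cpow (\<alpha> - 1) t * of_real ((1 / (t + 1)) ^ m))))"
    unfolding Hx by (rule integrable_mult_right)
  then show "integrable lborel (\<lambda>t. cpow (\<alpha> - 1) t * of_real ((1 / (t + 1)) ^ m))"
    using Gm by (simp add: mult.assoc[symmetric])
  have "Gamma (of_nat m) * (LINT t|lborel. cpow (\<alpha> - 1) t * of_real ((1 / (t + 1)) ^ m)) = (LINT t|lborel. LINT x|lborel. H \<alpha> x t)"
    unfolding Hx by simp
  also have "\<dots> = (LINT x|lborel. LINT t|lborel. H \<alpha> x t)"
    by (rule lborel_pair.Fubini_integral[OF int])
  also have "\<dots> = Gamma \<alpha> * (LINT x|lborel. cpow (of_nat m - \<alpha> - 1) x * of_real (exp (- x)))"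
    by (simp add: Ht(2)[OF \<alpha>(1)])
  also have "\<dots> = Gamma \<alpha> * Gamma (of_nat m - \<alpha>)"
    using \<alpha> by (subst Gamma_lborel(2)) auto
  finally show "(LINT t|lborel. cpow (\<alpha> - 1) t * of_real ((1 / (t + 1)) ^ m)) = Gamma \<alpha> * Gamma (of_nat m - \<alpha>) / Gamma (of_nat m)"
    using Gm by (simp add: field_simps)
qed

text \<open>Replacing \<open>t\<close> by \<open>l * t\<close> extracts the power of
  \<open>l\<close> from the Beta integral. At \<open>l = 0\<close> both sides vanish: the integrand
  because \<open>m > 0\<close>, and \<open>0 powr \<alpha>\<close> by the value of
  \<open>powr\<close> at 0.\<close>

lemma fractional_power_integral:
  fixes m :: nat
  assumes \<alpha>: "0 < Re \<alpha>" "Re \<alpha> < real m" and l: "l \<ge> 0"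
  shows "integrable lborel (\<lambda>t. cpow (\<alpha> - 1) t * of_real ((l / (t + l)) ^ m))" (is ?I)
    and "(LINT t|lborel. cpow (\<alpha> - 1) t * of_real ((l / (t + l)) ^ m))
      = Gamma \<alpha> * Gamma (of_nat m - \<alpha>) / Gamma (of_nat m) * of_real l powr \<alpha>" (is ?E)
proof -
  have m: "m > 0" using \<alpha> by (cases m) auto
  have "?I \<and> ?E"
  proof (cases "l = 0")
    case True
    then show ?thesis using m by (simp add: power_0_left)
  next
    case False
    then have l0: "l > 0" using l by simp
    let ?f = "\<lambda>t. cpow (\<alpha> - 1) t * complex_of_real ((l / (t + l)) ^ m)"
    have f: "?f (0 + l * t) = cpow (\<alpha> - 1) l * (cpow (\<alpha> - 1) t * of_real ((1 / (t + 1)) ^ m))" for t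
    proof (cases "t > 0")
      case True
      have "l / (l * t + l) = 1 / (t + 1)"
      proof -
        have "l * t + l = l * (t + 1)" by (simp add: algebra_simps)
        then show ?thesis using l0 True by simp
      qed
      then show ?thesis using cpow_mult[OF l0 True] by simp
    next
      case False
      then show ?thesis using l0 by (auto simp: cpow_def zero_less_mult_iff)
    qed
    have "integrable lborel (\<lambda>t. ?f (0 + l * t))"
      unfolding f by (intro integrable_mult_right Beta_half_line \<alpha>)
    then have I: ?I using l0 by (subst (asm) lborel_integrable_real_affine_iff) auto
    have "(LINT t|lborel. ?f t) = l *\<^sub>R (LINT t|lborel. ?f (0 + l * t))"
      using lborel_integral_real_affine[of l ?f 0] l0 by simp
    also have "\<dots> = of_real l * cpow (\<alpha> - 1) l * (Gamma \<alpha> * Gamma (of_nat m - \<alpha>) / Gamma (of_nat m))"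
      unfolding f integral_mult_right_zero Beta_half_line(2)[OF \<alpha>]
      by (simp add: scaleR_conv_of_real)
    also have "of_real l * cpow (\<alpha> - 1) l = of_real l powr \<alpha>"
      using cpow_add[of 1 "\<alpha> - 1" l] cpow_1[OF l0] cpow_eq_powr[OF l0, of \<alpha>] by simp
    finally show ?thesis using I by (simp add: mult_ac)
  qed
  then show ?I ?E by auto
qed

section \<open>Fractional powers\<close>

context dilation_group
begin

text \<open>The norm bound with \<open>c = 0\<close>. It converts pointwise identities between
  symbols into identities between operators.\<close>

lemma has_symbol_unique:
  assumes "has_symbol S \<psi>" "has_symbol T \<psi>" shows "S = T"
proof
  fix f
  have "norm (S f - T f) \<le> 2 * 0 * norm f"
    by (rule has_symbol_norm_le[OF has_symbol_diff[OF assms]]) simp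
  then show "S f = T f" by simp
qed

lemma has_symbol_scaleR:
  "has_symbol S \<psi> \<Longrightarrow> has_symbol (\<lambda>f. r *\<^sub>R S f) (\<lambda>s. of_real r * \<psi> s)"
  unfolding scaleR_scaleC by (rule has_symbol_scale)

text \<open>As \<open>resolvent\<close> is defined through \<open>inv\<close>, a two-sided inverse
  has to be exhibited. The function \<open>1 / (t + l)\<close> is continuous on the range of the
  symbol because \<open>t > 0\<close>, and the operator it yields inverts \<open>L\<close>, since
  both products have symbol 1.\<close>

lemma has_symbol_resolvent:
  assumes B: "has_symbol B (\<lambda>s. of_real (\<phi> s))" and \<phi>: "\<And>s. \<phi> s \<in> {0..M}" and t: "t > 0"
  shows "has_symbol (resolvent B t) (\<lambda>s. of_real (1 / (t + \<phi> s)))"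
proof -
  have "continuous_on {0..M} (\<lambda>l. complex_of_real (1 / (t + l)))"
    using t by (intro continuous_intros) auto
  from ex_functional_calculus[OF B \<phi> this]
  obtain S where S: "has_symbol S (\<lambda>s. of_real (1 / (t + \<phi> s)))" by blast
  define L where "L f = t *\<^sub>R f + B f" for f
  have L: "has_symbol L (\<lambda>s. of_real (t + \<phi> s))"
    unfolding L_def using has_symbol_add[OF has_symbol_scaleR[OF has_symbol_id, of t] B] by simp
  have one: "complex_of_real (t + \<phi> s) * of_real (1 / (t + \<phi> s)) = 1"
    "complex_of_real (1 / (t + \<phi> s)) * of_real (t + \<phi> s) = 1" for s
  proof -
    have "t + \<phi> s \<noteq> 0" using t \<phi>[of s] by simp
    then have "(t + \<phi> s) * (1 / (t + \<phi> s)) = 1" "(1 / (t + \<phi> s)) * (t + \<phi> s) = 1" by simp_all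
    then show "complex_of_real (t + \<phi> s) * of_real (1 / (t + \<phi> s)) = 1"
      "complex_of_real (1 / (t + \<phi> s)) * of_real (t + \<phi> s) = 1"
      unfolding of_real_mult[symmetric] by simp_all
  qed
  have "(\<lambda>f. L (S f)) = (\<lambda>f. f)"
    using has_symbol_comp[OF L S] unfolding one by (rule has_symbol_unique[OF _ has_symbol_id])
  moreover have "(\<lambda>f. S (L f)) = (\<lambda>f. f)"
    using has_symbol_comp[OF S L] unfolding one by (rule has_symbol_unique[OF _ has_symbol_id])
  ultimately have "L (S f) = f" "S (L f) = f" for f
    by (simp_all add: fun_eq_iff)
  then have "inv L = S" by (intro inv_equality)
  then show ?thesis using S unfolding resolvent_def L_def[abs_def] by simp
qed

lemma has_symbol_funpow:
  assumes "has_symbol S \<psi>" shows "has_symbol (S ^^ m) (\<lambda>s. \<psi> s ^ m)"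
proof (induction m)
  case 0
  then show ?case using has_symbol_id by (simp add: id_def)
next
  case (Suc m)
  show ?case using has_symbol_comp[OF assms Suc] by (simp add: o_def)
qed

text \<open>
  Functional calculus turns the primitives \<open>\<integral>\<^sub>0\<^sup>x t powr (\<alpha> - 1) * (l / (t + l)) ^ m dt\<close> of the
  scalar integrand into a primitive of the operator valued one, and uniform convergence in
  \<open>l\<close> into norm convergence. The integrands are dominated by the one at \<open>l = M\<close>.
\<close>

theorem has_symbol_fractional_power:
  assumes B: "has_symbol B (\<lambda>s. of_real (\<phi> s))" and \<phi>: "\<And>s. \<phi> s \<in> {0..M}"
    and \<alpha>: "Re \<alpha> > 0" and P: "has_symbol P (\<lambda>s. of_real (\<phi> s) powr \<alpha>)"
  shows "is_fractional_power B \<alpha> P"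
  unfolding is_fractional_power_def
proof (intro conjI allI impI)
  show "nonneg_operator B"
    by (rule has_symbol_nonneg[OF B]) (use \<phi> in auto)
  fix m :: nat and f assume m: "0 < m" "Re \<alpha> < real m"
  have M: "M \<ge> 0" using \<phi>[of 0] by simp
  define k where "k l t = cpow (\<alpha> - 1) t * of_real ((l / (t + l)) ^ m)" for l t
  define D where "D t = cmod (k M t)" for t
  have k_meas[measurable]: "k l \<in> borel_measurable borel" for l
    unfolding k_def by measurable
  have k_int: "integrable lborel (k l)" if "l \<ge> 0" for l
    unfolding k_def by (rule fractional_power_integral(1)[OF \<alpha> m(2) that])
  have D_int: "integrable lborel D"
    unfolding D_def by (intro integrable_norm k_int M)
  have D_nonneg: "D t \<ge> 0" for t by (simp add: D_def)
  have k_le: "cmod (k l t) \<le> D t" if l: "l \<in> {0..M}" for l t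
  proof (cases "t > 0")
    case True
    have "l / (t + l) \<le> M / (t + M)"
      using l True by (auto simp: divide_simps algebra_simps)
    then have "(l / (t + l)) ^ m \<le> (M / (t + M)) ^ m"
      using l True by (intro power_mono) auto
    moreover have "0 \<le> l / (t + l)" "0 \<le> M / (t + M)" using l True by auto
    ultimately show ?thesis
      by (simp only: k_def D_def norm_mult norm_of_real abs_of_nonneg zero_le_power mult_left_mono norm_ge_zero)
  next
    case False
    then show ?thesis by (simp add: k_def D_def cpow_def)
  qed
  define g where "g x l = (LINT t|lborel. indicator {..<x} t *\<^sub>R k l t)" for x l
  define E where "E x y = (LINT t|lborel. indicator {x..<y} t *\<^sub>R D t)" for x y
  have g_int: "integrable lborel (\<lambda>t. indicator A t *\<^sub>R k l t)" if "l \<ge> 0" "A \<in> sets borel" for A l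
    using k_int[OF that(1)] that(2) by (intro integrable_mult_indicator) auto
  have g_diff: "g y l - g x l = (LINT t|lborel. indicator {x..<y} t *\<^sub>R k l t)" if "l \<ge> 0" "x \<le> y" for x y l
  proof -
    have "g y l - g x l = (LINT t|lborel. indicator {..<y} t *\<^sub>R k l t - indicator {..<x} t *\<^sub>R k l t)"
      unfolding g_def by (rule Bochner_Integration.integral_diff[symmetric]) (auto intro!: g_int that)
    also have "\<dots> = (LINT t|lborel. indicator {x..<y} t *\<^sub>R k l t)"
      using that by (intro Bochner_Integration.integral_cong) (auto simp: indicator_def)
    finally show ?thesis .
  qed
  have g_diff_le: "cmod (g y l - g x l) \<le> E x y" if "l \<in> {0..M}" "x \<le> y" for x y l
  proof -
    have "cmod (g y l - g x l) \<le> (LINT t|lborel. cmod (indicator {x..<y} t *\<^sub>R k l t))"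
      using that by (subst g_diff) (simp_all only: integral_norm_bound atLeastAtMost_iff)
    also have "\<dots> \<le> E x y"
      unfolding E_def using k_le[OF that(1)] D_nonneg D_int
      by (intro integral_mono' integrable_mult_indicator) (auto simp: indicator_def)
    finally show ?thesis .
  qed
  have g_neg: "g x l = 0" if "x \<le> 0" for x l
  proof -
    have "(\<lambda>t. indicator {..<x} t *\<^sub>R k l t) = (\<lambda>t. 0)"
      using that by (auto simp: fun_eq_iff indicator_def k_def cpow_def)
    then show ?thesis by (simp add: g_def)
  qed
  have g_cont: "continuous_on {0..M} (g x)" for x
  proof (subst continuous_on_sequentially, intro ballI allI impI, elim conjE)
    fix L l assume l: "l \<in> {0..M}" and L: "\<forall>n. L n \<in> {0..M}" "L \<longlonglongrightarrow> l"
    have "(\<lambda>n. g x (L n)) \<longlonglongrightarrow> g x l"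
      unfolding g_def
    proof (rule integral_dominated_convergence[OF _ _ D_int])
      show "AE t in lborel. (\<lambda>n. indicator {..<x} t *\<^sub>R k (L n) t) \<longlonglongrightarrow> indicator {..<x} t *\<^sub>R k l t"
      proof (intro AE_I2 tendsto_scaleR tendsto_const)
        fix t
        show "(\<lambda>n. k (L n) t) \<longlonglongrightarrow> k l t"
        proof (cases "t > 0")
          case True
          then have "t + l \<noteq> 0" using l by simp
          then show ?thesis unfolding k_def by (intro tendsto_intros L(2))
        next
          case False
          then show ?thesis by (simp add: k_def cpow_def)
        qed
      qed
      show "AE t in lborel. norm (indicator {..<x} t *\<^sub>R k (L n) t) \<le> D t" for n
        using k_le L(1) D_nonneg by (intro AE_I2) (auto simp: indicator_def)
    qed measurable
    then show "(g x \<circ> L) \<longlonglongrightarrow> g x l" by (simp add: o_def)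
  qed
  have "\<exists>S. has_symbol S (\<lambda>s. g x (\<phi> s))" for x
    using ex_functional_calculus[OF B \<phi> g_cont] .
  then obtain S where S: "\<And>x. has_symbol (S x) (\<lambda>s. g x (\<phi> s))" by metis
  define V where "V t f = of_real t powr (\<alpha> - 1) *\<^sub>C (((\<lambda>g. B (resolvent B t g)) ^^ m) f)" for t f
  have V: "has_symbol (V t) (\<lambda>s. k (\<phi> s) t)" if t: "t > 0" for t
  proof -
    have "has_symbol (\<lambda>g. B (resolvent B t g)) (\<lambda>s. of_real (\<phi> s / (t + \<phi> s)))"
      using has_symbol_comp[OF B has_symbol_resolvent[OF B \<phi> t]] by simp
    from has_symbol_scale[OF has_symbol_funpow[OF this, of m], of "of_real t powr (\<alpha> - 1)"]
    show ?thesis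
      unfolding V_def[abs_def] k_def using t by (simp add: cpow_eq_powr)
  qed
  define G where "G x = S x f" for x
  define c where "c = Gamma \<alpha> * Gamma (of_nat m - \<alpha>) / Gamma (of_nat m)"
  define H where "H t = (if t \<in> {0<..} then V t f else 0)" for t
  have G_neg: "G x = 0" if "x \<le> 0" for x
  proof -
    have "norm (S x f) \<le> 2 * 0 * norm f"
      by (rule has_symbol_norm_le[OF S]) (simp add: g_neg that)
    then show ?thesis by (simp add: G_def)
  qed
  have G_lip: "norm (G y - G x) \<le> 2 * E x y * norm f" if "x \<le> y" for x y
    unfolding G_def using g_diff_le[OF \<phi> that] by (intro has_symbol_norm_le[OF has_symbol_diff[OF S S]])
  \<comment> \<open>At 0 the integrand can blow up, namely when \<open>Re \<alpha> < 1\<close>. The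
    derivative is taken away from 0; at 0 continuity of \<open>G\<close> will be enough for the
    fundamental theorem of calculus, which admits an exceptional point.\<close>
  have deriv: "(G has_vector_derivative H x) (at x)" if x: "x \<noteq> 0" for x
  proof (cases "x > 0")
    case False
    then have "x < 0" using x by simp
    have "((\<lambda>_. 0 :: (real^'n) L2) has_vector_derivative 0) (at x)" by simp
    then have "(G has_vector_derivative 0) (at x)"
      by (rule has_vector_derivative_transform_within_open[of _ _ _ "{..<0}"]) (use \<open>x < 0\<close> in \<open>auto simp: G_neg\<close>)
    then show ?thesis using \<open>x < 0\<close> by (simp add: H_def)
  next
    case True
    \<comment> \<open>The difference quotient must be controlled uniformly in \<open>l\<close>,
      because the operator norm is bounded by a supremum over the values of the symbol. Joint
      uniform continuity on a compact set away from \<open>t = 0\<close> provides this.\<close>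
    have uc: "uniformly_continuous_on ({0..M} \<times> {x/2..2*x}) (\<lambda>(l, t). k l t)"
    proof (rule compact_uniformly_continuous)
      have "continuous_on ({0..M} \<times> {x/2..2*x}) (\<lambda>p. exp ((\<alpha> - 1) * of_real (ln (snd p))) * of_real ((fst p / (snd p + fst p)) ^ m))"
        using True by (intro continuous_intros) auto
      then show "continuous_on ({0..M} \<times> {x/2..2*x}) (\<lambda>(l, t). k l t)"
        by (rule continuous_on_eq) (use True in \<open>auto simp: k_def cpow_def\<close>)
    qed (intro compact_Times compact_Icc)
    show ?thesis
      unfolding has_vector_derivative_def has_derivative_within_alt2
    proof (intro conjI allI impI bounded_linear_scaleR_left)
      fix e :: real assume e: "e > 0"
      \<comment> \<open>Absorbs the factor 2 of the symbol norm bound and allows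
        \<open>f = 0\<close>.\<close>
      define d where "d = e / (2 * norm f + 1)"
      have d: "d > 0" using e by (simp add: d_def add_nonneg_pos)
      obtain \<delta> where \<delta>: "\<delta> > 0" "\<And>p q. p \<in> {0..M} \<times> {x/2..2*x} \<Longrightarrow> q \<in> {0..M} \<times> {x/2..2*x} \<Longrightarrow>
          dist q p < \<delta> \<Longrightarrow> dist (case q of (l, t) \<Rightarrow> k l t) (case p of (l, t) \<Rightarrow> k l t) < d"
        using uc d unfolding uniformly_continuous_on_def by meson
      define r where "r = min \<delta> (x / 2)"
      have r: "r > 0" using \<delta>(1) True by (simp add: r_def)
      have kd: "cmod (k l t - k l x) \<le> d" if "l \<in> {0..M}" "\<bar>t - x\<bar> < r" for l t
      proof -
        have "t \<in> {x/2..2*x}" "x \<in> {x/2..2*x}" using that(2) True by (auto simp: r_def abs_real_def split: if_splits)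
        moreover have "dist (l, t) (l, x) < \<delta>" using that(2) by (simp add: dist_Pair_Pair dist_real_def r_def)
        ultimately show ?thesis using \<delta>(2)[of "(l, x)" "(l, t)"] that(1) by (auto simp: dist_norm)
      qed
      have gd: "cmod (g z l - g y l - of_real (z - y) * k l x) \<le> (z - y) * d"
        if l: "l \<in> {0..M}" and yz: "y \<le> z" "\<bar>y - x\<bar> < r" "\<bar>z - x\<bar> < r" for l y z
      proof -
        have l0: "l \<ge> 0" using l by simp
        have i1: "integrable lborel (\<lambda>t. indicator {y..<z} t *\<^sub>R k l t)" by (rule g_int[OF l0]) simp
        have i2: "integrable lborel (\<lambda>t. indicator {y..<z} t *\<^sub>R k l x)" using yz by (intro integrable_scaleR_left integrable_real_indicator) auto
        have "of_real (z - y) * k l x = (LINT t|lborel. indicator {y..<z} t *\<^sub>R k l x)"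
          using yz by (simp add: scaleR_conv_of_real)
        then have "g z l - g y l - of_real (z - y) * k l x = (LINT t|lborel. indicator {y..<z} t *\<^sub>R k l t - indicator {y..<z} t *\<^sub>R k l x)"
          using i1 i2 by (simp add: g_diff[OF l0 yz(1)])
        also have "cmod \<dots> \<le> (LINT t|lborel. cmod (indicator {y..<z} t *\<^sub>R k l t - indicator {y..<z} t *\<^sub>R k l x))"
          by (rule integral_norm_bound)
        also have "\<dots> \<le> (LINT t|lborel. indicator {y..<z} t *\<^sub>R d)"
        proof (rule integral_mono')
          show "integrable lborel (\<lambda>t. indicat_real {y..<z} t *\<^sub>R d)"
            using yz by (intro integrable_scaleR_left integrable_real_indicator) auto
          show "cmod (indicator {y..<z} t *\<^sub>R k l t - indicator {y..<z} t *\<^sub>R k l x) \<le> indicat_real {y..<z} t *\<^sub>R d" for t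
            using kd[OF l, of t] yz by (auto simp: indicator_def)
        qed (use d in auto)
        also have "\<dots> = (z - y) * d" using yz by simp
        finally show ?thesis .
      qed
      have Gd: "norm (G z - G y - (z - y) *\<^sub>R V x f) \<le> e * (z - y)" if yz: "y \<le> z" "\<bar>y - x\<bar> < r" "\<bar>z - x\<bar> < r" for y z
      proof -
        have "norm (S z f - S y f - (z - y) *\<^sub>R V x f) \<le> 2 * ((z - y) * d) * norm f"
          using gd[OF \<phi> yz]
          by (intro has_symbol_norm_le[OF has_symbol_diff[OF has_symbol_diff[OF S S] has_symbol_scaleR[OF V[OF True]]]])
        also have "\<dots> \<le> (z - y) * (d * (2 * norm f + 1))"
          using yz d by (simp add: algebra_simps)
        also have "d * (2 * norm f + 1) = e"
          using add_nonneg_pos[of "2 * norm f" 1] by (simp add: d_def)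
        finally show ?thesis by (simp add: G_def mult.commute)
      qed
      have "norm (G y - G x - (y - x) *\<^sub>R H x) \<le> e * norm (y - x)" if y: "\<bar>y - x\<bar> < r" for y
      proof (cases "x \<le> y")
        case True
        then show ?thesis using Gd[of x y] y r \<open>x > 0\<close> by (simp add: H_def)
      next
        case False
        have "norm (G y - G x - (y - x) *\<^sub>R H x) = norm (G x - G y - (x - y) *\<^sub>R V x f)"
          using \<open>x > 0\<close> by (subst norm_minus_commute) (simp add: H_def algebra_simps)
        then show ?thesis using Gd[of y x] y r False by simp
      qed
      then show "\<forall>\<^sub>F y in at x. norm (G y - G x - (y - x) *\<^sub>R H x) \<le> e * norm (y - x)"
        unfolding eventually_at using r by (auto simp: dist_real_def)
    qed
  qed
  have E_lim: "(\<lambda>n. E (X n) (Y n)) \<longlonglongrightarrow> 0"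
    if "\<And>t. t > 0 \<Longrightarrow> \<forall>\<^sub>F n in sequentially. t \<notin> {X n..<Y n}" for X Y
  proof -
    have "(\<lambda>n. LINT t|lborel. indicator {X n..<Y n} t *\<^sub>R D t) \<longlonglongrightarrow> (LINT t|(lborel :: real measure). (0 :: real))"
    proof (rule integral_dominated_convergence[OF _ _ D_int])
      show "AE t in lborel. (\<lambda>n. indicator {X n..<Y n} t *\<^sub>R D t) \<longlonglongrightarrow> 0"
      proof (rule AE_I2)
        fix t
        show "(\<lambda>n. indicator {X n..<Y n} t *\<^sub>R D t) \<longlonglongrightarrow> 0"
        proof (cases "t > 0")
          case True
          show ?thesis
            by (rule tendsto_eventually, rule eventually_mono[OF that[OF True]]) (simp add: indicator_def)
        next
          case False
          then show ?thesis by (simp add: D_def k_def cpow_def)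
        qed
      qed
      have [measurable]: "D \<in> borel_measurable borel" using D_int by auto
      show "(\<lambda>t. indicator {X n..<Y n} t *\<^sub>R D t) \<in> borel_measurable lborel" for n by measurable
    qed (use D_nonneg in \<open>auto simp: indicator_def\<close>)
    then show ?thesis by (simp add: E_def)
  qed
  have G_cont: "continuous_on UNIV G"
  proof (rule continuous_at_imp_continuous_on, intro ballI)
    fix x :: real
    show "isCont G x"
    proof (cases "x = 0")
      case False
      then show ?thesis using deriv[of x] by (auto dest: has_vector_derivative_continuous)
    next
      case True
      have "(\<lambda>n. G (X n)) \<longlonglongrightarrow> G 0" if "X \<longlonglongrightarrow> 0" for X
      proof -
        \<comment> \<open>Every positive \<open>t\<close> eventually leaves the shrinking intervals,
          and \<open>D\<close> vanishes on the other numbers.\<close>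
        have "(\<lambda>n. E 0 (X n)) \<longlonglongrightarrow> 0"
        proof (rule E_lim)
          fix t :: real assume "t > 0"
          then have "\<forall>\<^sub>F n in sequentially. X n < t" using that by (intro order_tendstoD(2))
          then show "\<forall>\<^sub>F n in sequentially. t \<notin> {0..<X n}" by eventually_elim simp
        qed
        then have lim: "(\<lambda>n. 2 * E 0 (X n) * norm f) \<longlonglongrightarrow> 0"
          using tendsto_mult_right_zero tendsto_mult_left_zero by blast
        have "norm (G (X n) - G 0) \<le> 2 * E 0 (X n) * norm f" for n
        proof (cases "0 \<le> X n")
          case True
          then show ?thesis by (rule G_lip)
        next
          case False
          then have "E 0 (X n) = 0" by (simp add: E_def)
          then show ?thesis using False by (simp add: G_neg)
        qed
        then have "(\<lambda>n. G (X n) - G 0) \<longlonglongrightarrow> 0"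
          by (intro Lim_null_comparison[OF _ lim] always_eventually) auto
        then show ?thesis by (simp add: LIM_zero_iff)
      qed
      then show ?thesis unfolding True continuous_at_sequentially by (simp add: o_def)
    qed
  qed
  have H_int: "(H has_integral (G y - G x)) {x..y}" if "x \<le> y" for x y
    by (rule fundamental_theorem_of_calculus_interior_strong[of "{0}"])
      (use that deriv G_cont in \<open>auto intro: continuous_on_subset\<close>)
  \<comment> \<open>The symbol of the remainder is the tail of a scalar integral, at most the tail
    \<open>T\<close> of the majorant for every \<open>l\<close>. Hence the primitives converge in
    norm, and the full scalar integral identifies the limit.\<close>
  have G_lim: "\<exists>b>0. \<forall>y\<ge>b. norm (G y - c *\<^sub>C P f) < e" if e: "e > 0" for e
  proof -
    define T where "T x = (LINT t|lborel. indicator {x..} t *\<^sub>R D t)" for x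
    have T_mono: "T y \<le> T x" if "x \<le> y" for x y
      unfolding T_def using that D_nonneg D_int
      by (intro integral_mono' integrable_mult_indicator) (auto simp: indicator_def)
    have "(\<lambda>n. T (real n)) \<longlonglongrightarrow> (LINT t|(lborel :: real measure). (0 :: real))"
      unfolding T_def
    proof (rule integral_dominated_convergence[OF _ _ D_int])
      show "AE t in lborel. (\<lambda>n. indicator {real n..} t *\<^sub>R D t) \<longlonglongrightarrow> 0"
      proof (intro AE_I2 tendsto_eventually)
        fix t :: real
        show "\<forall>\<^sub>F n in sequentially. indicator {real n..} t *\<^sub>R D t = 0"
          using eventually_gt_at_top[of "nat \<lceil>t\<rceil>"] 
          by eventually_elim (use real_nat_ceiling_ge[of t] in \<open>auto simp: indicator_def\<close>)
      qed
      have [measurable]: "D \<in> borel_measurable borel" using D_int by auto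
      show "(\<lambda>t. indicator {real n..} t *\<^sub>R D t) \<in> borel_measurable lborel" for n by measurable
    qed (use D_nonneg in \<open>auto simp: indicator_def\<close>)
    then have "(\<lambda>n. 2 * T (real n) * norm f) \<longlonglongrightarrow> 0"
      by (simp add: tendsto_mult_left_zero tendsto_mult_right_zero)
    then have "\<forall>\<^sub>F n in sequentially. 2 * T (real n) * norm f < e"
      using e by (rule order_tendstoD(2))
    then obtain n where n: "2 * T (real n) * norm f < e" by (auto simp: eventually_sequentially)
    have "norm (G y - c *\<^sub>C P f) < e" if y: "real n \<le> y" for y
    proof -
      have "norm (S y f - c *\<^sub>C P f) \<le> 2 * T y * norm f"
      proof (rule has_symbol_norm_le[OF has_symbol_diff[OF S has_symbol_scale[OF P]]])
        fix s
        have l: "\<phi> s \<in> {0..M}" "0 \<le> \<phi> s" using \<phi>[of s] by auto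
        have "g y (\<phi> s) - c * of_real (\<phi> s) powr \<alpha> = (LINT t|lborel. indicator {..<y} t *\<^sub>R k (\<phi> s) t - k (\<phi> s) t)"
          using fractional_power_integral(2)[OF \<alpha> m(2) l(2)] g_int[OF l(2)] k_int[OF l(2)]
          by (simp add: g_def c_def k_def[abs_def])
        also have "\<dots> = (LINT t|lborel. - (indicator {y..} t *\<^sub>R k (\<phi> s) t))"
          by (intro Bochner_Integration.integral_cong) (auto simp: indicator_def)
        also have "cmod \<dots> \<le> (LINT t|lborel. cmod (- (indicator {y..} t *\<^sub>R k (\<phi> s) t)))"
          by (rule integral_norm_bound)
        also have "\<dots> \<le> T y"
          unfolding T_def using k_le[OF l(1)] D_nonneg D_int
          by (intro integral_mono' integrable_mult_indicator) (auto simp: indicator_def)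
        finally show "cmod (g y (\<phi> s) - c * of_real (\<phi> s) powr \<alpha>) \<le> T y" .
      qed
      also have "\<dots> \<le> 2 * T (real n) * norm f"
        using T_mono[OF y] by (intro mult_right_mono) auto
      finally show ?thesis using n by (simp add: G_def)
    qed
    then show ?thesis by (intro exI[of _ "real n + 1"]) auto
  qed
  have c: "c \<noteq> 0"
    using \<alpha> m by (simp add: c_def Gamma_nonzero)
  \<comment> \<open>On an unbounded domain the gauge integral is a limit over boxes. A box
    containing \<open>- b\<close> and \<open>b\<close> contributes \<open>G y - G x\<close>, where
    \<open>G x = 0\<close> because \<open>x\<close> is negative.\<close>
  have "((\<lambda>t. V t f) has_integral c *\<^sub>C P f) {0<..}"
    unfolding has_integral_alt'
  proof (intro conjI allI impI)
    fix x y :: real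
    have eq: "(\<lambda>t. if t \<in> {0<..} then V t f else 0) = H" by (simp add: H_def fun_eq_iff)
    show "(\<lambda>t. if t \<in> {0<..} then V t f else 0) integrable_on cbox x y"
      unfolding eq using H_int[of x y] by (cases "x \<le> y") (auto simp: integrable_on_def)
  next
    fix e :: real assume "e > 0"
    then obtain b where b: "b > 0" "\<And>y. y \<ge> b \<Longrightarrow> norm (G y - c *\<^sub>C P f) < e" using G_lim by blast
    have "norm (integral (cbox x y) H - c *\<^sub>C P f) < e" if xy: "ball 0 (b + 1) \<subseteq> cbox x y" for x y
    proof -
      have "b \<in> cbox x y" "- b \<in> cbox x y" using xy b(1) by (auto simp: subset_iff)
      then have "x \<le> 0" "b \<le> y" "x \<le> y" using b(1) by auto
      then have "integral (cbox x y) H = G y" using H_int[of x y] by (simp add: integral_unique G_neg)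
      then show ?thesis using b(2)[OF \<open>b \<le> y\<close>] by simp
    qed
    then show "\<exists>b>0. \<forall>x y. ball 0 b \<subseteq> cbox x y \<longrightarrow> norm (integral (cbox x y) (\<lambda>t. if t \<in> {0<..} then V t f else 0) - c *\<^sub>C P f) < e"
      using b(1) unfolding H_def by (intro exI[of _ "b + 1"]) auto
  qed
  moreover have "P f = (Gamma (of_nat m) / (Gamma \<alpha> * Gamma (of_nat m - \<alpha>))) *\<^sub>C c *\<^sub>C P f"
    using c by (simp add: scaleC_scaleC c_def scaleC_one)
  ultimately show "\<exists>I. ((\<lambda>t. of_real t powr (\<alpha> - 1) *\<^sub>C (((\<lambda>g. B (resolvent B t g)) ^^ m) f)) has_integral I) {0<..} \<and>
      P f = (Gamma (of_nat m) / (Gamma \<alpha> * Gamma (of_nat m - \<alpha>))) *\<^sub>C I"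
    unfolding V_def by blast
qed

end

section \<open>Null sets and Lebesgue measurable preimages\<close>

text \<open>
  Vitali's construction inside \<open>E\<close>: representatives modulo rational translations in one
  coordinate direction.
\<close>

lemma null_if_all_subsets_measurable_bounded:
  fixes E :: "'a::euclidean_space set"
  assumes meas: "\<And>T. T \<subseteq> E \<Longrightarrow> T \<in> sets lebesgue" and E: "bounded E"
  shows "negligible E"
proof -
  obtain e :: 'a where e: "e \<in> Basis" using nonempty_Basis by blast
  define r where "r x y \<longleftrightarrow> (\<exists>q\<in>\<rat>. y = x + q *\<^sub>R e)" for x y
  have r_refl: "r x x" for x unfolding r_def by (intro bexI[of _ 0]) auto
  have r_sym: "r y x" if xy: "r x y" for x y
  proof -
    obtain q where "q \<in> \<rat>" "y = x + q *\<^sub>R e" using xy by (auto simp: r_def)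
    then show ?thesis unfolding r_def by (intro bexI[of _ "- q"]) auto
  qed
  have r_trans: "r x z" if "r x y" "r y z" for x y z
  proof -
    obtain q q' where "q \<in> \<rat>" "y = x + q *\<^sub>R e" "q' \<in> \<rat>" "z = y + q' *\<^sub>R e"
      using \<open>r x y\<close> \<open>r y z\<close> by (auto simp: r_def)
    then show ?thesis unfolding r_def by (intro bexI[of _ "q + q'"]) (auto simp: algebra_simps)
  qed
  \<comment> \<open>Equivalent points have the same set of candidates, so the choice operator gives
    them the same representative.\<close>
  define c where "c x = (SOME y. y \<in> E \<and> r x y)" for x
  have c: "c x \<in> E \<and> r x (c x)" if "x \<in> E" for x
    unfolding c_def by (rule someI[of _ x]) (use that r_refl in auto)
  have c_eq: "c x = c y" if "r x y" for x y
  proof -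
    have "r x z \<longleftrightarrow> r y z" for z using that r_sym r_trans by blast
    then show ?thesis by (simp add: c_def)
  qed
  define V where "V = c ` E"
  have VE: "V \<subseteq> E" using c by (auto simp: V_def)
  have V_uniq: "v = w" if "v \<in> V" "w \<in> V" "r v w" for v w
  proof -
    obtain x y where xy: "x \<in> E" "y \<in> E" "v = c x" "w = c y" using \<open>v \<in> V\<close> \<open>w \<in> V\<close> by (auto simp: V_def)
    then have "r x y" using c[of x] c[of y] \<open>r v w\<close> r_sym r_trans by blast
    then show ?thesis using c_eq xy by blast
  qed
  obtain R where R: "\<And>x. x \<in> E \<Longrightarrow> norm x \<le> R" using E by (auto simp: bounded_iff)
  have V: "V \<in> lmeasurable"
    using meas[OF VE] bounded_subset[OF E VE] by (rule bounded_set_imp_lmeasurable[rotated])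
  \<comment> \<open>Infinitely many distinct rationals between 0 and 1. The corresponding translates
    of \<open>V\<close> are disjoint, have equal measure and lie in one ball, which forces the
    measure of \<open>V\<close> to be 0.\<close>
  define q where "q i = inverse (real (Suc i))" for i
  define W where "W i = (+) (q i *\<^sub>R e) ` V" for i
  have W: "W i \<in> lmeasurable" "measure lebesgue (W i) = measure lebesgue V" for i
    unfolding W_def using V by (simp_all add: measurable_translation measure_translation)
  have disj: "disjoint_family_on W I" for I
    unfolding disjoint_family_on_def
  proof (intro ballI impI equals0I)
    fix i j x assume "i \<noteq> j" "x \<in> W i \<inter> W j"
    then obtain v w where vw: "v \<in> V" "w \<in> V" "q i *\<^sub>R e + v = q j *\<^sub>R e + w" by (auto simp: W_def)
    then have "w = v + (q i - q j) *\<^sub>R e" by (simp add: algebra_simps)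
    moreover have "q i - q j \<in> \<rat>" by (simp add: q_def)
    ultimately have "v = w" using V_uniq[OF vw(1,2)] by (auto simp: r_def)
    then have "q i = q j" using vw(3) e by (auto simp: nonzero_Basis)
    then show False using \<open>i \<noteq> j\<close> by (simp add: q_def)
  qed
  have sub: "W i \<subseteq> cball 0 (R + 1)" for i
  proof
    fix x assume "x \<in> W i"
    then obtain v where v: "v \<in> V" "x = q i *\<^sub>R e + v" by (auto simp: W_def)
    have "norm x \<le> norm (q i *\<^sub>R e) + norm v" unfolding v(2) by (rule norm_triangle_ineq)
    also have "norm (q i *\<^sub>R e) \<le> 1" using e by (simp add: q_def field_simps)
    also have "norm v \<le> R" using v VE R by auto
    finally show "x \<in> cball 0 (R + 1)" by simp
  qed
  have "real n * measure lebesgue V \<le> measure lebesgue (cball 0 (R + 1) :: 'a set)" for n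
  proof -
    have "ennreal (real n * measure lebesgue V) = (\<Sum>i<n. emeasure lebesgue (W i))"
      using W by (simp add: emeasure_eq_measure2 ennreal_mult ennreal_of_nat_eq_real_of_nat)
    also have "\<dots> = emeasure lebesgue (\<Union>i<n. W i)"
      using W(1) disj by (intro sum_emeasure) auto
    also have "\<dots> \<le> emeasure lebesgue (cball 0 (R + 1) :: 'a set)"
      using sub by (intro emeasure_mono) auto
    also have "\<dots> = ennreal (measure lebesgue (cball 0 (R + 1) :: 'a set))"
      by (intro emeasure_eq_measure2 lmeasurable_cball)
    finally show ?thesis by simp
  qed
  then have "measure lebesgue V = 0"
    using reals_Archimedean3[of "measure lebesgue V"] measure_nonneg[of lebesgue V]
    by (metis linorder_not_less order_le_less)
  then have "negligible V" using V by (simp add: negligible_iff_measure)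
  then have "negligible (\<Union>p\<in>\<rat>. (+) (p *\<^sub>R e) ` V)"
    by (intro negligible_countable_Union countable_image countable_rat) (auto simp: negligible_translation)
  moreover have "E \<subseteq> (\<Union>p\<in>\<rat>. (+) (p *\<^sub>R e) ` V)"
  proof
    fix x assume x: "x \<in> E"
    then have "r (c x) x" using c r_sym by blast
    then obtain p where p: "p \<in> \<rat>" "x = c x + p *\<^sub>R e" by (auto simp: r_def)
    then show "x \<in> (\<Union>p\<in>\<rat>. (+) (p *\<^sub>R e) ` V)"
      using x by (intro UN_I[of p] image_eqI[of _ _ "c x"]) (auto simp: V_def add.commute)
  qed
  ultimately show ?thesis by (rule negligible_subset)
qed

lemma null_if_all_subsets_measurable:
  fixes E :: "'a::euclidean_space set"
  assumes "\<And>T. T \<subseteq> E \<Longrightarrow> T \<in> sets lebesgue"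
  shows "negligible E"
proof -
  have "negligible (\<Union>n::nat. E \<inter> cball 0 (real n))"
    using assms by (intro negligible_Union_nat null_if_all_subsets_measurable_bounded bounded_Int) auto
  moreover have "(\<Union>n::nat. E \<inter> cball 0 (real n)) = E"
    using real_arch_simple by auto
  ultimately show ?thesis by simp
qed

text \<open>
  Up to a null set, every subset of \<open>b -` N\<close> is the preimage of a subset of \<open>N\<close>, hence
  Lebesgue measurable.
\<close>

lemma negligible_vimage_almost_bijective:
  assumes b: "b \<in> lebesgue \<rightarrow>\<^sub>M lebesgue" and bij: "almost_bijective b" and N: "negligible N"
  shows "negligible (b -` N)"
proof -
  obtain M N' where M: "M \<in> null_sets lebesgue" and bb: "bij_betw b (- M) (- N')"
    using bij by (auto simp: almost_bijective_def)
  have "negligible (b -` N - M)"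
  proof (rule null_if_all_subsets_measurable)
    fix T assume T: "T \<subseteq> b -` N - M"
    then have "negligible (b ` T)" using N by (rule_tac negligible_subset) auto
    then have "b ` T \<in> sets lebesgue" by (auto simp: negligible_iff_null_sets)
    \<comment> \<open>The image of \<open>T\<close> is a null set but perhaps not Borel; that
      \<open>b\<close> is measurable between Lebesgue sigma-algebras covers it.\<close>
    then have "b -` (b ` T) \<in> sets lebesgue" using measurable_sets[OF b] by simp
    then have "b -` (b ` T) - M \<in> sets lebesgue" using M by auto
    moreover have "b -` (b ` T) - M = T"
      using T bb by (auto simp: bij_betw_def inj_on_def)
    ultimately show "T \<in> sets lebesgue" by simp
  qed
  moreover have "negligible M" using M by (simp add: negligible_iff_null_sets)
  ultimately have "negligible ((b -` N - M) \<union> M)" by (rule negligible_Un)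
  then show ?thesis by (rule negligible_subset) auto
qed

text \<open>Radon-Nikodym for the image under \<open>b\<close> of the measure with density
  \<open>p\<close>; absolute continuity is the preceding lemma. The construction needs a positive
  measure, so it will be applied to \<open>cmod (Q t)\<close>, the phase of \<open>Q\<close> being
  restored separately. The finite total mass makes the density finite almost everywhere, so
  \<open>enn2real\<close> loses nothing.\<close>

lemma ex_transported_density:
  fixes b :: "real^'n \<Rightarrow> real^'n"
  assumes b: "b \<in> lebesgue \<rightarrow>\<^sub>M lebesgue" and bij: "almost_bijective b"
    and p: "integrable lebesgue p" "\<And>t. p t \<ge> 0"
  obtains r where "integrable lebesgue r" "\<And>u. r u \<ge> (0::real)"
    "\<And>h :: real^'n \<Rightarrow> complex. h \<in> borel_measurable lebesgue \<Longrightarrow>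
      (LINT u|lebesgue. r u *\<^sub>R h u) = (LINT t|lebesgue. p t *\<^sub>R h (b t))"
proof -
  interpret L: sigma_finite_measure "lebesgue :: (real^'n) measure" by (rule sigma_finite_lebesgue)
  have [measurable]: "p \<in> borel_measurable lebesgue" "b \<in> lebesgue \<rightarrow>\<^sub>M lebesgue" using p b by auto
  define dp where "dp = density lebesgue (\<lambda>t. ennreal (p t))"
  define \<nu> where "\<nu> = distr dp lebesgue b"
  have b_dp: "b \<in> dp \<rightarrow>\<^sub>M lebesgue" using b by (simp add: dp_def)
  have "absolutely_continuous lebesgue \<nu>"
    unfolding absolutely_continuous_def
  proof
    fix N :: "(real^'n) set" assume N: "N \<in> null_sets lebesgue"
    then have "negligible (b -` N)"
      using b bij by (intro negligible_vimage_almost_bijective) (auto simp: negligible_iff_null_sets)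
    then have "b -` N \<in> null_sets dp"
      unfolding dp_def
      by (subst null_sets_density_iff) (auto simp: negligible_iff_null_sets intro!: AE_I'[of "b -` N"])
    then show "N \<in> null_sets \<nu>"
      using N b_dp by (auto simp: null_sets_def \<nu>_def emeasure_distr dp_def)
  qed
  then obtain \<rho> where \<rho>[measurable]: "\<rho> \<in> borel_measurable lebesgue" and dens: "density lebesgue \<rho> = \<nu>"
    using L.Radon_Nikodym[of \<nu>] by (auto simp: \<nu>_def)
  have "(\<integral>\<^sup>+u. \<rho> u \<partial>lebesgue) = emeasure \<nu> UNIV"
    unfolding dens[symmetric] by (simp add: emeasure_density)
  also have "\<dots> = emeasure dp UNIV"
    unfolding \<nu>_def using b_dp by (simp add: emeasure_distr dp_def)
  also have "\<dots> = (\<integral>\<^sup>+t. ennreal (p t) \<partial>lebesgue)"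
    by (simp add: dp_def emeasure_density)
  also have "\<dots> < \<infinity>" using p by (simp add: integrable_iff_bounded)
  finally have fin: "(\<integral>\<^sup>+u. \<rho> u \<partial>lebesgue) < \<infinity>" .
  then have "AE u in lebesgue. \<rho> u \<noteq> \<infinity>" by (intro nn_integral_PInf_AE) auto
  then have ae: "AE u in lebesgue. \<rho> u = ennreal (enn2real (\<rho> u))"
    by eventually_elim (simp add: less_top)
  define r where "r u = enn2real (\<rho> u)" for u
  have [measurable]: "r \<in> borel_measurable lebesgue" unfolding r_def by measurable
  have "(\<integral>\<^sup>+u. ennreal (r u) \<partial>lebesgue) = (\<integral>\<^sup>+u. \<rho> u \<partial>lebesgue)"
    using ae by (intro nn_integral_cong_AE) (auto simp: r_def)
  then have r_int: "integrable lebesgue r"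
    using fin by (simp add: integrable_iff_bounded r_def)
  have dens_r: "density lebesgue (\<lambda>u. ennreal (r u)) = \<nu>"
    unfolding dens[symmetric] using ae by (intro density_cong) (auto simp: r_def)
  show ?thesis
  proof (rule that[OF r_int])
    fix h :: "real^'n \<Rightarrow> complex" assume h[measurable]: "h \<in> borel_measurable lebesgue"
    have "(LINT u|lebesgue. r u *\<^sub>R h u) = (LINT u|density lebesgue (\<lambda>u. ennreal (r u)). h u)"
      by (subst integral_density) (auto simp: r_def)
    also have "\<dots> = (LINT t|dp. h (b t))"
      unfolding dens_r \<nu>_def using b_dp by (rule integral_distr) measurable
    also have "\<dots> = (LINT t|lebesgue. p t *\<^sub>R h (b t))"
      unfolding dp_def using p(2) by (subst integral_density) auto
    finally show "(LINT u|lebesgue. r u *\<^sub>R h u) = (LINT t|lebesgue. p t *\<^sub>R h (b t))" .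
  qed (simp add: r_def)
qed

text \<open>The measure is complete, so almost everywhere equality transports measurability. No
  measurability condition remains, and if one side is not integrable, both integrals take the
  default value 0.\<close>

lemma integrable_integral_cong_AE_lebesgue:
  fixes f g :: "'a::euclidean_space \<Rightarrow> complex"
  assumes ae: "AE x in lebesgue. f x = g x"
  shows "integrable lebesgue f \<longleftrightarrow> integrable lebesgue g"
    and "(LINT x|lebesgue. f x) = (LINT x|lebesgue. g x)"
proof -
  have ae': "AE x in lebesgue. g x = f x" using ae by eventually_elim simp
  have m: "f \<in> borel_measurable lebesgue \<longleftrightarrow> g \<in> borel_measurable lebesgue"
    using borel_measurable_AE[OF _ ae] borel_measurable_AE[OF _ ae'] by blast
  show i: "integrable lebesgue f \<longleftrightarrow> integrable lebesgue g"
    using m integrable_cong_AE[OF _ _ ae] by (auto dest: borel_measurable_integrable)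
  show "(LINT x|lebesgue. f x) = (LINT x|lebesgue. g x)"
  proof (cases "integrable lebesgue f")
    case True
    then show ?thesis using i by (intro integral_cong_AE ae) auto
  next
    case False
    then show ?thesis using i by (simp add: not_integrable_integral_eq)
  qed
qed

section \<open>Hausdorff operators as averages over the dilation group\<close>

context dilation_group
begin

text \<open>The exceptional set of parameters \<open>u\<close> in \<open>eq\<close> is common to all
  \<open>f\<close> and \<open>x\<close>, so the two integrals over \<open>u\<close> agree at every
  point \<open>x\<close>, for every representative \<open>f\<close>.\<close>

lemma hausdorff_average:
  assumes eq: "AE u in lebesgue. \<forall>f x. K u * f (A u *v x) = \<kappa> u * dil (\<tau> u) f x"
    and \<kappa>: "integrable lebesgue \<kappa>" and \<tau>: "\<tau> \<in> lebesgue \<rightarrow>\<^sub>M borel"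
  shows "is_average lebesgue \<kappa> \<tau> (hausdorff_op A K)" and "hausdorff_bounded A K"
proof -
  have ae: "AE u in lebesgue. K u * f (A u *v x) = \<kappa> u * dil (\<tau> u) f x" for f x
    using eq by eventually_elim simp
  note cong = integrable_integral_cong_AE_lebesgue[OF ae]
  have H: "hausdorff A K f = (\<lambda>x. LINT u|lebesgue. \<kappa> u * dil (\<tau> u) f x)" for f
    unfolding hausdorff_def by (simp only: cong)
  note avg = average_lebesgue[OF \<kappa> \<tau> sigma_finite_lebesgue]
  obtain T where T: "is_average lebesgue \<kappa> \<tau> T"
    by (rule ex_average[OF sigma_finite_lebesgue \<kappa> \<tau>])
  have op: "hausdorff_op A K = T"
  proof
    fix f
    show "hausdorff_op A K f = T f"
      using avg(3)[OF square_integrable_rep_L2[of f] T] unfolding hausdorff_op_def H by (simp add: abs_rep_L2)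
  qed
  then show "is_average lebesgue \<kappa> \<tau> (hausdorff_op A K)" using T by simp
  have "bounded_operator (hausdorff_op A K)"
    unfolding op using T \<kappa> by (rule bounded_operator_average)
  then show "hausdorff_bounded A K"
    unfolding hausdorff_bounded_def cong H op using avg T by blast
qed

end

section \<open>Diagonalized matrix families\<close>

lemma matrix_inv_orthogonal: "orthogonal_matrix (C :: real^'n^'n) \<Longrightarrow> matrix_inv C = transpose C"
proof -
  assume C: "orthogonal_matrix C"
  then have "C ** transpose C = mat 1 \<and> transpose C ** C = mat 1" by (simp add: orthogonal_matrix_def)
  then have inv: "matrix_inv C ** C = mat 1" unfolding matrix_inv_def by (rule someI2) simp
  have "matrix_inv C = matrix_inv C ** (C ** transpose C)" using C by (simp add: orthogonal_matrix_def)
  also have "\<dots> = transpose C" by (simp add: matrix_mul_assoc inv)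
  finally show ?thesis .
qed

lemma diag_matrix_vector_mult: "diag_matrix v *v x = (\<chi> k. v $ k * x $ k)"
  by (simp add: diag_matrix_def matrix_vector_mult_def vec_eq_iff if_distrib[of "\<lambda>y. y * _"] cong: if_cong)

lemma det_diag_matrix: "det (diag_matrix v) = (\<Prod>k\<in>UNIV. v $ k)"
  by (subst det_diagonal) (auto simp: diag_matrix_def)

locale diagonal_family = dilation_group C for C :: "real^'n^'n" +
  fixes D :: "(real^'n) set" and A :: "real^'n \<Rightarrow> real^'n^'n" and a :: "real^'n \<Rightarrow> real^'n"
  assumes D: "D \<in> sets lebesgue" and A: "A \<in> borel_measurable (lebesgue_on D)"
    and pos: "AE u in lebesgue. u \<in> D \<longrightarrow> pos_def (A u)"
    and diag: "\<And>u. u \<in> D \<Longrightarrow> matrix_inv C ** A u ** C = diag_matrix (a u)"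
begin

text \<open>The points at which all logarithms make sense. Phrased by eigenvalues instead of
  \<open>pos_def\<close>, it is visibly a measurable condition.\<close>

definition positive_at :: "real^'n \<Rightarrow> bool" where
  "positive_at u \<longleftrightarrow> u \<in> D \<and> (\<forall>k. 0 < a u $ k)"

text \<open>The default 0 makes \<open>logs\<close> total and measurable; it never contributes,
  because the weights below vanish at these points.\<close>

definition logs :: "real^'n \<Rightarrow> real^'n" where
  "logs u = (\<chi> k. if positive_at u then ln (a u $ k) else 0)"

lemma A_eq:
  assumes "u \<in> D" shows "A u = C ** diag_matrix (a u) ** transpose C"
proof -
  have "C ** diag_matrix (a u) ** transpose C = (C ** transpose C) ** A u ** (C ** transpose C)"
    using diag[OF assms] by (simp add: matrix_inv_orthogonal[OF orth] matrix_mul_assoc flip: diag[OF assms])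
  then show ?thesis using orth by (simp add: orthogonal_matrix_def)
qed

text \<open>The source of both measurability and positivity of \<open>a\<close>: each eigenvalue is
  the quadratic form of \<open>A u\<close> at a fixed column of \<open>C\<close>, hence measurable
  along with \<open>A\<close> and positive where \<open>A u\<close> is positive definite.\<close>

lemma a_eq:
  assumes "u \<in> D" shows "a u $ k = (C *v axis k 1) \<bullet> (A u *v (C *v axis k 1))"
proof -
  have "A u *v (C *v axis k 1) = C *v (diag_matrix (a u) *v axis k 1)"
    unfolding A_eq[OF assms] by (simp add: matrix_vector_mul_assoc[symmetric] orth_mult[simplified])
  then have "(C *v axis k 1) \<bullet> (A u *v (C *v axis k 1)) = axis k 1 \<bullet> (diag_matrix (a u) *v axis k 1)"
    by (simp add: dot_lmul_matrix[symmetric] orth_mult[simplified])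
  then show ?thesis by (simp add: diag_matrix_vector_mult inner_axis' )
qed

lemma AE_positive_at: "AE u in lebesgue. u \<in> D \<longrightarrow> positive_at u"
  using pos
proof eventually_elim
  case (elim u)
  show ?case
  proof
    assume u: "u \<in> D"
    have "0 < a u $ k" for k
    proof -
      have "C *v axis k 1 \<noteq> 0"
      proof
        assume "C *v axis k 1 = 0"
        then have "axis k (1 :: real) = (0 :: real^'n)"
          using orth_mult(1)[of "axis k 1"] by (simp del: transpose_matrix_vector)
        then show False by (simp add: axis_eq_0_iff)
      qed
      then show ?thesis using elim u unfolding a_eq[OF u] pos_def_def by blast
    qed
    then show "positive_at u" using u by (simp add: positive_at_def)
  qed
qed

lemma exp_logs: "positive_at u \<Longrightarrow> exp (logs u $ k) = a u $ k"
  by (simp add: logs_def positive_at_def)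

lemma A_mult: "positive_at u \<Longrightarrow> A u *v x = dilation (logs u) x"
  using A_eq[of u] by (simp add: positive_at_def dilation_def exp_logs[unfolded positive_at_def] matrix_vector_mul_assoc[symmetric] diag_matrix_vector_mult)

lemma det_A: "positive_at u \<Longrightarrow> det (A u) = exp (\<Sum>k\<in>UNIV. logs u $ k)"
proof -
  assume u: "positive_at u"
  then have "det (A u) = det C * det (transpose C) * (\<Prod>k\<in>UNIV. a u $ k)"
    using A_eq[of u] by (simp add: positive_at_def det_mul det_diag_matrix mult_ac)
  also have "det C * det (transpose C) = det (C ** transpose C)" by (simp only: det_mul)
  also have "C ** transpose C = mat 1" using orth by (simp add: orthogonal_matrix_def)
  finally show ?thesis using u by (simp add: exp_sum exp_logs)
qed

lemma measurable_a: "(\<lambda>u. if u \<in> D then a u $ k else 0) \<in> borel_measurable lebesgue"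
proof -
  let ?v = "C *v axis k 1"
  have "continuous_on UNIV (\<lambda>X :: real^'n^'n. ?v \<bullet> (X *v ?v))"
    unfolding matrix_vector_mult_def by (intro continuous_intros continuous_on_vec_lambda)
  then have "(\<lambda>X :: real^'n^'n. ?v \<bullet> (X *v ?v)) \<in> borel \<rightarrow>\<^sub>M borel"
    by (rule borel_measurable_continuous_onI)
  from measurable_compose[OF A this]
  have "(\<lambda>u. ?v \<bullet> (A u *v ?v)) \<in> borel_measurable (lebesgue_on D)" .
  then have "(\<lambda>u. if u \<in> D then ?v \<bullet> (A u *v ?v) else 0) \<in> borel_measurable lebesgue"
    using D by (simp add: borel_measurable_if)
  also have "(\<lambda>u. if u \<in> D then ?v \<bullet> (A u *v ?v) else 0) = (\<lambda>u. if u \<in> D then a u $ k else 0)"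
    using a_eq by (auto simp: fun_eq_iff)
  finally show ?thesis .
qed

lemma measurable_positive_at[measurable]: "Measurable.pred lebesgue positive_at"
proof -
  note measurable_a[measurable]
  have "positive_at = (\<lambda>u. \<forall>k. 0 < (if u \<in> D then a u $ k else 0))"
    by (auto simp: positive_at_def fun_eq_iff)
  also have "Measurable.pred lebesgue \<dots>"
    by measurable
  finally show ?thesis .
qed

lemma measurable_logs[measurable]: "logs \<in> lebesgue \<rightarrow>\<^sub>M borel"
proof -
  note measurable_a[measurable]
  have "(\<lambda>u. logs u $ k) = (\<lambda>u. if positive_at u then ln (if u \<in> D then a u $ k else 0) else 0)" for k
    by (auto simp: fun_eq_iff logs_def positive_at_def)
  then have "(\<lambda>u. logs u $ k) \<in> borel_measurable lebesgue" for k by simp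
  then show ?thesis
    unfolding borel_measurable_euclidean_space[of logs] by (auto simp: Basis_vec_def inner_axis)
qed

text \<open>The integrable weight of the average. The exponential is the square root of
  \<open>det (A u)\<close>; the value 0 is used where \<open>A u\<close> carries no
  information.\<close>

definition weighted :: "(real^'n \<Rightarrow> complex) \<Rightarrow> real^'n \<Rightarrow> complex" where
  "weighted K u = (if positive_at u then K u / of_real (exp ((\<Sum>k\<in>UNIV. logs u $ k) / 2)) else 0)"

lemma AE_weighted:
  assumes "defined_on_support D A K"
  shows "AE u in lebesgue. positive_at u \<or> K u = 0"
  using assms AE_positive_at unfolding defined_on_support_def
  by eventually_elim (auto simp: support_on_def)

lemma det_weight_eq:
  assumes "positive_at u" shows "of_real (\<bar>det (A u)\<bar> powr (- 1 / 2)) * K u = weighted K u"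
proof -
  have eq: "\<bar>det (A u)\<bar> powr (- 1 / 2) = inverse (exp ((\<Sum>k\<in>UNIV. logs u $ k) / 2))"
    unfolding det_A[OF assms] by (simp add: powr_def exp_minus)
  show ?thesis
    unfolding eq using assms by (simp only: weighted_def if_True of_real_inverse divide_inverse mult.commute[of "K u"])
qed

lemma integrable_weighted:
  assumes "defined_on_support D A K" "det_weight_integrable A K"
  shows "integrable lebesgue (weighted K)"
proof -
  have "AE u in lebesgue. of_real (\<bar>det (A u)\<bar> powr (- 1 / 2)) * K u = weighted K u"
    using AE_weighted[OF assms(1)]
    by eventually_elim (metis det_weight_eq mult_zero_right weighted_def div_0)
  from integrable_integral_cong_AE_lebesgue(1)[OF this] assms(2)
  show ?thesis by (simp add: det_weight_integrable_def)
qed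

lemma hausdorff_symbol:
  assumes "defined_on_support D A K" "det_weight_integrable A K"
  shows "hausdorff_bounded A K"
    and "has_symbol (hausdorff_op A K) (\<lambda>s. LINT u|lebesgue. weighted K u * cis (- (s \<bullet> logs u)))"
proof -
  have eq: "AE u in lebesgue. \<forall>f x. K u * f (A u *v x) = weighted K u * dil (logs u) f x"
    using AE_weighted[OF assms(1)]
    by eventually_elim (auto simp: weighted_def dil_def A_mult)
  note int = integrable_weighted[OF assms]
  show "hausdorff_bounded A K" by (rule hausdorff_average(2)[OF eq int measurable_logs])
  show "has_symbol (hausdorff_op A K) (\<lambda>s. LINT u|lebesgue. weighted K u * cis (- (s \<bullet> logs u)))"
    using hausdorff_average(1)[OF eq int measurable_logs] sigma_finite_lebesgue int measurable_logs
    by (rule average_has_symbol)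
qed

text \<open>In the exponent of each eigenvalue, the real part \<open>- 1 / 2\<close> produces the
  weight and the imaginary part the character at \<open>logs u\<close>.\<close>

lemma scalar_symbol_eq:
  assumes "defined_on_support D A K"
  shows "scalar_symbol a K s = (LINT u|lebesgue. weighted K u * cis (- (s \<bullet> logs u)))"
  unfolding scalar_symbol_def
proof (rule integrable_integral_cong_AE_lebesgue(2))
  show "AE u in lebesgue. K u * (\<Prod>k\<in>UNIV. exp ((- 1 / 2 - \<i> * of_real (s $ k)) * of_real (ln (a u $ k))))
      = weighted K u * cis (- (s \<bullet> logs u))"
    using AE_weighted[OF assms]
  proof eventually_elim
    case (elim u)
    show ?case
    proof (cases "positive_at u")
      case True
      have "(\<Prod>k\<in>UNIV. exp ((- 1 / 2 - \<i> * of_real (s $ k)) * of_real (ln (a u $ k))))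
          = exp (\<Sum>k\<in>UNIV. (- 1 / 2 - \<i> * of_real (s $ k)) * of_real (logs u $ k))"
        using True by (simp add: exp_sum logs_def)
      also have "(\<Sum>k\<in>UNIV. (- 1 / 2 - \<i> * of_real (s $ k)) * of_real (logs u $ k))
          = - of_real ((\<Sum>k\<in>UNIV. logs u $ k) / 2) + \<i> * of_real (- (s \<bullet> logs u))"
        by (simp add: inner_vec_def left_diff_distrib sum_subtractf sum_distrib_left sum_divide_distrib sum_negf mult.assoc)
      also have "exp \<dots> = cis (- (s \<bullet> logs u)) / of_real (exp ((\<Sum>k\<in>UNIV. logs u $ k) / 2))"
        by (simp only: exp_add exp_minus cis_conv_exp exp_of_real divide_inverse mult.commute)
      finally show ?thesis using True by (simp add: weighted_def)
    next
      case False
      then show ?thesis using elim by (simp add: weighted_def)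
    qed
  qed
qed

text \<open>Since \<open>logs (b t) = t\<close> for almost every \<open>t\<close>, integrating
  functions of \<open>logs u\<close> against the image of \<open>Q\<close> under \<open>b\<close>
  returns integrals against \<open>Q\<close> itself. The modulus is transported as a positive
  measure and the phase is read off at \<open>logs u\<close>. As \<open>K\<close> is the square root
  of \<open>det (A u)\<close> times an integrable function, a bound on the determinant over
  \<open>S \<inter> D\<close> gives integrability on \<open>S\<close>.\<close>

lemma ex_kernel_of_symbol:
  assumes b: "AE t in lebesgue. b t \<in> D \<and> (\<forall>k. a (b t) $ k = exp (t $ k))"
    and b_meas: "b \<in> lebesgue \<rightarrow>\<^sub>M lebesgue" and bij: "almost_bijective b" and Q: "integrable lebesgue Q"
  obtains K where "K \<in> borel_measurable lebesgue" "defined_on_support D A K" "det_weight_integrable A K"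
    "\<And>S. compact S \<Longrightarrow> bounded ((\<lambda>u. det (A u)) ` (S \<inter> D)) \<Longrightarrow> set_integrable lebesgue S K"
    "\<And>s. (LINT u|lebesgue. weighted K u * cis (- (s \<bullet> logs u))) = fourier_transform Q s"
proof -
  have [measurable]: "Q \<in> borel_measurable lebesgue" using Q by auto
  \<comment> \<open>The map \<open>logs\<close> need not pull null sets back to measurable sets, so
    \<open>Q\<close> composed with it could fail to be measurable; a Borel version avoids
    this.\<close>
  obtain Q0 where [measurable]: "Q0 \<in> borel_measurable borel" and Q0: "AE t in lebesgue. Q t = Q0 t"
    by (rule borel_version_complex[of Q]) auto
  obtain r where r: "integrable lebesgue r" "\<And>u. r u \<ge> (0::real)"
    "\<And>h :: real^'n \<Rightarrow> complex. h \<in> borel_measurable lebesgue \<Longrightarrow>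
      (LINT u|lebesgue. r u *\<^sub>R h u) = (LINT t|lebesgue. cmod (Q t) *\<^sub>R h (b t))"
    by (rule ex_transported_density[OF b_meas bij integrable_norm[OF Q]]) auto
  have [measurable]: "r \<in> borel_measurable lebesgue" using r by auto
  define w where "w u = exp ((\<Sum>k\<in>UNIV. logs u $ k) / 2)" for u
  \<comment> \<open>For almost every \<open>t\<close> this gives
    \<open>\<sigma> (b t) = sgn (Q t)\<close>, so modulus and phase recombine to \<open>Q t\<close>
    in the last step.\<close>
  define \<sigma> where "\<sigma> u = (if positive_at u then sgn (Q0 (logs u)) else 0)" for u
  have sgn_meas: "(sgn :: complex \<Rightarrow> complex) \<in> borel \<rightarrow>\<^sub>M borel"
    unfolding sgn_div_norm[abs_def] by measurable
  note sgn_meas[measurable]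
  have \<sigma>_meas[measurable]: "\<sigma> \<in> borel_measurable lebesgue"
    unfolding \<sigma>_def by measurable
  have \<sigma>_le: "cmod (\<sigma> u) \<le> 1" for u by (simp add: \<sigma>_def norm_sgn)
  have [measurable]: "(\<lambda>u. logs u $ k) \<in> borel_measurable lebesgue" for k
    using measurable_compose[OF measurable_logs borel_measurable_continuous_onI[of "\<lambda>x::real^'n. x $ k"]]
    by (simp add: continuous_on_component)
  have w_meas[measurable]: "w \<in> borel_measurable lebesgue"
    unfolding w_def by measurable
  \<comment> \<open>The factor \<open>w u\<close> cancels the division in
    \<open>weighted\<close>.\<close>
  define K where "K u = of_real (w u) * (r u *\<^sub>R \<sigma> u)" for u
  have W: "weighted K u = r u *\<^sub>R \<sigma> u" for u
  proof -
    have "complex_of_real (w u) \<noteq> 0" by (simp only: of_real_eq_0_iff w_def exp_not_eq_zero) simp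
    then have "K u / of_real (w u) = r u *\<^sub>R \<sigma> u" by (simp add: K_def scaleR_conv_of_real)
    then show ?thesis unfolding weighted_def w_def[symmetric] by (simp add: \<sigma>_def)
  qed
  have int: "integrable lebesgue (\<lambda>u. r u *\<^sub>R \<sigma> u)"
    by (rule Bochner_Integration.integrable_bound[OF r(1)]) (use \<sigma>_le r(2) in \<open>auto simp: mult_left_le\<close>)
  have K_zero: "K u = 0" if "\<not> positive_at u" for u using that by (simp add: K_def \<sigma>_def)
  show ?thesis
  proof (rule that[of K])
    show "K \<in> borel_measurable lebesgue" unfolding K_def by measurable
    show "defined_on_support D A K"
      unfolding defined_on_support_def
      using K_zero det_A by (intro AE_I2) (force simp: support_on_def positive_at_def)
    have "(\<lambda>u. of_real (\<bar>det (A u)\<bar> powr (- 1 / 2)) * K u) = (\<lambda>u. r u *\<^sub>R \<sigma> u)"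
    proof
      fix u
      show "of_real (\<bar>det (A u)\<bar> powr (- 1 / 2)) * K u = r u *\<^sub>R \<sigma> u"
        using det_weight_eq[of u K] K_zero[of u] W[of u] by (cases "positive_at u") (auto simp: \<sigma>_def)
    qed
    then show "det_weight_integrable A K" using int by (simp add: det_weight_integrable_def)
  next
    fix S :: "(real^'n) set"
    assume S: "compact S" and bd: "bounded ((\<lambda>u. det (A u)) ` (S \<inter> D))"
    obtain B where B: "\<And>u. u \<in> S \<Longrightarrow> u \<in> D \<Longrightarrow> \<bar>det (A u)\<bar> \<le> B"
      using bd by (auto simp: bounded_iff)
    have [measurable]: "S \<in> sets lebesgue" using S by (auto dest: borel_compact)
    have w_le: "w u \<le> sqrt B" if "u \<in> S" "positive_at u" for u
    proof -
      have "(w u)\<^sup>2 = det (A u)"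
        unfolding det_A[OF that(2)] w_def by (simp flip: exp_double)
      then have "(w u)\<^sup>2 \<le> B" using B[OF that(1)] that(2) by (auto simp: positive_at_def)
      then show ?thesis by (rule real_le_rsqrt)
    qed
    show "set_integrable lebesgue S K"
      unfolding set_integrable_def
    proof (rule Bochner_Integration.integrable_bound)
      show "integrable lebesgue (\<lambda>u. sqrt B *\<^sub>R (r u *\<^sub>R \<sigma> u))" using int by (rule integrable_scaleR_right)
      show "AE u in lebesgue. norm (indicator S u *\<^sub>R K u) \<le> norm (sqrt B *\<^sub>R (r u *\<^sub>R \<sigma> u))"
      proof (rule AE_I2)
        fix u
        show "norm (indicator S u *\<^sub>R K u) \<le> norm (sqrt B *\<^sub>R (r u *\<^sub>R \<sigma> u))"
        proof (cases "u \<in> S \<and> positive_at u")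
          case True
          then have "\<bar>w u\<bar> \<le> \<bar>sqrt B\<bar>" using w_le[of u] by (simp add: w_def)
          then show ?thesis using True by (simp only: K_def norm_mult norm_scaleR norm_of_real) (simp add: mult_right_mono)
        next
          case False
          then show ?thesis using K_zero[of u] by (auto simp: indicator_def)
        qed
      qed
    qed (unfold K_def, measurable)
  next
    fix s
    let ?h = "\<lambda>u. \<sigma> u * cis (- (s \<bullet> logs u))"
    have "(LINT u|lebesgue. weighted K u * cis (- (s \<bullet> logs u))) = (LINT u|lebesgue. r u *\<^sub>R ?h u)"
      by (simp add: W)
    also have "\<dots> = (LINT t|lebesgue. cmod (Q t) *\<^sub>R ?h (b t))"
      by (rule r(3)) measurable
    also have "\<dots> = (LINT t|lebesgue. Q t * exp (- \<i> * of_real (s \<bullet> t)))"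
    proof (rule integrable_integral_cong_AE_lebesgue(2))
      show "AE t in lebesgue. cmod (Q t) *\<^sub>R ?h (b t) = Q t * exp (- \<i> * of_real (s \<bullet> t))"
        using b Q0
      proof eventually_elim
        case (elim t)
        then have g: "positive_at (b t)" by (simp add: positive_at_def)
        then have l: "logs (b t) = t" using elim by (simp add: logs_def vec_eq_iff)
        have "cmod (Q t) *\<^sub>R sgn (Q t) = Q t" by (cases "Q t = 0") (auto simp: sgn_div_norm)
        moreover have "cis (- (s \<bullet> t)) = exp (- \<i> * of_real (s \<bullet> t))" by (simp add: cis_conv_exp)
        ultimately show ?case using g l elim by (simp add: \<sigma>_def) (metis mult_scaleR_left)
      qed
    qed
    finally show "(LINT u|lebesgue. weighted K u * cis (- (s \<bullet> logs u))) = fourier_transform Q s"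
      by (simp add: fourier_transform_def)
  qed
qed

end

theorem theorem6:
  fixes \<alpha> :: complex
    and D :: "(real^'n) set"
    and A :: "real^'n \<Rightarrow> real^'n^'n"
    and C :: "real^'n^'n"
    and a b :: "real^'n \<Rightarrow> real^'n"
    and K Q :: "real^'n \<Rightarrow> complex"
  assumes "0 < Re \<alpha>"
    and "D \<in> sets lebesgue" and "A \<in> borel_measurable (lebesgue_on D)"
    and "\<forall>u\<in>D. transpose (A u) = A u"
    and "\<forall>u\<in>D. \<forall>v\<in>D. A u ** A v = A v ** A u"
    and "AE u in lebesgue. u \<in> D \<longrightarrow> pos_def (A u)"
    and "orthogonal_matrix C"
    and "\<forall>u\<in>D. matrix_inv C ** A u ** C = diag_matrix (a u)"
    and "AE t in lebesgue. \<forall>u. (u \<in> D \<and> (\<forall>k. a u $ k = exp (t $ k))) \<longleftrightarrow> u = b t"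
    and "b \<in> lebesgue \<rightarrow>\<^sub>M lebesgue" and "almost_bijective b"
    and "locally_integrable K" and "defined_on_support D A K" and "det_weight_integrable A K"
    and "\<forall>s. scalar_symbol a K s \<in> \<real>\<^sub>\<ge>\<^sub>0"
    and "integrable lebesgue Q"
    and "\<forall>s. fourier_transform Q s = scalar_symbol a K s powr \<alpha>"
  shows "\<exists>K\<^sub>\<alpha>. K\<^sub>\<alpha> \<in> borel_measurable lebesgue \<and>
           defined_on_support D A K\<^sub>\<alpha> \<and>
           det_weight_integrable A K\<^sub>\<alpha> \<and>
           (\<forall>S. compact S \<and> bounded ((\<lambda>u. det (A u)) ` (S \<inter> D)) \<longrightarrow>
              set_integrable lebesgue S K\<^sub>\<alpha>) \<and>
           hausdorff_bounded A K\<^sub>\<alpha> \<and>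
           is_fractional_power (hausdorff_op A K) \<alpha> (hausdorff_op A K\<^sub>\<alpha>)"
proof -
  interpret diagonal_family C D A a
    by unfold_locales (use assms in auto)
  have "AE t in lebesgue. b t \<in> D \<and> (\<forall>k. a (b t) $ k = exp (t $ k))"
    using assms(9) by eventually_elim blast
  then obtain K' where K': "K' \<in> borel_measurable lebesgue" "defined_on_support D A K'" "det_weight_integrable A K'"
    "\<And>S. compact S \<Longrightarrow> bounded ((\<lambda>u. det (A u)) ` (S \<inter> D)) \<Longrightarrow> set_integrable lebesgue S K'"
    "\<And>s. (LINT u|lebesgue. weighted K' u * cis (- (s \<bullet> logs u))) = fourier_transform Q s"
    using assms(10,11,16) by (rule ex_kernel_of_symbol) blast
  define \<phi> where "\<phi> s = Re (scalar_symbol a K s)" for s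
  have \<phi>: "scalar_symbol a K s = of_real (\<phi> s)" "\<phi> s \<ge> 0" for s
    using assms(15)[rule_format, of s] by (auto simp: \<phi>_def complex_nonneg_Reals_iff complex_eq_iff)
  have B: "has_symbol (hausdorff_op A K) (\<lambda>s. of_real (\<phi> s))"
    using hausdorff_symbol(2)[OF assms(13,14)] by (simp only: scalar_symbol_eq[OF assms(13), symmetric] \<phi>(1))
  \<comment> \<open>The boundedness clause of \<open>has_symbol\<close> supplies the compact
    interval on which the functional calculus works.\<close>
  then obtain M where M: "\<And>s. cmod (of_real (\<phi> s)) \<le> M" by (auto simp: has_symbol_def)
  have "\<phi> s \<in> {0..M}" for s using M[of s] \<phi>(2)[of s] by simp
  moreover have "has_symbol (hausdorff_op A K') (\<lambda>s. of_real (\<phi> s) powr \<alpha>)"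
    using hausdorff_symbol(2)[OF K'(2,3)] assms(17) by (simp only: K'(5) \<phi>(1))
  ultimately have "is_fractional_power (hausdorff_op A K) \<alpha> (hausdorff_op A K')"
    using assms(1) by (intro has_symbol_fractional_power[OF B])
  then show ?thesis
    using K'(1-4) hausdorff_symbol(1)[OF K'(2,3)] by blast
qed

end
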